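(* Let $N\ge 1$ be an integer and run the One-Point Zero-Order Sliding Algorithm (described in the context) for $N$ outer iterations with parameters $$p_t=\frac t2,\qquad \theta_t=\frac{2(t+1)}{t(t+3)}\quad(t\ge 1),$$ $$\beta_k=\frac{2L}{k},\qquad \gamma_k=\frac{2}{k+1},\qquad T_k=\max\left\{1;\ \left\lceil \frac{N(2\tilde G^2+\rho^2)k^2}{D_{\mathcal X,V}^2L^2}\right\rceil\right\}\quad (k\ge 1),$$ where $$\tilde G=2p(n)\sqrt n\,G,\qquad \rho^2=24\,n\,p^2(n)G^2+\frac{4n^2p^2(n)\sigma^2}{r^2}.$$ Then $$\mathbb E[\Psi_0(\overline x_N)-\Psi_0(x^* )]\le \frac{20LD_{\mathcal X,V}^2}{N(N+1)}+2rG .$$ Additionally, the total number $T^{\rm total}=\sum_{k=1}^N T_k$ of inner (PS procedure) iterations satisfies $$T^{\rm total}\le \frac{(N+1)^4}{D_{\mathcal X,V}^2L^2}\left(20\,p^2(n)\,n\,G^2+\frac{2p^2(n)n^2\sigma^2}{r^2}\right)+N .$$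
   Context: Setting. $\|\cdot\|=\|\cdot\|_p$ is an $\ell_p$-norm on $\mathbb R^n$, with dual norm $\|\cdot\|_*=\|\cdot\|_q$, $\frac1p+\frac1q=1$. $\mathcal X\subset\mathbb R^n$ is a nonempty compact convex set. $\nu$ is a continuously differentiable function that is $1$-strongly convex w.r.t. $\|\cdot\|$ on $\mathcal X$; the Bregman divergence is $V(x,y)=\nu(y)-\nu(x)-\langle\nabla\nu(x),y-x\rangle$, and $D_{\mathcal X,V}=\max\{\sqrt{2V(x,y)}: x,y\in\mathcal X\}$. The problem is $\min_{x\in\mathcal X}\Psi_0(x)=f(x)+g(x)$, with a solution $x^*$. The function $g$ is convex and $L$-smooth w.r.t. $\|\cdot\|$ on $\mathcal X$: $\|\nabla g(x)-\nabla g(y)\|_*\le L\|x-y\|$, $L>0$. The function $f$ (possibly non-differentiable) is convex and $G$-Lipschitz w.r.t. $\|\cdot\|_2$, $G>0$, on the neighbourhood $\{x+z: x\in\mathcal X,\|z\|_2\le r\}$ of $\mathcal X$, where $r>0$ is the smoothing parameter. Oracles. The gradient $\nabla g$ is available. For $f$ only noisy values $f(x,\xi)=f(x)+\xi$ are available, where $\xi$ is random, generated independently of the point, with $\mathbb E\xi=0$, $\mathbb E[\xi^2]\le\sigma^2$. The one-point gradient estimate is $$\tilde f'_r(x,\xi^{\pm})=\frac{n}{2r}\bigl(f(x+re,\xi^+)-f(x-re,\xi^-)\bigr)e,$$ with $e$ uniformly distributed on the unit Euclidean sphere of $\mathbb R^n$ and $\xi^+,\xi^-$ random noises generated independently of the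 points, with $\mathbb E\xi^{+}=\mathbb E\xi^{-}=0$, $\mathbb E[(\xi^{+})^2]\le\sigma^2$, $\mathbb E[(\xi^{-})^2]\le\sigma^2$, independent of $e$; fresh $e,\xi^\pm$, independent of the past, are drawn at each call. Constant. $p(n)>0$ is given by $p^2(n)=\min\{2q-1,\,32\log n-8\}\,n^{2/q-1}$, a quantity satisfying $\sqrt{\mathbb E[\|e\|_*^4]}\le p^2(n)$ (so implicitly $n\ge2$; for $q=\infty$ read $2/q=0$, $2q-1=\infty$). One-Point Zero-Order Sliding Algorithm. Input $x_0\in\mathcal X$, $N$, and sequences $\beta_k,\gamma_k,p_t,\theta_t>0$, $T_k\in\mathbb N$. Set $\overline x_0=x_0$. For $k=1,\dots,N$: set $\underline x_k=(1-\gamma_k)\overline x_{k-1}+\gamma_kx_{k-1}$; let $h_k(y)=g(\underline x_k)+\langle\nabla g(\underline x_k),y-\underline x_k\rangle$; set $(x_k,\tilde x_k)=\mathrm{PS}(h_k,x_{k-1},\beta_k,T_k)$; set $\overline x_k=(1-\gamma_k)\overline x_{k-1}+\gamma_k\tilde x_k$. Output $\overline x_N$. Procedure $\mathrm{PS}(h,x,\beta,T)$: set $u_0=\tilde u_0=x$; for $t=1,\dots,T$ set $$u_t=\arg\min_{u\in\mathcal X}\{h(u)+\langle\tilde f'_r(u_{t-1},\xi^\pm_{t-1}),u\rangle+\beta V(x,u)+\beta p_tV(u_{t-1},u)\},\qquad \tilde u_t=(1-\theta_t)\tilde u_{t-1}+\theta_tu_t;$$ return $(u_T,\tilde u_T)$.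 *)

theory Defs
  imports "HOL-Probability.Probability"
begin

section \<open>Norms and gradients\<close>

definition lp_norm :: "ereal \<Rightarrow> real^'n \<Rightarrow> real" where
  "lp_norm p x =
     (if p = \<infinity> then infnorm x
      else (\<Sum>i\<in>UNIV. \<bar>x $ i\<bar> powr real_of_ereal p) powr (1 / real_of_ereal p))"

text \<open>The derivative is taken within \<open>S\<close>, so one-sided gradients on the boundary are allowed; the
  ordinary gradient of a function differentiable around \<open>S\<close> is a special case. If \<open>S\<close> has empty
  interior, \<open>f'\<close> may be any choice of gradient.\<close>

definition has_gradient_on :: "('a::real_inner \<Rightarrow> real) \<Rightarrow> ('a \<Rightarrow> 'a) \<Rightarrow> 'a set \<Rightarrow> bool" where
  "has_gradient_on f f' S \<longleftrightarrow>
     (\<forall>x\<in>S. (f has_derivative (\<lambda>h. f' x \<bullet> h)) (at x within S))"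

definition strongly_convex_on ::
    "('a::real_vector \<Rightarrow> real) \<Rightarrow> real \<Rightarrow> 'a set \<Rightarrow> ('a \<Rightarrow> real) \<Rightarrow> bool" where
  "strongly_convex_on nrm \<mu> S f \<longleftrightarrow> convex S \<and>
     (\<forall>x\<in>S. \<forall>y\<in>S. \<forall>u\<ge>0. \<forall>v\<ge>0. u + v = 1 \<longrightarrow>
        f (u *\<^sub>R x + v *\<^sub>R y) \<le> u * f x + v * f y - \<mu> / 2 * u * v * (nrm (x - y))\<^sup>2)"

definition smooth_on ::
    "('a::real_inner \<Rightarrow> real) \<Rightarrow> ('a \<Rightarrow> real) \<Rightarrow> real \<Rightarrow> 'a set \<Rightarrow> ('a \<Rightarrow> real) \<Rightarrow> ('a \<Rightarrow> 'a) \<Rightarrow> bool"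
  where
  "smooth_on nrm dual L S f f' \<longleftrightarrow> has_gradient_on f f' S \<and>
     (\<forall>x\<in>S. \<forall>y\<in>S. dual (f' x - f' y) \<le> L * nrm (x - y))"

definition bregman :: "('a::real_inner \<Rightarrow> real) \<Rightarrow> ('a \<Rightarrow> 'a) \<Rightarrow> 'a \<Rightarrow> 'a \<Rightarrow> real" where
  "bregman \<nu> \<nu>' x y = \<nu> y - \<nu> x - \<nu>' x \<bullet> (y - x)"

text \<open>For a nonempty compact set and a continuously differentiable \<open>\<nu>\<close> the supremum is attained,
  so it is the maximum.\<close>

definition bregman_diam ::
    "'a::real_inner set \<Rightarrow> ('a \<Rightarrow> real) \<Rightarrow> ('a \<Rightarrow> 'a) \<Rightarrow> real" where
  "bregman_diam S \<nu> \<nu>' = (SUP (x, y) \<in> S \<times> S. sqrt (2 * bregman \<nu> \<nu>' x y))"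


section \<open>The zeroth-order oracle\<close>

text \<open>Normalising a uniform point of the ball gives the normalised surface (= cone) measure of the
  Euclidean sphere; \<open>sgn x\<close> is \<open>x\<close> divided by its norm, and the origin is a null set.\<close>

definition uniform_sphere :: "(real^'n) measure" where
  "uniform_sphere = distr (uniform_measure lborel (ball 0 1)) borel sgn"

definition noisy_value :: "('a \<Rightarrow> real) \<Rightarrow> 'a \<Rightarrow> real \<Rightarrow> real" where
  "noisy_value f x \<xi> = f x + \<xi>"

definition one_point_grad ::
    "(real^'n \<Rightarrow> real) \<Rightarrow> real \<Rightarrow> real^'n \<Rightarrow> real^'n \<Rightarrow> real \<Rightarrow> real \<Rightarrow> real^'n" where
  "one_point_grad f r x e \<xi>p \<xi>m =
     (real CARD('n) / (2 * r) *
        (noisy_value f (x + r *\<^sub>R e) \<xi>p - noisy_value f (x - r *\<^sub>R e) \<xi>m)) *\<^sub>R e"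

text \<open>The arithmetic of \<^typ>\<open>ereal\<close> gives \<open>2 / q = 0\<close> and \<open>2 * q - 1 = \<infinity>\<close> for \<open>q = \<infinity>\<close>.\<close>

definition p_const :: "ereal \<Rightarrow> nat \<Rightarrow> real" where
  "p_const q n = sqrt (real_of_ereal (min (2 * q - 1) (ereal (32 * ln (real n) - 8))) *
                       real n powr (real_of_ereal (2 / q) - 1))"


section \<open>The sliding algorithm\<close>

text \<open>\<open>G t u\<close> is the estimate of the subgradient at \<open>u\<close> obtained from the \<open>t\<close>-th sample, \<open>t\<close> counting
  from \<open>0\<close>. The \<open>t\<close>-th state is the pair \<open>(u\<^sub>t, \<tilde>u\<^sub>t)\<close>.\<close>

primrec prox_sliding ::
    "'a::real_inner set \<Rightarrow> ('a \<Rightarrow> 'a \<Rightarrow> real) \<Rightarrow> (nat \<Rightarrow> real) \<Rightarrow> (nat \<Rightarrow> real) \<Rightarrow> (nat \<Rightarrow> 'a \<Rightarrow> 'a) \<Rightarrow>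
     ('a \<Rightarrow> real) \<Rightarrow> 'a \<Rightarrow> real \<Rightarrow> nat \<Rightarrow> 'a \<times> 'a" where
  "prox_sliding S V p \<theta> G h x \<beta> 0 = (x, x)"
| "prox_sliding S V p \<theta> G h x \<beta> (Suc t) =
     (let (u, u_avg) = prox_sliding S V p \<theta> G h x \<beta> t;
          u_new = arg_min_on (\<lambda>v. h v + G t u \<bullet> v + \<beta> * V x v + \<beta> * p (Suc t) * V u v) S
      in (u_new, (1 - \<theta> (Suc t)) *\<^sub>R u_avg + \<theta> (Suc t) *\<^sub>R u_new))"

text \<open>\<open>G k\<close> is the oracle used in the \<open>k\<close>-th outer iteration, \<open>k\<close> counting from \<open>1\<close>. The \<open>k\<close>-th state
  is the pair of \<open>x\<^sub>k\<close> and the averaged iterate.\<close>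

primrec sliding ::
    "'a::real_inner set \<Rightarrow> ('a \<Rightarrow> 'a \<Rightarrow> real) \<Rightarrow> ('a \<Rightarrow> real) \<Rightarrow> ('a \<Rightarrow> 'a) \<Rightarrow>
     (nat \<Rightarrow> real) \<Rightarrow> (nat \<Rightarrow> real) \<Rightarrow> (nat \<Rightarrow> real) \<Rightarrow> (nat \<Rightarrow> real) \<Rightarrow> (nat \<Rightarrow> nat) \<Rightarrow>
     (nat \<Rightarrow> nat \<Rightarrow> 'a \<Rightarrow> 'a) \<Rightarrow> 'a \<Rightarrow> nat \<Rightarrow> 'a \<times> 'a" where
  "sliding S V g g' p \<theta> \<beta> \<gamma> T G x0 0 = (x0, x0)"
| "sliding S V g g' p \<theta> \<beta> \<gamma> T G x0 (Suc k) =
     (let (x, x_avg) = sliding S V g g' p \<theta> \<beta> \<gamma> T G x0 k;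
          x_und = (1 - \<gamma> (Suc k)) *\<^sub>R x_avg + \<gamma> (Suc k) *\<^sub>R x;
          h = (\<lambda>y. g x_und + g' x_und \<bullet> (y - x_und));
          (x_new, x_til) = prox_sliding S V p \<theta> (G (Suc k)) h x (\<beta> (Suc k)) (T (Suc k))
      in (x_new, (1 - \<gamma> (Suc k)) *\<^sub>R x_avg + \<gamma> (Suc k) *\<^sub>R x_til))"

definition sliding_output where
  "sliding_output S V g g' p \<theta> \<beta> \<gamma> T G x0 N = snd (sliding S V g g' p \<theta> \<beta> \<gamma> T G x0 N)"


section \<open>Randomness\<close>

text \<open>\<open>e k t\<close>, \<open>\<xi>p k t\<close>, \<open>\<xi>m k t\<close> are the direction and the two noises of the \<open>t\<close>-th oracle call
  (\<open>t\<close> counting from \<open>0\<close>) in outer iteration \<open>k\<close>. Triples of different calls are mutually independent,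
  which says that each call is independent of the past; within one call each of the two noises is
  independent of the direction, but the two noises may depend on each other. The directions take
  their values in the sphere everywhere (not just almost surely) because the objective is
  unconstrained away from the neighbourhood of the feasible set. Independence of a noise and the
  direction is spelled out by \<^const>\<open>prob_space.indep_set\<close> because \<open>indep_var\<close> requires both variables
  to have the same type.\<close>

definition oracle_samples ::
    "'w measure \<Rightarrow> real \<Rightarrow> nat \<Rightarrow> (nat \<Rightarrow> nat) \<Rightarrow> (nat \<Rightarrow> nat \<Rightarrow> 'w \<Rightarrow> real^'n) \<Rightarrow>
     (nat \<Rightarrow> nat \<Rightarrow> 'w \<Rightarrow> real) \<Rightarrow> (nat \<Rightarrow> nat \<Rightarrow> 'w \<Rightarrow> real) \<Rightarrow> bool" where
  "oracle_samples M \<sigma> N T e \<xi>p \<xi>m \<longleftrightarrow>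
     prob_space M \<and>
     prob_space.indep_vars M (\<lambda>_. borel) (\<lambda>(k, t) \<omega>. (e k t \<omega>, \<xi>p k t \<omega>, \<xi>m k t \<omega>))
       (SIGMA k:{1..N}. {..<T k}) \<and>
     (\<forall>k\<in>{1..N}. \<forall>t<T k.
        e k t \<in> space M \<rightarrow> sphere 0 1 \<and>
        distr M borel (e k t) = uniform_sphere \<and>
        (\<forall>\<xi>\<in>{\<xi>p k t, \<xi>m k t}.
           prob_space.indep_set M {e k t -` A \<inter> space M | A. A \<in> sets borel}
             {\<xi> -` B \<inter> space M | B. B \<in> sets borel} \<and>
           integrable M (\<lambda>\<omega>. (\<xi> \<omega>)\<^sup>2) \<and>
           prob_space.expectation M \<xi> = 0 \<and>
           prob_space.expectation M (\<lambda>\<omega>. (\<xi> \<omega>)\<^sup>2) \<le> \<sigma>\<^sup>2))"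

end

theory Submission
  imports Defs
begin

text \<open>
  A convex Lipschitz function extends to the whole space by infimal convolution, so \<open>f\<close> may be taken
  to be convex and \<open>G\<close>-Lipschitz everywhere. Averaging \<open>f\<close> over the ball of radius \<open>r\<close> changes it by
  at most \<open>r G\<close>, and the mean of the gradient estimate is a subgradient of this average: compare the
  convexity inequality for a continuous radial cutoff with its derivative, which is supported in a thin
  shell, and let the cutoff tend to the indicator of the ball.

  The second moment of the estimate is bounded through the fourth moments of \<open>f (x + r e) - f (x - r e)\<close>
  and of the dual norm of \<open>e\<close>. The former comes from the Maurey--Pisier argument: extend the function
  from the sphere to a positively homogeneous one, go from \<open>z\<close> to \<open>- z\<close> along the circle through an
  independent Gaussian copy, and use rotation invariance. The latter reduces to even moments of
  coordinates, computed with Gaussian vectors.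

  The deterministic part is Lan's gradient sliding analysis: weighting the inner steps by \<open>t + 1\<close> and
  the outer ones by \<open>k (k + 1) / 2\<close> makes both recursions telescope. Each state depends only on the past
  samples, so the error terms have the required expectations.
\<close>

section \<open>The \<open>\<ell>\<^sub>p\<close>-norms\<close>

text \<open>The delicate point is the factor \<open>n\<close> in \<open>rho2\<close>. The Lipschitz
  property alone bounds the symmetric difference of \<open>f\<close> on the sphere by
  \<open>2 * r * G\<close>, which would lead to \<open>n\<^sup>2\<close>. The missing
  \<open>1 / n\<^sup>2\<close> in the fourth moment is a concentration effect: the Gaussian bound is
  free of the dimension, and it is divided by the fourth moment of the length, at least
  \<open>n\<^sup>2\<close>. That argument needs a derivative, which \<open>f\<close> may lack, so
  \<open>f\<close> is smoothed a second time at an auxiliary radius tending to 0. The subgradient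
  property of \<open>sphere_grad\<close> thus serves twice: for the bias at radius \<open>r\<close>
  and for the approximation. Gaussian vectors are used because their coordinates are independent and
  so are their length and direction. Moment inequalities are applied as tangent lines or weighted
  means at the known bounds, which keeps them valid for integrals of nonnegative functions.
  Constants: 13824 is 4 ^ 4 times 27 / 2 times 4, its root is rounded up to 118, and half of that is
  59. The resulting \<open>B = 120 * v1 + 4 * v2\<close> is compared with
  \<open>Q = 32 * v1 + 4 * v2\<close>.\<close>

lemma young_powr_mean:
  fixes a b \<theta> :: real
  assumes "0 \<le> a" "0 < b" "0 \<le> \<theta>" "\<theta> \<le> 1"
  shows "a powr \<theta> \<le> b powr (\<theta> - 1) * (\<theta> * a + (1 - \<theta>) * b)"
proof -
  \<comment> \<open>The claim is the tangent line at \<open>b\<close> of the concave function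
    \<open>a powr \<theta>\<close>. With \<open>b\<close> a mean, or a bound on a mean, it is
    Jensen's inequality in a form that survives summation and integration.\<close>
  have "a powr \<theta> * b powr (1 - \<theta>) \<le> \<theta> * a + (1 - \<theta>) * b"
    using Youngs_inequality_0[of \<theta> "1 - \<theta>" a b] assms by (cases "a = 0") auto
  hence "b powr (\<theta> - 1) * (a powr \<theta> * b powr (1 - \<theta>)) \<le> b powr (\<theta> - 1) * (\<theta> * a + (1 - \<theta>) * b)"
    by (intro mult_left_mono) auto
  moreover have "b powr (\<theta> - 1) * (a powr \<theta> * b powr (1 - \<theta>)) = a powr \<theta> * b powr (\<theta> - 1 + (1 - \<theta>))"
    unfolding powr_add by simp
  ultimately show ?thesis using assms by simp
qed

lemma lp_norm_ereal:
  "lp_norm (ereal q) x = (\<Sum>i\<in>UNIV. \<bar>x $ i\<bar> powr q) powr (1 / q)"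
  by (simp add: lp_norm_def)

lemma lp_norm_infinity: "lp_norm \<infinity> x = infnorm x"
  by (simp add: lp_norm_def)

lemma lp_norm_nonneg [simp]: "0 \<le> lp_norm q x"
  by (simp add: lp_norm_def infnorm_pos_le)

lemma lp_norm_powr:
  assumes "1 \<le> q"
  shows "lp_norm (ereal q) x powr q = (\<Sum>i\<in>UNIV. \<bar>x $ i\<bar> powr q)"
  using assms by (simp add: lp_norm_ereal powr_powr sum_nonneg)

lemma ereal_ge_1_cases:
  assumes "(1::ereal) \<le> q"
  obtains (fin) r where "q = ereal r" "1 \<le> r" | (inf) "q = \<infinity>"
  using assms by (cases q) (auto simp: one_ereal_def)

lemma lp_norm_scaleR:
  assumes "1 \<le> q"
  shows "lp_norm q (c *\<^sub>R x) = \<bar>c\<bar> * lp_norm q x"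
  using assms
proof (cases rule: ereal_ge_1_cases)
  case (fin r)
  have "(\<Sum>i\<in>UNIV. \<bar>(c *\<^sub>R x) $ i\<bar> powr r) = \<bar>c\<bar> powr r * (\<Sum>i\<in>UNIV. \<bar>x $ i\<bar> powr r)"
    by (simp add: abs_mult powr_mult sum_distrib_left)
  thus ?thesis using fin by (simp add: lp_norm_ereal powr_mult powr_powr sum_nonneg)
qed (simp add: lp_norm_infinity infnorm_mul)

lemma abs_component_le_lp_norm:
  fixes x :: "real^'n"
  assumes "1 \<le> q"
  shows "\<bar>x $ i\<bar> \<le> lp_norm q x"
  using assms
proof (cases rule: ereal_ge_1_cases)
  case (fin r)
  have "\<bar>x $ i\<bar> powr r \<le> (\<Sum>i\<in>UNIV. \<bar>x $ i\<bar> powr r)"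
    by (rule member_le_sum) auto
  hence "(\<bar>x $ i\<bar> powr r) powr (1 / r) \<le> lp_norm q x"
    unfolding fin lp_norm_ereal using fin by (intro powr_mono2) auto
  thus ?thesis using fin by (simp add: powr_powr)
qed (simp add: lp_norm_infinity component_le_infnorm_cart)

lemma infnorm_le_lp_norm:
  fixes x :: "real^'n"
  assumes "1 \<le> q"
  shows "infnorm x \<le> lp_norm q x"
  unfolding infnorm_cart by (rule cSup_least) (auto simp: abs_component_le_lp_norm[OF assms])

text \<open>Of the exponent \<open>s'\<close>, the part \<open>s' - q'\<close> is spent on bounding
  each entry by the whole \<open>q\<close>-norm; the remaining \<open>q'\<close>-th powers sum to a
  power of that norm again.\<close>

lemma lp_norm_antimono:
  fixes x :: "real^'n"
  assumes "1 \<le> q" "q \<le> s"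
  shows "lp_norm s x \<le> lp_norm q x"
proof -
  have "1 \<le> s" using assms by order
  thus ?thesis
  proof (cases rule: ereal_ge_1_cases)
    case (fin s')
    then obtain q' where q': "q = ereal q'" "1 \<le> q'" "q' \<le> s'"
      using assms by (cases q) (auto simp: one_ereal_def)
    let ?m = "lp_norm q x"
    have "(\<Sum>i\<in>UNIV. \<bar>x $ i\<bar> powr s') \<le> (\<Sum>i\<in>UNIV. \<bar>x $ i\<bar> powr q' * ?m powr (s' - q'))"
    proof (rule sum_mono)
      fix i
      have "\<bar>x $ i\<bar> powr s' = \<bar>x $ i\<bar> powr q' * \<bar>x $ i\<bar> powr (s' - q')"
        by (simp flip: powr_add)
      also have "\<dots> \<le> \<bar>x $ i\<bar> powr q' * ?m powr (s' - q')"
        using abs_component_le_lp_norm[OF assms(1)] q' by (intro mult_left_mono powr_mono2) auto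
      finally show "\<bar>x $ i\<bar> powr s' \<le> \<dots>" .
    qed
    also have "\<dots> = ?m powr q' * ?m powr (s' - q')"
      using q' by (simp add: lp_norm_powr sum_distrib_right)
    also have "\<dots> = ?m powr s'" by (simp flip: powr_add)
    finally have "(\<Sum>i\<in>UNIV. \<bar>x $ i\<bar> powr s') powr (1 / s') \<le> (?m powr s') powr (1 / s')"
      using fin by (intro powr_mono2) (auto simp: sum_nonneg)
    thus ?thesis using fin by (simp add: lp_norm_ereal powr_powr)
  next
    case inf
    thus ?thesis using infnorm_le_lp_norm[OF assms(1)] by (simp add: lp_norm_infinity)
  qed
qed

text \<open>Sum the tangent inequality of \<open>young_powr_mean\<close> over the coordinates, with
  the tangent point \<open>S\<close> at the mean of the \<open>s\<close>-th powers: the first-order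
  terms cancel and \<open>n * S powr \<theta>\<close> remains.\<close>

lemma lp_norm_power_mean:
  fixes x :: "real^'n"
  assumes "1 \<le> q" "q \<le> s"
  shows "lp_norm (ereal q) x \<le> real CARD('n) powr (1 / q - 1 / s) * lp_norm (ereal s) x"
proof (cases "x = 0")
  case True
  thus ?thesis using assms by (simp add: lp_norm_ereal)
next
  case False
  define n where "n = real CARD('n)"
  have n: "n > 0" by (simp add: n_def)
  define \<theta> where "\<theta> = q / s"
  define S where "S = (\<Sum>i\<in>UNIV. \<bar>x $ i\<bar> powr s) / n"
  have th: "0 < \<theta>" "\<theta> \<le> 1" using assms by (auto simp: \<theta>_def)
  obtain j where "x $ j \<noteq> 0" using False by (auto simp: vec_eq_iff)
  hence "0 < (\<Sum>i\<in>UNIV. \<bar>x $ i\<bar> powr s)" by (intro sum_pos2[where i=j]) auto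
  hence S: "S > 0" using n by (simp add: S_def)
  have "(\<Sum>i\<in>UNIV. \<bar>x $ i\<bar> powr q) = (\<Sum>i\<in>UNIV. (\<bar>x $ i\<bar> powr s) powr \<theta>)"
    using assms by (simp add: powr_powr \<theta>_def)
  also have "\<dots> \<le> (\<Sum>i\<in>UNIV. S powr (\<theta> - 1) * (\<theta> * (\<bar>x $ i\<bar> powr s) + (1 - \<theta>) * S))"
    using S th by (intro sum_mono young_powr_mean) auto
  also have "\<dots> = S powr (\<theta> - 1) * (\<theta> * (\<Sum>i\<in>UNIV. \<bar>x $ i\<bar> powr s) + n * ((1 - \<theta>) * S))"
    by (simp add: sum_distrib_left sum.distrib n_def distrib_left mult.assoc mult.left_commute)
  also have "\<theta> * (\<Sum>i\<in>UNIV. \<bar>x $ i\<bar> powr s) + n * ((1 - \<theta>) * S) = n * S"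
    using n by (simp add: S_def field_simps)
  also have "S powr (\<theta> - 1) * (n * S) = n * S powr \<theta>"
    using S by (simp add: powr_diff)
  finally have "lp_norm (ereal q) x \<le> (n * S powr \<theta>) powr (1 / q)"
    unfolding lp_norm_ereal using assms by (intro powr_mono2) (auto simp: sum_nonneg)
  also have "\<dots> = n powr (1 / q) * S powr (1 / s)"
    using assms n S by (simp add: powr_mult powr_powr \<theta>_def)
  also have "S powr (1 / s) = lp_norm (ereal s) x / n powr (1 / s)"
    using n by (simp add: S_def lp_norm_ereal powr_divide sum_nonneg)
  finally show ?thesis by (simp add: powr_diff n_def)
qed

lemma lp_norm_2: "lp_norm 2 (x :: real^'n) = norm x"
proof -
  have "lp_norm (ereal 2) x = norm x"
    by (simp add: lp_norm_ereal norm_vec_def L2_set_def powr_half_sqrt sum_nonneg)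
  thus ?thesis by simp
qed

text \<open>Duality arguments need either two real exponents above 1, where powers can be used, or
  one of the two extreme pairs. Two infinite exponents are excluded because both quotients would
  vanish.\<close>

lemma holder_dual_ereal:
  assumes "1 \<le> p" "1 \<le> q" "1 / p + 1 / q = (1::ereal)"
  obtains (fin) p' q' where "p = ereal p'" "q = ereal q'" "1 < p'" "1 < q'" "1 / p' + 1 / q' = 1"
    | (inf1) "p = 1" "q = \<infinity>" | (inf2) "p = \<infinity>" "q = 1"
proof -
  note * = that
  show ?thesis
  using assms(1)
  proof (cases rule: ereal_ge_1_cases)
    case (fin p')
    note F = fin
    show ?thesis using assms(2)
    proof (cases rule: ereal_ge_1_cases)
      case (fin q')
      have e: "1 / p' + 1 / q' = 1"
        using assms(3) F fin by (simp add: one_ereal_def divide_ereal_def flip: ereal_divide) (simp add: divide_inverse)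
      have "0 < 1 / p'" "0 < 1 / q'" using F fin by auto
      hence "1 / p' < 1" "1 / q' < 1" using e by linarith+
      hence "1 < p'" "1 < q'" using F fin by (auto simp: field_simps)
      thus ?thesis using *(1) F fin e by blast
    next
      case inf
      hence "1 / p' = 1" using assms(3) F by (simp add: one_ereal_def divide_ereal_def flip: ereal_divide) 
      hence "p = 1" using F by (simp add: one_ereal_def)
      thus ?thesis using *(2) inf by blast
    qed
  next
    case inf
    note F = inf
    show ?thesis using assms(2)
    proof (cases rule: ereal_ge_1_cases)
      case (fin q')
      hence "1 / q' = 1" using assms(3) F by (simp add: one_ereal_def divide_ereal_def flip: ereal_divide) 
      hence "q = 1" using fin by (simp add: one_ereal_def)
      thus ?thesis using *(3) inf by blast
    next
      case inf
      thus ?thesis using assms(3) F by simp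
    qed
  qed
qed

lemma lp_norm_eq_0_imp:
  fixes x :: "real^'n"
  assumes "1 \<le> q" "lp_norm q x = 0"
  shows "x = 0"
  using abs_component_le_lp_norm[OF assms(1), of x] assms(2) by (simp add: vec_eq_iff)

lemma infnorm_holder: "\<bar>a \<bullet> b\<bar> \<le> infnorm a * lp_norm 1 (b :: real^'n)"
proof -
  have "\<bar>a \<bullet> b\<bar> \<le> (\<Sum>i\<in>UNIV. \<bar>a $ i\<bar> * \<bar>b $ i\<bar>)"
    unfolding inner_vec_def by (rule order.trans[OF sum_abs]) (simp add: abs_mult)
  also have "\<dots> \<le> (\<Sum>i\<in>UNIV. infnorm a * \<bar>b $ i\<bar>)"
    by (intro sum_mono mult_right_mono component_le_infnorm_cart) auto
  also have "\<dots> = infnorm a * lp_norm (ereal 1) b"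
    by (simp add: lp_norm_ereal sum_distrib_left sum_nonneg)
  finally show ?thesis by (simp add: one_ereal_def)
qed

text \<open>After normalising both vectors, Young's inequality in each coordinate sums to
  \<open>1 / p' + 1 / q' = 1\<close>.\<close>

lemma lp_norm_holder:
  fixes a b :: "real^'n"
  assumes "1 \<le> p" "1 \<le> q" "1 / p + 1 / q = (1::ereal)"
  shows "\<bar>a \<bullet> b\<bar> \<le> lp_norm q a * lp_norm p b"
  using assms
proof (cases rule: holder_dual_ereal)
  case (fin p' q')
  show ?thesis
  proof (cases "a = 0 \<or> b = 0")
    case False
    let ?A = "lp_norm q a" and ?B = "lp_norm p b"
    have A: "?A > 0" using False lp_norm_eq_0_imp[OF assms(2), of a] lp_norm_nonneg[of q a] by argo
    have B: "?B > 0" using False lp_norm_eq_0_imp[OF assms(1), of b] lp_norm_nonneg[of p b] by argo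
    have "\<bar>a \<bullet> b\<bar> \<le> (\<Sum>i\<in>UNIV. \<bar>a $ i\<bar> * \<bar>b $ i\<bar>)"
      unfolding inner_vec_def by (rule order.trans[OF sum_abs]) (simp add: abs_mult)
    also have "\<dots> = ?A * ?B * (\<Sum>i\<in>UNIV. (\<bar>a $ i\<bar> / ?A) * (\<bar>b $ i\<bar> / ?B))"
      using A B by (simp add: sum_distrib_left)
    also have "(\<Sum>i\<in>UNIV. (\<bar>a $ i\<bar> / ?A) * (\<bar>b $ i\<bar> / ?B))
        \<le> (\<Sum>i\<in>UNIV. (\<bar>a $ i\<bar> / ?A) powr q' / q' + (\<bar>b $ i\<bar> / ?B) powr p' / p')"
      using A B fin by (intro sum_mono Youngs_inequality) auto
    also have "\<dots> = (\<Sum>i\<in>UNIV. \<bar>a $ i\<bar> powr q') / ?A powr q' / q' + (\<Sum>i\<in>UNIV. \<bar>b $ i\<bar> powr p') / ?B powr p' / p'"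
      using A B by (simp add: sum.distrib powr_divide sum_divide_distrib)
    also have "\<dots> = 1"
      using fin A B by (simp flip: lp_norm_powr)
    finally show ?thesis using A B by simp
  qed auto
next
  case inf1
  thus ?thesis using infnorm_holder[of a b] by (simp add: lp_norm_infinity)
next
  case inf2
  thus ?thesis using infnorm_holder[of b a] by (simp add: lp_norm_infinity inner_commute mult.commute)
qed

lemma lp_norm_measurable [measurable]: "lp_norm q \<in> borel_measurable (borel :: (real^'n) measure)"
proof (cases "q = \<infinity>")
  case True
  have "continuous_on UNIV (infnorm :: real^'n \<Rightarrow> real)" by (intro continuous_on_infnorm continuous_on_id)
  thus ?thesis using True by (simp add: lp_norm_def[abs_def] borel_measurable_continuous_onI)
next
  case False
  have "(\<lambda>x::real^'n. x $ i) \<in> borel_measurable borel" for i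
    by (intro borel_measurable_continuous_onI continuous_intros)
  thus ?thesis using False unfolding lp_norm_def[abs_def] by simp
qed

text \<open>Passing through \<open>infnorm\<close> gives a constant that is the same for every
  exponent, good enough for continuity and integrability. The constant in the rate comes from
  \<open>norm_le_p_const_lp_norm\<close>.\<close>

lemma norm_le_lp_norm:
  fixes x :: "real^'n"
  assumes "1 \<le> q"
  shows "norm x \<le> sqrt (real CARD('n)) * lp_norm q x"
proof -
  have "norm x \<le> sqrt (real CARD('n)) * infnorm x" using norm_le_infnorm[of x] by simp
  thus ?thesis using infnorm_le_lp_norm[OF assms, of x]
    by (meson mult_left_mono order.trans real_sqrt_ge_zero of_nat_0_le_iff)
qed

section \<open>Moments of the uniform distribution on the sphere\<close>

lemma emeasure_unit_ball: "emeasure lborel (ball (0::'a::euclidean_space) 1) = ennreal (unit_ball_vol (real DIM('a)))"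
  by (simp add: emeasure_ball)

lemma sgn_measurable [measurable]: "(sgn :: 'a::euclidean_space \<Rightarrow> 'a) \<in> borel_measurable borel"
  unfolding sgn_div_norm[abs_def] by measurable

lemma sets_uniform_sphere [simp, measurable_cong]: "sets uniform_sphere = sets borel"
  by (simp add: uniform_sphere_def)

lemma space_uniform_sphere [simp]: "space uniform_sphere = UNIV"
  by (simp add: uniform_sphere_def)

lemma unit_ball_vol_card_nonzero [simp]: "unit_ball_vol (real CARD('n::finite)) \<noteq> 0"
  using unit_ball_vol_pos[of "real CARD('n)"] by linarith

lemma prob_space_uniform_sphere: "prob_space (uniform_sphere :: (real^'n) measure)"
  unfolding uniform_sphere_def
  by (intro prob_space.prob_space_distr prob_space_uniform_measure) (auto simp: emeasure_unit_ball)

section \<open>Polar coordinates for the uniform measure on the sphere\<close>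

lemma nn_integral_uniform_sphere:
  fixes \<psi> :: "real^'n \<Rightarrow> ennreal"
  assumes [measurable]: "\<psi> \<in> borel_measurable borel"
  shows "(\<integral>\<^sup>+z. \<psi> (sgn z) * indicator (ball 0 1) z \<partial>lborel) =
    ennreal (unit_ball_vol (real CARD('n))) * (\<integral>\<^sup>+e. \<psi> e \<partial>uniform_sphere)"
proof -
  have "(\<integral>\<^sup>+e. \<psi> e \<partial>uniform_sphere) =
     (\<integral>\<^sup>+z. \<psi> (sgn z) * indicator (ball 0 1) z \<partial>lborel) / ennreal (unit_ball_vol (real CARD('n)))"
    unfolding uniform_sphere_def
    by (subst nn_integral_distr) (simp_all add: nn_integral_uniform_measure emeasure_unit_ball)
  moreover have "ennreal (unit_ball_vol (real CARD('n))) \<noteq> 0"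
    by (auto simp: ennreal_eq_0_iff not_le)
  ultimately show ?thesis
    by (metis ennreal_mult_divide_eq ennreal_neq_top ennreal_times_divide mult.commute)
qed

lemma nn_integral_lborel_scale:
  fixes f :: "'a::euclidean_space \<Rightarrow> ennreal"
  assumes [measurable]: "f \<in> borel_measurable borel" and "c > 0"
  shows "(\<integral>\<^sup>+z. f z \<partial>lborel) = ennreal (c ^ DIM('a)) * (\<integral>\<^sup>+z. f (c *\<^sub>R z) \<partial>lborel)"
  using assms(2)
  by (subst lborel_affine[of c 0]) (simp_all add: nn_integral_density nn_integral_distr nn_integral_cmult)

lemma nn_integral_sgn_ball:
  fixes \<psi> :: "real^'n \<Rightarrow> ennreal"
  assumes [measurable]: "\<psi> \<in> borel_measurable borel" and "0 \<le> a"
  shows "(\<integral>\<^sup>+z. \<psi> (sgn z) * indicator (ball 0 a) z \<partial>lborel) =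
    ennreal (unit_ball_vol (real CARD('n)) * a ^ CARD('n)) * (\<integral>\<^sup>+e. \<psi> e \<partial>uniform_sphere)"
proof (cases "a = 0")
  case False
  hence a: "a > 0" using assms by simp
  have *: "indicator (ball 0 a) (a *\<^sub>R z) = (indicator (ball 0 1) z :: ennreal)" for z :: "real^'n"
    using a by (auto simp: indicator_def)
  have **: "sgn (a *\<^sub>R z) = sgn z" for z :: "real^'n" using a by (simp add: sgn_scaleR)
  have [measurable]: "ball (0::real^'n) a \<in> sets borel" by simp
  have [measurable]: "(\<lambda>z. \<psi> (sgn z) * indicator (ball (0::real^'n) a) z) \<in> borel_measurable borel"
    by measurable
  show ?thesis
    using a by (subst nn_integral_lborel_scale[OF _ a])
      (simp_all add: * ** nn_integral_uniform_sphere ennreal_mult' mult_ac)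
qed simp

lemma emeasure_ball_card:
  fixes x :: "real^'n"
  assumes "0 \<le> a"
  shows "emeasure lborel (ball x a) = ennreal (unit_ball_vol (real CARD('n)) * a ^ CARD('n))"
  using assms by (simp add: emeasure_ball)

text \<open>For fixed \<open>\<psi>\<close> both sides integrate \<open>k\<close> against a measure
  on the line: the radial image of Lebesgue measure weighted by \<open>\<psi> (sgn z)\<close>, and
  the plain radial image times a constant. By scaling they agree on the rays \<open>{..<a}\<close>,
  an intersection-stable generator of the Borel sets. \<open>fin\<close> gives the rays finite
  measure, as uniqueness requires.\<close>

lemma nn_integral_polar:
  fixes \<psi> :: "real^'n \<Rightarrow> ennreal" and k :: "real \<Rightarrow> ennreal"
  assumes [measurable]: "\<psi> \<in> borel_measurable borel" "k \<in> borel_measurable borel"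
    and fin: "(\<integral>\<^sup>+e. \<psi> e \<partial>uniform_sphere) < \<infinity>"
  shows "(\<integral>\<^sup>+z. k (norm z) * \<psi> (sgn z) \<partial>lborel) =
    (\<integral>\<^sup>+e. \<psi> e \<partial>uniform_sphere) * (\<integral>\<^sup>+z. k (norm (z::real^'n)) \<partial>lborel)"
proof -
  define C where "C = (\<integral>\<^sup>+e. \<psi> e \<partial>uniform_sphere)"
  define M1 where "M1 = distr (density lborel (\<lambda>z::real^'n. \<psi> (sgn z))) borel norm"
  define M2 where "M2 = density (distr lborel borel (norm :: real^'n \<Rightarrow> real)) (\<lambda>_. C)"
  let ?E = "range (\<lambda>a::real. {..<a})"
  have vim: "norm -` {..<a} = ball (0::real^'n) a" for a by auto
  \<comment> \<open>For \<open>a < 0\<close> both balls are empty; \<open>max 0 a\<close> makes the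
    volume formula valid for every real \<open>a\<close>.\<close>
  have bm: "ball (0::real^'n) (max 0 a) = ball 0 a" for a
    by (cases "0 \<le> a") (auto simp: ball_empty)
  have m1: "emeasure M1 {..<a} = ennreal (unit_ball_vol (real CARD('n)) * (max 0 a) ^ CARD('n)) * C" for a
  proof -
    have "emeasure M1 {..<a} = (\<integral>\<^sup>+z. \<psi> (sgn z) * indicator (ball (0::real^'n) (max 0 a)) z \<partial>lborel)"
      unfolding M1_def
      by (subst emeasure_distr, simp, simp, subst emeasure_density)
         (auto simp: vim bm intro!: nn_integral_cong split: split_indicator)
    thus ?thesis by (simp add: nn_integral_sgn_ball C_def)
  qed
  have m2: "emeasure M2 {..<a} = ennreal (unit_ball_vol (real CARD('n)) * (max 0 a) ^ CARD('n)) * C" for a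
  proof -
    have "emeasure M2 {..<a} = C * emeasure lborel (ball (0::real^'n) (max 0 a))"
      unfolding M2_def
      by (subst emeasure_density) (auto simp: nn_integral_cmult_indicator emeasure_distr vim bm)
    thus ?thesis by (simp add: emeasure_ball_card mult.commute)
  qed
  have "M1 = M2"
  proof (rule measure_eqI_generator_eq[where E="?E" and \<Omega>=UNIV and A="\<lambda>i. {..<real i}"])
    have "{..<a} \<inter> {..<b} = {..<min a b}" for a b :: real by auto
    thus "Int_stable ?E" unfolding Int_stable_def by auto
    show "sets M1 = sigma_sets UNIV ?E" "sets M2 = sigma_sets UNIV ?E"
      by (simp_all add: M1_def M2_def borel_Iio)
    show "(\<Union>i. {..<real i}) = UNIV" by (auto intro: reals_Archimedean2)
    show "emeasure M1 {..<real i} \<noteq> \<infinity>" for i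
      using fin unfolding m1 C_def by (simp add: ennreal_mult_eq_top_iff)
  qed (auto simp: m1 m2)
  hence "(\<integral>\<^sup>+t. k t \<partial>M1) = (\<integral>\<^sup>+t. k t \<partial>M2)" by simp
  thus ?thesis
    unfolding M1_def M2_def
    by (simp add: nn_integral_distr nn_integral_density nn_integral_cmult C_def mult.commute)
qed

lemma AE_lborel_nonzero: "AE z in lborel. z \<noteq> (0::'a::euclidean_space)"
  by (rule AE_I[where N="{0}"]) auto

lemma AE_uniform_sphere_norm: "AE e in (uniform_sphere :: (real^'n) measure). norm e = 1"
proof -
  have "AE z in uniform_measure lborel (ball (0::real^'n) 1). norm (sgn z) = 1"
    by (rule AE_uniform_measureI) (use AE_lborel_nonzero in \<open>auto simp: norm_sgn\<close>)
  thus ?thesis unfolding uniform_sphere_def by (subst AE_distr_iff) auto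
qed

lemma nn_integral_lborel_minus:
  fixes f :: "'a::euclidean_space \<Rightarrow> ennreal"
  assumes [measurable]: "f \<in> borel_measurable borel"
  shows "(\<integral>\<^sup>+z. f (- z) \<partial>lborel) = (\<integral>\<^sup>+z. f z \<partial>lborel)"
proof -
  have "distr lborel borel uminus = (lborel :: 'a measure)"
    using lborel_affine[of "-1" "0::'a"] by (simp add: density_1)
  thus ?thesis using nn_integral_distr[of uminus lborel borel f] by simp
qed

text \<open>Reflection preserves Lebesgue measure and the ball, and it commutes with
  \<open>sgn\<close>. This symmetry gives both halves of the gradient estimate the same
  mean.\<close>

lemma uniform_sphere_uminus: "distr uniform_sphere borel uminus = (uniform_sphere :: (real^'n) measure)"
proof (rule measure_eqI)
  fix A assume "A \<in> sets (distr uniform_sphere borel (uminus :: real^'n \<Rightarrow> real^'n))"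
  hence [measurable]: "A \<in> sets borel" by simp
  let ?v = "ennreal (unit_ball_vol (real CARD('n)))"
  have v: "?v \<noteq> 0" "?v \<noteq> \<top>" by (auto simp: ennreal_eq_0_iff not_le)
  have "?v * emeasure (distr uniform_sphere borel uminus) A = ?v * (\<integral>\<^sup>+e. indicator A (- e) \<partial>uniform_sphere)"
    by (simp flip: nn_integral_indicator) (subst nn_integral_distr, auto)
  also have "\<dots> = (\<integral>\<^sup>+z. indicator A (- sgn z) * indicator (ball 0 1) z \<partial>lborel)"
    by (subst nn_integral_uniform_sphere) auto
  also have "\<dots> = (\<integral>\<^sup>+z. indicator A (sgn z) * indicator (ball (0::real^'n) 1) z \<partial>lborel)"
    using nn_integral_lborel_minus[of "\<lambda>z. indicator A (sgn z) * indicator (ball (0::real^'n) 1) z"]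
    by (simp add: sgn_minus indicator_def)
  also have "\<dots> = ?v * emeasure uniform_sphere A"
    by (subst nn_integral_uniform_sphere) auto
  finally show "emeasure (distr uniform_sphere borel uminus) A = emeasure uniform_sphere A"
    using v by (simp add: ennreal_mult_cancel_left)
qed simp

section \<open>Gaussian vectors: moments, and the independence of length and direction\<close>

definition gauss :: "(real^'n) measure" where
  "gauss = density lborel (\<lambda>z. ennreal (\<Prod>b\<in>Basis. std_normal_density (z \<bullet> b)))"

lemma sets_gauss [simp, measurable_cong]: "sets gauss = sets borel"
  by (simp add: gauss_def)

lemma space_gauss [simp]: "space gauss = UNIV"
  by (simp add: gauss_def)

lemma power2_norm_Basis: "(norm (z :: 'a::euclidean_space))\<^sup>2 = (\<Sum>b\<in>Basis. (z \<bullet> b)\<^sup>2)"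
  unfolding power2_norm_eq_inner by (subst euclidean_inner) (simp add: power2_eq_square)

lemma gauss_density_norm:
  "(\<Prod>b\<in>Basis. std_normal_density (z \<bullet> b)) =
    (1 / sqrt (2 * pi)) ^ CARD('n) * exp (- (norm (z :: real^'n))\<^sup>2 / 2)"
proof -
  have "(\<Prod>b\<in>Basis. std_normal_density (z \<bullet> b)) =
     (1 / sqrt (2 * pi)) ^ CARD('n) * (\<Prod>b\<in>Basis. exp (- (z \<bullet> b)\<^sup>2 / 2))"
    unfolding std_normal_density_def by (subst prod.distrib) simp
  also have "(\<Prod>b\<in>Basis. exp (- (z \<bullet> b)\<^sup>2 / 2)) = exp (- (norm z)\<^sup>2 / 2)"
    by (subst exp_sum[symmetric]) (auto simp: power2_norm_Basis sum_negf sum_divide_distrib)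
  finally show ?thesis .
qed

lemma nn_integral_gauss:
  assumes [measurable]: "f \<in> borel_measurable borel"
  shows "(\<integral>\<^sup>+z. f z \<partial>gauss) = (\<integral>\<^sup>+z. ennreal (\<Prod>b\<in>Basis. std_normal_density (z \<bullet> b)) * f z \<partial>lborel)"
  unfolding gauss_def by (subst nn_integral_density) auto

lemma nn_integral_gauss_prod:
  fixes f :: "real^'n \<Rightarrow> real \<Rightarrow> real"
  assumes [measurable]: "\<And>b. f b \<in> borel_measurable borel" and nn: "\<And>b t. 0 \<le> f b t"
  shows "(\<integral>\<^sup>+z. ennreal (\<Prod>b\<in>Basis. f b (z \<bullet> b)) \<partial>gauss) =
    (\<Prod>b\<in>Basis. \<integral>\<^sup>+t. ennreal (std_normal_density t * f b t) \<partial>lborel)"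
proof -
  have "(\<integral>\<^sup>+z. ennreal (\<Prod>b\<in>Basis. f b (z \<bullet> b)) \<partial>gauss) =
     (\<integral>\<^sup>+z. (\<Prod>b\<in>Basis. ennreal (std_normal_density (z \<bullet> b) * f b (z \<bullet> b))) \<partial>lborel)"
    by (subst nn_integral_gauss)
       (auto intro!: nn_integral_cong simp: prod_nonneg nn prod_ennreal prod.distrib ennreal_mult)
  also have "\<dots> = (\<Prod>b\<in>Basis. \<integral>\<^sup>+t. ennreal (std_normal_density t * f b t) \<partial>lborel)"
    by (rule nn_integral_lborel_prod) auto
  finally show ?thesis .
qed

lemma nn_integral_std_normal: "(\<integral>\<^sup>+t. ennreal (std_normal_density t) \<partial>lborel) = 1"
  by (subst nn_integral_eq_integral) auto

lemma prob_space_gauss: "prob_space (gauss :: (real^'n) measure)"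
proof
  have "emeasure (gauss :: (real^'n) measure) (space gauss) = (\<integral>\<^sup>+z. ennreal (\<Prod>b\<in>(Basis::(real^'n) set). 1::real) \<partial>(gauss :: (real^'n) measure))"
    by simp
  also have "\<dots> = 1"
    by (subst nn_integral_gauss_prod[where f="\<lambda>_ _. 1"]) (auto simp: nn_integral_std_normal)
  finally show "emeasure (gauss :: (real^'n) measure) (space gauss) = 1" .
qed

lemma gauss_moment_even:
  fixes b :: "real^'n"
  assumes b: "b \<in> Basis"
  shows "(\<integral>\<^sup>+z. ennreal ((z \<bullet> b) ^ (2 * k)) \<partial>gauss) = ennreal (fact (2 * k) / (2 ^ k * fact k))"
proof -
  let ?f = "\<lambda>b' t. if b' = b then t ^ (2 * k) else (1::real)"
  have "(z \<bullet> b) ^ (2 * k) = (\<Prod>b'\<in>Basis. ?f b' (z \<bullet> b'))" for z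
    using b by (simp add: prod.If_cases Int_absorb1 Collect_conv_if)
  hence "(\<integral>\<^sup>+z. ennreal ((z \<bullet> b) ^ (2 * k)) \<partial>gauss) = (\<integral>\<^sup>+z. ennreal (\<Prod>b'\<in>Basis. ?f b' (z \<bullet> b')) \<partial>gauss)"
    by simp
  also have "\<dots> = (\<Prod>b'\<in>Basis. \<integral>\<^sup>+t. ennreal (std_normal_density t * ?f b' t) \<partial>lborel)"
    by (rule nn_integral_gauss_prod) (auto simp: power_mult)
  also have "\<dots> = (\<Prod>b'\<in>Basis. if b' = b then \<integral>\<^sup>+t. ennreal (std_normal_density t * t ^ (2 * k)) \<partial>lborel else 1)"
    by (intro prod.cong) (auto simp: nn_integral_std_normal)
  also have "\<dots> = (\<integral>\<^sup>+t. ennreal (std_normal_density t * t ^ (2 * k)) \<partial>lborel)"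
    using b by simp
  also have "\<dots> = ennreal (fact (2 * k) / (2 ^ k * fact k))"
    by (subst nn_integral_eq_integral) (auto simp: integrable_std_normal_moment integral_std_normal_moment_even
      intro!: mult_nonneg_nonneg zero_le_even_power)
  finally show ?thesis .
qed

text \<open>In each coordinate, completing the square turns the integrand into
  \<open>exp (c\<^sup>2 / 2)\<close> times a shifted normal density.\<close>

lemma gauss_exp_moment:
  fixes a :: "real^'n"
  shows "(\<integral>\<^sup>+z. ennreal (exp (a \<bullet> z)) \<partial>gauss) = ennreal (exp ((norm a)\<^sup>2 / 2))"
proof -
  have 1: "(\<integral>\<^sup>+t. ennreal (std_normal_density t * exp (c * t)) \<partial>lborel) = ennreal (exp (c\<^sup>2 / 2))" for c
  proof -
    have "std_normal_density t * exp (c * t) = exp (c\<^sup>2 / 2) * normal_density c 1 t" for t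
      by (simp add: normal_density_def exp_add[symmetric] power2_eq_square field_simps)
    thus ?thesis
      by (simp add: ennreal_mult' nn_integral_cmult) (subst nn_integral_eq_integral, auto)
  qed
  have "exp (a \<bullet> z) = (\<Prod>b\<in>Basis. exp ((a \<bullet> b) * (z \<bullet> b)))" for z
    by (subst euclidean_inner) (simp add: exp_sum)
  hence "(\<integral>\<^sup>+z. ennreal (exp (a \<bullet> z)) \<partial>gauss) = (\<integral>\<^sup>+z. ennreal (\<Prod>b\<in>Basis. exp ((a \<bullet> b) * (z \<bullet> b))) \<partial>gauss)"
    by simp
  also have "\<dots> = (\<Prod>b\<in>Basis. ennreal (exp ((a \<bullet> b)\<^sup>2 / 2)))"
    by (subst nn_integral_gauss_prod[where f="\<lambda>b t. exp ((a \<bullet> b) * t)"]) (auto simp: 1)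
  also have "\<dots> = ennreal (exp (\<Sum>b\<in>Basis. (a \<bullet> b)\<^sup>2 / 2))"
    by (simp add: prod_ennreal exp_sum)
  also have "(\<Sum>b\<in>Basis. (a \<bullet> b)\<^sup>2 / 2) = (norm a)\<^sup>2 / 2"
    by (simp add: power2_norm_Basis sum_divide_distrib)
  finally show ?thesis .
qed

lemma gauss_norm_sq: "(\<integral>\<^sup>+z. ennreal ((norm z)\<^sup>2) \<partial>(gauss :: (real^'n) measure)) = ennreal (real CARD('n))"
proof -
  have "(\<integral>\<^sup>+z. ennreal ((norm z)\<^sup>2) \<partial>(gauss :: (real^'n) measure)) = (\<integral>\<^sup>+z. (\<Sum>b\<in>Basis. ennreal ((z \<bullet> b)^(2*1))) \<partial>(gauss :: (real^'n) measure))"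
    by (simp add: power2_norm_Basis)
  also have "\<dots> = (\<Sum>b\<in>(Basis :: (real^'n) set). 1)"
    by (subst nn_integral_sum) (use gauss_moment_even[where 'n='n and k=1] in \<open>auto intro!: sum.cong\<close>)
  finally show ?thesis by (simp add: ennreal_of_nat_eq_real_of_nat)
qed

text \<open>Jensen's inequality for the \<open>k\<close>-th power of
  \<open>(norm z)\<^sup>2 / n\<close>, a variable of mean 1. Bernoulli's inequality supplies the
  tangent at 1.\<close>

lemma gauss_norm_moment_lower:
  "ennreal (real CARD('n) ^ k) \<le> (\<integral>\<^sup>+z. ennreal (norm z ^ (2 * k)) \<partial>(gauss :: (real^'n) measure))"
proof (cases k)
  case 0
  interpret prob_space "gauss :: (real^'n) measure" by (rule prob_space_gauss)
  show ?thesis using 0 emeasure_space_1 by simp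
next
  case (Suc j)
  interpret prob_space "gauss :: (real^'n) measure" by (rule prob_space_gauss)
  define n where "n = real CARD('n)"
  have n: "n > 0" by (simp add: n_def)
  let ?I = "\<integral>\<^sup>+z. ennreal (norm z ^ (2 * k)) \<partial>(gauss :: (real^'n) measure)"
  \<comment> \<open>The negative term of Bernoulli's inequality is moved to the right, so that both
    sides are nonnegative and can be integrated in \<open>ennreal\<close>; it is cancelled at the
    end.\<close>
  have pt: "n ^ k + real k * n ^ j * (norm z)\<^sup>2 \<le> norm z ^ (2 * k) + real k * n ^ k" for z :: "real^'n"
  proof -
    have "1 + real k * ((norm z)\<^sup>2 / n - 1) \<le> (1 + ((norm z)\<^sup>2 / n - 1)) ^ k"
      by (rule Bernoulli_inequality) (use n in auto)
    hence "n ^ k * (1 + real k * ((norm z)\<^sup>2 / n - 1)) \<le> n ^ k * ((norm z)\<^sup>2 / n) ^ k"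
      using n by (intro mult_left_mono) auto
    also have "n ^ k * ((norm z)\<^sup>2 / n) ^ k = norm z ^ (2 * k)" using n by (simp add: power_divide power_mult)
    also have "n ^ k * (1 + real k * ((norm z)\<^sup>2 / n - 1)) = n ^ k + real k * n ^ j * (norm z)\<^sup>2 - real k * n ^ k"
      using n Suc by (simp add: field_simps)
    finally show ?thesis by simp
  qed
  have "ennreal (n ^ k + real k * n ^ k) = ennreal (n ^ k) + ennreal (real k * n ^ j) * ennreal n"
    using n Suc by (subst ennreal_mult'[symmetric]) (auto simp: ennreal_plus[symmetric] mult_ac simp del: ennreal_plus)
  also have "\<dots> = (\<integral>\<^sup>+z. ennreal (n ^ k + real k * n ^ j * (norm z)\<^sup>2) \<partial>(gauss :: (real^'n) measure))"
    using n by (simp add: ennreal_plus ennreal_mult nn_integral_add nn_integral_cmult gauss_norm_sq n_def emeasure_space_1[simplified])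
  also have "\<dots> \<le> (\<integral>\<^sup>+z. ennreal (norm z ^ (2 * k) + real k * n ^ k) \<partial>(gauss :: (real^'n) measure))"
    by (intro nn_integral_mono ennreal_leI pt)
  also have "\<dots> = ?I + ennreal (real k * n ^ k)"
    using n by (simp add: ennreal_plus nn_integral_add emeasure_space_1[simplified])
  finally have "ennreal (n ^ k) + ennreal (real k * n ^ k) \<le> ?I + ennreal (real k * n ^ k)"
    using n by (simp add: ennreal_plus)
  thus ?thesis unfolding n_def by (simp add: ennreal_add_left_cancel_le add.commute)
qed

text \<open>The Gaussian density is a function of the norm alone, so length and direction are
  independent. This converts Gaussian moments into moments on the sphere.\<close>

lemma gauss_polar:
  fixes \<psi> :: "real^'n \<Rightarrow> ennreal"
  assumes [measurable]: "\<psi> \<in> borel_measurable borel"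
    and fin: "(\<integral>\<^sup>+e. \<psi> e \<partial>uniform_sphere) < \<infinity>"
  shows "(\<integral>\<^sup>+z. ennreal (norm z ^ m) * \<psi> (sgn z) \<partial>gauss) =
    (\<integral>\<^sup>+e. \<psi> e \<partial>uniform_sphere) * (\<integral>\<^sup>+z. ennreal (norm z ^ m) \<partial>(gauss :: (real^'n) measure))"
proof -
  let ?k = "\<lambda>t. ennreal ((1 / sqrt (2 * pi)) ^ CARD('n) * exp (- t\<^sup>2 / 2)) * ennreal (t ^ m)"
  have "(\<integral>\<^sup>+z. ennreal (norm z ^ m) * \<psi> (sgn z) \<partial>gauss) = (\<integral>\<^sup>+z. ?k (norm z) * \<psi> (sgn z) \<partial>lborel)"
    by (subst nn_integral_gauss) (simp_all add: gauss_density_norm mult.assoc)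
  also have "\<dots> = (\<integral>\<^sup>+e. \<psi> e \<partial>uniform_sphere) * (\<integral>\<^sup>+z. ?k (norm (z::real^'n)) \<partial>lborel)"
    by (rule nn_integral_polar) (use fin in auto)
  also have "(\<integral>\<^sup>+z. ?k (norm (z::real^'n)) \<partial>lborel) = (\<integral>\<^sup>+z. ennreal (norm z ^ m) \<partial>(gauss :: (real^'n) measure))"
    by (subst nn_integral_gauss) (simp_all add: gauss_density_norm)
  finally show ?thesis .
qed

text \<open>The left side is the \<open>2 * k\<close>-th moment of a standard normal variable. Each
  of the \<open>k\<close> factors of \<open>fact (2 * k) / fact k\<close> is at most
  \<open>2 * k\<close>, and the powers of two cancel.\<close>

lemma fact_double_le: "fact (2 * k) / (2 ^ k * fact k) \<le> (real k ^ k :: real)"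
proof -
  have "fact (2 * k) div fact (2 * k - k) \<le> (2 * k) ^ k"
    by (rule fact_div_fact_le_pow) simp
  moreover have "fact k dvd (fact (2 * k) :: nat)" by (rule fact_dvd) simp
  ultimately have "fact (2 * k) \<le> (2 * k) ^ k * (fact k :: nat)"
    by (metis div_le_mono dvd_div_mult_self mult_le_mono1 add_diff_cancel_left' mult_2)
  hence "real (fact (2 * k)) \<le> real ((2 * k) ^ k * fact k)" by (rule of_nat_mono)
  thus ?thesis by (simp add: field_simps power_mult_distrib)
qed

text \<open>A coordinate of a Gaussian vector is its length times that coordinate of its direction.
  So the Gaussian moment, at most \<open>k ^ k\<close>, is the moment on the sphere times a moment
  of the length, which is at least \<open>n ^ k\<close>.\<close>

lemma sphere_moment:
  fixes b :: "real^'n"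
  assumes b: "b \<in> Basis"
  shows "(\<integral>\<^sup>+e. ennreal ((e \<bullet> b) ^ (2 * k)) \<partial>uniform_sphere) \<le> ennreal (real k ^ k / real CARD('n) ^ k)"
proof -
  interpret S: prob_space "uniform_sphere :: (real^'n) measure" by (rule prob_space_uniform_sphere)
  define n where "n = real CARD('n)"
  have n: "n > 0" by (simp add: n_def)
  let ?E = "\<integral>\<^sup>+e. ennreal ((e \<bullet> b) ^ (2 * k)) \<partial>uniform_sphere"
  have "?E \<le> (\<integral>\<^sup>+e. ennreal 1 \<partial>(uniform_sphere :: (real^'n) measure))"
  proof (rule nn_integral_mono_AE, use AE_uniform_sphere_norm in eventually_elim)
    fix e :: "real^'n" assume "norm e = 1"
    hence "\<bar>e \<bullet> b\<bar> \<le> 1" using b by (metis Basis_le_norm)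
    hence "\<bar>e \<bullet> b\<bar> ^ (2 * k) \<le> 1" by (intro power_le_one) auto
    thus "ennreal ((e \<bullet> b) ^ (2 * k)) \<le> ennreal 1" by (simp add: power_even_abs)
  qed
  hence fin: "?E < \<infinity>" using S.emeasure_space_1 by (simp add: order_le_less_trans)
  have ns: "norm z * (sgn z \<bullet> b) = z \<bullet> b" for z :: "real^'n"
    by (cases "z = 0") (auto simp: sgn_div_norm)
  have "?E * ennreal (n ^ k) \<le> ?E * (\<integral>\<^sup>+z. ennreal (norm z ^ (2 * k)) \<partial>(gauss :: (real^'n) measure))"
    unfolding n_def by (intro mult_left_mono gauss_norm_moment_lower) auto
  also have "\<dots> = (\<integral>\<^sup>+z. ennreal (norm z ^ (2 * k)) * ennreal ((sgn z \<bullet> b) ^ (2 * k)) \<partial>gauss)"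
    by (rule gauss_polar[symmetric]) (use fin in auto)
  also have "\<dots> = (\<integral>\<^sup>+z. ennreal ((z \<bullet> b) ^ (2 * k)) \<partial>gauss)"
    by (intro nn_integral_cong)
       (auto simp: ennreal_mult'[symmetric] power_mult_distrib[symmetric] ns)
  also have "\<dots> \<le> ennreal (real k ^ k)"
    using b by (simp add: gauss_moment_even ennreal_leI fact_double_le)
  finally have *: "?E * ennreal (n ^ k) \<le> ennreal (real k ^ k)" .
  obtain E where E: "?E = ennreal E" "E \<ge> 0" using fin by (cases ?E) auto
  have "E * n ^ k \<le> real k ^ k"
    using * n E by (simp add: ennreal_mult'[symmetric])
  thus ?thesis using n E unfolding n_def[symmetric] by (simp add: ennreal_leI field_simps)
qed

text \<open>Both Taylor polynomials of degree 5 have a nonnegative remainder, of the even order 6,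
  and in their sum the odd powers cancel: \<open>exp t + exp (- t)\<close> is at least
  \<open>2 + t\<^sup>2 + t ^ 4 / 12\<close>.\<close>

lemma power4_le_exp: "(t::real) ^ 4 \<le> 12 * (exp t + exp (- t))"
proof -
  obtain s where s: "exp t = (\<Sum>m<6. t ^ m / fact m) + exp s / fact 6 * t ^ 6"
    using Maclaurin_exp_le[of t 6] by blast
  obtain s' where s': "exp (- t) = (\<Sum>m<6. (- t) ^ m / fact m) + exp s' / fact 6 * (- t) ^ 6"
    using Maclaurin_exp_le[of "- t" 6] by blast
  have "exp t \<ge> (\<Sum>m<6. t ^ m / fact m)" unfolding s by simp
  moreover have "exp (- t) \<ge> (\<Sum>m<6. (- t) ^ m / fact m)" unfolding s' by simp
  ultimately have "exp t + exp (- t) \<ge> 2 + t\<^sup>2 + t ^ 4 / 12"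
    by (simp add: eval_nat_numeral fact_numeral lessThan_Suc algebra_simps)
  hence "12 * (exp t + exp (- t)) \<ge> 12 * (2 + t\<^sup>2) + t ^ 4" by (simp add: algebra_simps)
  moreover have "12 * (2 + t\<^sup>2) \<ge> 0" by simp
  ultimately show ?thesis by linarith
qed

text \<open>The exact constant would be 3. Exponential moments give 27 / 2: \<open>a\<close> is
  rescaled to length 2, where \<open>power4_le_exp\<close> costs \<open>2 * 12 / 16 * exp 2\<close>,
  and \<open>exp 2 \<le> 9\<close>.\<close>

lemma gauss_fourth_moment:
  fixes a :: "real^'n"
  shows "(\<integral>\<^sup>+z. ennreal ((a \<bullet> z) ^ 4) \<partial>gauss) \<le> ennreal (27 / 2 * norm a ^ 4)"
proof (cases "a = 0")
  case False
  define u where "u = (2 / norm a) *\<^sub>R a"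
  have nu: "norm u = 2" "norm (- u) = 2" using False by (auto simp: u_def)
  have "(\<integral>\<^sup>+z. ennreal ((a \<bullet> z) ^ 4) \<partial>gauss) \<le>
    (\<integral>\<^sup>+z. ennreal (norm a ^ 4 / 16 * 12) * (ennreal (exp (u \<bullet> z)) + ennreal (exp (- u \<bullet> z))) \<partial>gauss)"
  proof (rule nn_integral_mono)
    fix z :: "real^'n"
    have "(a \<bullet> z) ^ 4 = norm a ^ 4 / 16 * (u \<bullet> z) ^ 4"
      using False by (simp add: u_def power_mult_distrib power_divide)
    also have "\<dots> \<le> norm a ^ 4 / 16 * (12 * (exp (u \<bullet> z) + exp (- (u \<bullet> z))))"
      by (intro mult_left_mono power4_le_exp) auto
    finally have "(a \<bullet> z) ^ 4 \<le> (norm a ^ 4 / 16 * 12) * (exp (u \<bullet> z) + exp (- u \<bullet> z))"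
      by (simp only: mult.assoc inner_minus_left)
    hence "ennreal ((a \<bullet> z) ^ 4) \<le> ennreal ((norm a ^ 4 / 16 * 12) * (exp (u \<bullet> z) + exp (- u \<bullet> z)))"
      by (rule ennreal_leI)
    also have "\<dots> = ennreal (norm a ^ 4 / 16 * 12) * (ennreal (exp (u \<bullet> z)) + ennreal (exp (- u \<bullet> z)))"
      by (subst ennreal_mult') (simp_all only: ennreal_plus exp_ge_zero, simp)
    finally show "ennreal ((a \<bullet> z) ^ 4) \<le> ennreal (norm a ^ 4 / 16 * 12) * (ennreal (exp (u \<bullet> z)) + ennreal (exp (- u \<bullet> z)))" .
  qed
  also have "\<dots> = ennreal (norm a ^ 4 / 16 * 12) * (ennreal (exp 2) + ennreal (exp 2))"
    using gauss_exp_moment[of u] gauss_exp_moment[of "- u"]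
    by (simp add: nn_integral_cmult nn_integral_add nu)
  also have "\<dots> = ennreal (norm a ^ 4 * (3 / 2) * exp 2)"
    by (simp add: ennreal_plus[symmetric] ennreal_mult'[symmetric] del: ennreal_plus)
  also have "\<dots> \<le> ennreal (norm a ^ 4 * (3 / 2) * 9)"
  proof (intro ennreal_leI mult_left_mono)
    have "exp 2 = exp 1 * exp (1::real)" by (simp flip: exp_add)
    also have "\<dots> \<le> 3 * 3" by (intro mult_mono exp_le) auto
    finally show "exp 2 \<le> (9::real)" by simp
  qed auto
  finally show ?thesis by (simp add: mult_ac)
qed simp

section \<open>The constant \<open>p_const\<close> and the moments of dual norms on the
  sphere\<close>

lemma ereal_two_times_minus_one: "2 * ereal q - 1 = ereal (2 * q - 1)"
  by (simp add: one_ereal_def numeral_eq_ereal)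

text \<open>The minimum is at least 1 because \<open>q \<ge> 1\<close> and
  \<open>32 * ln 2 - 8 > 1\<close>; here \<open>n \<ge> 2\<close> enters. So the argument of the
  root is nonnegative, and later the minimum may be replaced by 1 from below.\<close>

lemma p_const_sq_fin:
  assumes "n \<ge> 2" "1 \<le> q"
  shows "(p_const (ereal q) n)\<^sup>2 = min (2 * q - 1) (32 * ln (real n) - 8) * real n powr (2 / q - 1)"
    and "1 \<le> min (2 * q - 1) (32 * ln (real n) - 8)"
proof -
  have "ln (real n) \<ge> ln 2" using assms by (subst ln_le_cancel_iff) auto
  hence l: "ln (real n) \<ge> 2 / 3" using ln2_ge_two_thirds by linarith
  thus *: "1 \<le> min (2 * q - 1) (32 * ln (real n) - 8)" using assms by auto
  have "2 / ereal q = ereal (2 / q)"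
    using assms by (simp add: numeral_eq_ereal)
  with ereal_two_times_minus_one[of q] show "(p_const (ereal q) n)\<^sup>2 = min (2 * q - 1) (32 * ln (real n) - 8) * real n powr (2 / q - 1)"
    using * unfolding p_const_def by (subst real_sqrt_pow2) (auto simp: min_def)
qed

lemma p_const_sq_inf:
  assumes "n \<ge> 2"
  shows "(p_const \<infinity> n)\<^sup>2 = (32 * ln (real n) - 8) * real n powr (- 1)"
    and "1 \<le> 32 * ln (real n) - 8"
proof -
  have "ln (real n) \<ge> ln 2" using assms by (subst ln_le_cancel_iff) auto
  thus *: "1 \<le> 32 * ln (real n) - 8" using ln2_ge_two_thirds by linarith
  have "2 * \<infinity> - 1 = (\<infinity>::ereal)" "2 / \<infinity> = (0::ereal)" by auto
  thus "(p_const \<infinity> n)\<^sup>2 = (32 * ln (real n) - 8) * real n powr (- 1)"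
    using * unfolding p_const_def by (subst real_sqrt_pow2) (auto simp: min_def)
qed

lemma p_const_pos:
  assumes "n \<ge> 2" "1 \<le> q"
  shows "0 < p_const q n"
proof -
  have "0 < real_of_ereal (min (2 * q - 1) (ereal (32 * ln (real n) - 8)))"
    using assms(2)
  proof (cases rule: ereal_ge_1_cases)
    case (fin r)
    hence "min (2 * q - 1) (ereal (32 * ln (real n) - 8)) = ereal (min (2 * r - 1) (32 * ln (real n) - 8))"
      using ereal_two_times_minus_one[of r] by (simp add: min_def)
    thus ?thesis
      using p_const_sq_fin(2)[OF assms(1) fin(2)] by (metis less_le_trans real_of_ereal.simps(1) zero_less_one)
  next
    case inf
    thus ?thesis using p_const_sq_inf(2)[OF assms(1)] by (simp add: min_def)
  qed
  thus ?thesis using assms by (simp add: p_const_def)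
qed

lemma power4_eq_square: "x ^ 4 = (x\<^sup>2)\<^sup>2" for x :: real
  by (simp flip: power_mult)

lemma powr_square: "(x powr a)\<^sup>2 = x powr (2 * a)" for x a :: real
  by (simp add: powr_powr power2_eq_square flip: powr_add)

text \<open>For an even exponent the sum of powers is a polynomial, whose mean
  \<open>sphere_moment\<close> controls. The fourth power of the norm is the power
  \<open>\<theta> = 2 / k\<close> of that sum, concave because \<open>k \<ge> 2\<close>, so Jensen's
  inequality applies in its tangent form.\<close>

lemma sphere_even_lp_moment:
  assumes "k \<ge> 2"
  shows "(\<integral>\<^sup>+e. ennreal (lp_norm (ereal (2 * real k)) e ^ 4) \<partial>(uniform_sphere :: (real^'n) measure))
    \<le> ennreal ((real k * real CARD('n) powr (1 / real k - 1))\<^sup>2)"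
proof -
  interpret S: prob_space "uniform_sphere :: (real^'n) measure" by (rule prob_space_uniform_sphere)
  define n where "n = real CARD('n)"
  have n: "n > 0" by (simp add: n_def)
  define \<theta> where "\<theta> = 2 / real k"
  have th: "0 \<le> \<theta>" "\<theta> \<le> 1" using assms by (auto simp: \<theta>_def)
  \<comment> \<open>The bound of \<open>sphere_moment\<close> for the mean of the sum of
    \<open>2 * k\<close>-th powers. The tangent taken at this point integrates to at most
    \<open>s powr \<theta>\<close>.\<close>
  define s where "s = n * (real k ^ k / n ^ k)"
  have s: "s > 0" using n assms by (auto simp: s_def)
  have pt: "lp_norm (ereal (2 * real k)) e ^ 4 \<le> s powr (\<theta> - 1) * (\<theta> * (\<Sum>b\<in>Basis. (e \<bullet> b) ^ (2 * k)) + (1 - \<theta>) * s)"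
    for e :: "real^'n"
  proof -
    let ?S = "\<Sum>i\<in>UNIV. \<bar>e $ i\<bar> powr (2 * real k)"
    have "lp_norm (ereal (2 * real k)) e ^ 4 = lp_norm (ereal (2 * real k)) e powr 4"
      by (cases "lp_norm (ereal (2 * real k)) e = 0") (simp_all add: less_le)
    also have "\<dots> = ?S powr \<theta>"
      using assms by (simp add: lp_norm_ereal powr_powr \<theta>_def sum_nonneg)
    also have "\<dots> \<le> s powr (\<theta> - 1) * (\<theta> * ?S + (1 - \<theta>) * s)"
      using th s by (intro young_powr_mean sum_nonneg) auto
    also have "?S = (\<Sum>i\<in>UNIV. (e $ i) ^ (2 * k))"
    proof (intro sum.cong refl)
      fix i
      have "\<bar>e $ i\<bar> powr (2 * real k) = \<bar>e $ i\<bar> powr real (2 * k)" by simp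
      also have "\<dots> = \<bar>e $ i\<bar> ^ (2 * k)" using assms by (subst powr_realpow') auto
      finally show "\<bar>e $ i\<bar> powr (2 * real k) = (e $ i) ^ (2 * k)" by (simp add: power_even_abs)
    qed
    also have "\<dots> = (\<Sum>b\<in>Basis. (e \<bullet> b) ^ (2 * k))"
      by (simp add: Basis_vec_def sum.UNION_disjoint axis_eq_axis inner_axis)
    finally show ?thesis .
  qed
  have "(\<integral>\<^sup>+e. ennreal (lp_norm (ereal (2 * real k)) e ^ 4) \<partial>(uniform_sphere :: (real^'n) measure))
    \<le> (\<integral>\<^sup>+e. ennreal (s powr (\<theta> - 1)) * (ennreal \<theta> * (\<Sum>b\<in>Basis. ennreal ((e \<bullet> b) ^ (2 * k))) + ennreal ((1 - \<theta>) * s)) \<partial>(uniform_sphere :: (real^'n) measure))"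
  proof (rule nn_integral_mono)
    fix e :: "real^'n"
    have nn: "0 \<le> (e \<bullet> b) ^ (2 * k)" for b by (simp add: zero_le_even_power)
    have "ennreal (lp_norm (ereal (2 * real k)) e ^ 4) \<le> ennreal (s powr (\<theta> - 1) * (\<theta> * (\<Sum>b\<in>Basis. (e \<bullet> b) ^ (2 * k)) + (1 - \<theta>) * s))"
      by (rule ennreal_leI[OF pt])
    thus "ennreal (lp_norm (ereal (2 * real k)) e ^ 4) \<le> ennreal (s powr (\<theta> - 1)) * (ennreal \<theta> * (\<Sum>b\<in>Basis. ennreal ((e \<bullet> b) ^ (2 * k))) + ennreal ((1 - \<theta>) * s))"
      using th s nn by (simp add: ennreal_mult' ennreal_plus sum_nonneg sum_ennreal)
  qed
  also have "\<dots> = ennreal (s powr (\<theta> - 1)) * (ennreal \<theta> * (\<Sum>b\<in>Basis. \<integral>\<^sup>+e. ennreal ((e \<bullet> b) ^ (2 * k)) \<partial>(uniform_sphere :: (real^'n) measure)) + ennreal ((1 - \<theta>) * s))"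
    using S.emeasure_space_1 by (simp add: nn_integral_cmult nn_integral_add nn_integral_sum del: sum_ennreal)
  also have "\<dots> \<le> ennreal (s powr (\<theta> - 1)) * (ennreal \<theta> * (\<Sum>b\<in>(Basis::(real^'n) set). ennreal (real k ^ k / n ^ k)) + ennreal ((1 - \<theta>) * s))"
    unfolding n_def by (intro mult_left_mono add_mono sum_mono sphere_moment) auto
  also have "(\<Sum>b\<in>(Basis::(real^'n) set). ennreal (real k ^ k / n ^ k)) = ennreal s"
    using n by (simp add: s_def n_def ennreal_of_nat_eq_real_of_nat ennreal_mult'[symmetric])
  also have "ennreal (s powr (\<theta> - 1)) * (ennreal \<theta> * ennreal s + ennreal ((1 - \<theta>) * s)) = ennreal (s powr (\<theta> - 1) * (\<theta> * s + (1 - \<theta>) * s))"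
    using th s by (simp add: ennreal_mult' ennreal_plus)
  also have "s powr (\<theta> - 1) * (\<theta> * s + (1 - \<theta>) * s) = s powr \<theta>"
    using s by (simp add: powr_diff algebra_simps)
  also have "s powr \<theta> = (real k * n powr (1 / real k - 1))\<^sup>2"
  proof -
    have s': "s = n powr (1 - real k) * real k powr real k"
      using n assms by (simp add: s_def powr_diff powr_realpow)
    have "s powr \<theta> = n powr ((1 - real k) * \<theta>) * real k powr (real k * \<theta>)"
      unfolding s' using n assms by (simp add: powr_mult powr_powr)
    also have "real k * \<theta> = 2" using assms by (simp add: \<theta>_def)
    also have "(1 - real k) * \<theta> = 2 * (1 / real k - 1)" using assms by (simp add: \<theta>_def field_simps)
    also have "n powr (2 * (1 / real k - 1)) = (n powr (1 / real k - 1))\<^sup>2"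
      using n by (simp add: powr_powr mult.commute flip: powr_numeral)
    also have "real k powr 2 = (real k)\<^sup>2" using assms by simp
    finally show ?thesis by (simp add: power_mult_distrib mult.commute)
  qed
  finally show ?thesis by (simp add: n_def)
qed

text \<open>Exponents up to 2 are compared with the Euclidean norm, pointwise on the sphere. Beyond
  2, \<open>q\<close> is compared with an even exponent \<open>2 * k\<close>: with \<open>k\<close>
  near \<open>q / 2\<close> if \<open>2 * q - 1\<close> is the smaller entry of the minimum in
  \<open>p_const\<close>, and with \<open>k\<close> near \<open>ln n\<close> if the logarithm
  is.\<close>

lemma sphere_lp_fourth_moment:
  assumes n2: "CARD('n::finite) \<ge> 2" and q: "1 \<le> q"
  shows "(\<integral>\<^sup>+e. ennreal (lp_norm q e ^ 4) \<partial>(uniform_sphere :: (real^'n) measure))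
    \<le> ennreal (p_const q CARD('n) ^ 4)"
proof -
  interpret S: prob_space "uniform_sphere :: (real^'n) measure" by (rule prob_space_uniform_sphere)
  define n where "n = real CARD('n)"
  have n: "n \<ge> 2" using n2 by (simp add: n_def)
  have "ln n \<ge> ln 2" using n by (subst ln_le_cancel_iff) auto
  hence ln: "ln n \<ge> 2 / 3" using ln2_ge_two_thirds by linarith
  define L where "L = 32 * ln n - 8"
  have scale: "(\<integral>\<^sup>+e. ennreal (lp_norm q e ^ 4) \<partial>(uniform_sphere :: (real^'n) measure)) \<le> ennreal (p_const q CARD('n) ^ 4)"
    if k: "k \<ge> 2" and c: "0 \<le> c" "\<And>e::real^'n. lp_norm q e \<le> c * lp_norm (ereal (2 * real k)) e"
      and le: "c\<^sup>2 * (real k * n powr (1 / real k - 1)) \<le> (p_const q CARD('n))\<^sup>2" for k c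
  proof -
    have "(\<integral>\<^sup>+e. ennreal (lp_norm q e ^ 4) \<partial>(uniform_sphere :: (real^'n) measure))
      \<le> (\<integral>\<^sup>+e. ennreal (c ^ 4) * ennreal (lp_norm (ereal (2 * real k)) e ^ 4) \<partial>(uniform_sphere :: (real^'n) measure))"
    proof (rule nn_integral_mono)
      fix e :: "real^'n"
      have "lp_norm q e ^ 4 \<le> (c * lp_norm (ereal (2 * real k)) e) ^ 4" by (intro power_mono c) auto
      thus "ennreal (lp_norm q e ^ 4) \<le> ennreal (c ^ 4) * ennreal (lp_norm (ereal (2 * real k)) e ^ 4)"
        using c by (simp add: ennreal_mult'[symmetric] power_mult_distrib ennreal_leI)
    qed
    also have "\<dots> \<le> ennreal (c ^ 4) * ennreal ((real k * n powr (1 / real k - 1))\<^sup>2)"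
      unfolding n_def by (subst nn_integral_cmult) (auto intro!: mult_left_mono sphere_even_lp_moment k)
    also have "\<dots> = ennreal ((c\<^sup>2 * (real k * n powr (1 / real k - 1)))\<^sup>2)"
      using c by (simp add: ennreal_mult'[symmetric] power_mult_distrib flip: power_mult)
    also have "\<dots> \<le> ennreal (((p_const q CARD('n))\<^sup>2)\<^sup>2)"
      by (intro ennreal_leI power_mono le) auto
    finally show ?thesis unfolding power4_eq_square .
  qed
  \<comment> \<open>If the logarithmic entry is the smaller one, \<open>q\<close> is so large that
    an exponent \<open>2 * k\<close> near \<open>2 * ln n\<close> lies below it. Then
    \<open>n powr (1 / k)\<close> is at most \<open>exp 1\<close>, so a multiple of
    \<open>ln n\<close> suffices for the moment.\<close>
  have big: "(\<integral>\<^sup>+e. ennreal (lp_norm q e ^ 4) \<partial>(uniform_sphere :: (real^'n) measure)) \<le> ennreal (p_const q CARD('n) ^ 4)"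
    if L: "ereal L \<le> 2 * q - 1" and le: "L * n powr (- 1) \<le> (p_const q CARD('n))\<^sup>2"
  proof -
    define k where "k = nat \<lceil>ln n\<rceil> + 1"
    have "\<lceil>ln n\<rceil> \<ge> 1" using ln by linarith
    hence k: "k \<ge> 2" unfolding k_def by linarith
    have kl: "ln n \<le> real k" "real k \<le> ln n + 2" using ln unfolding k_def by linarith+
    have qk: "ereal (2 * real k) \<le> q"
    proof (cases q)
      case (real q')
      have "2 * ereal q' - 1 = ereal (2 * q' - 1)" by (rule ereal_two_times_minus_one)
      hence "L \<le> 2 * q' - 1" using L real by simp
      thus ?thesis using real kl ln by (simp add: L_def)
    qed (use q in auto)
    show ?thesis
    proof (rule scale[OF k, of 1])
      show "lp_norm q e \<le> 1 * lp_norm (ereal (2 * real k)) e" for e :: "real^'n"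
        using lp_norm_antimono[OF _ qk, of e] k by (simp add: one_ereal_def)
      have "n powr (1 / real k) = exp (ln n / real k)" using n by (simp add: powr_def)
      also have "\<dots> \<le> exp 1" using kl k by simp
      also have "\<dots> \<le> 3" by (rule exp_le)
      finally have "n powr (1 / real k) \<le> 3" .
      hence "real k * n powr (1 / real k) \<le> (ln n + 2) * 3"
        using kl ln by (intro mult_mono) auto
      \<comment> \<open>The inequality \<open>3 * (ln n + 2) \<le> 32 * ln n - 8\<close> holds from
        \<open>ln n = 14 / 29\<close> on, below the available 2 / 3.\<close>
      also have "\<dots> \<le> L" using ln by (simp add: L_def)
      finally have "real k * n powr (1 / real k) * n powr (- 1) \<le> L * n powr (- 1)"
        by (intro mult_right_mono) auto
      also note le
      finally show "1\<^sup>2 * (real k * n powr (1 / real k - 1)) \<le> (p_const q CARD('n))\<^sup>2"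
        using n by (simp add: powr_diff powr_minus divide_inverse mult.assoc)
    qed simp
  qed
  show ?thesis using q
  proof (cases rule: ereal_ge_1_cases)
    case inf
    show ?thesis
      by (rule big) (use p_const_sq_inf[OF n2] in \<open>auto simp: inf L_def n_def\<close>)
  next
    case (fin q')
    note pc = p_const_sq_fin[OF n2 fin(2), folded n_def, folded L_def]
    have e: "2 * ereal q' - 1 = ereal (2 * q' - 1)" by (rule ereal_two_times_minus_one)
    consider "q' \<le> 2" | "q' > 2" "2 * q' - 1 \<le> L" | "q' > 2" "L \<le> 2 * q' - 1" by linarith
    thus ?thesis
    proof cases
      case 1
      have "(\<integral>\<^sup>+e. ennreal (lp_norm q e ^ 4) \<partial>(uniform_sphere :: (real^'n) measure))
        \<le> (\<integral>\<^sup>+e. ennreal (p_const q CARD('n) ^ 4) \<partial>(uniform_sphere :: (real^'n) measure))"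
      proof (rule nn_integral_mono_AE, use AE_uniform_sphere_norm in eventually_elim)
        fix e :: "real^'n" assume e: "norm e = 1"
        have "lp_norm q e \<le> n powr (1 / q' - 1 / 2) * lp_norm (ereal 2) e"
          unfolding fin n_def by (rule lp_norm_power_mean) (use fin 1 in auto)
        hence "lp_norm q e \<le> n powr (1 / q' - 1 / 2)" using lp_norm_2[of e] e by simp
        hence "(lp_norm q e)\<^sup>2 \<le> (n powr (1 / q' - 1 / 2))\<^sup>2" by (intro power_mono) auto
        also have "\<dots> = n powr (2 / q' - 1)"
          by (simp add: powr_square right_diff_distrib)
        also have "\<dots> \<le> (p_const q CARD('n))\<^sup>2"
          using mult_right_mono[OF pc(2), of "n powr (2 / q' - 1)"] unfolding fin(1) pc(1) by simp
        finally have "((lp_norm q e)\<^sup>2)\<^sup>2 \<le> ((p_const q CARD('n))\<^sup>2)\<^sup>2" by (rule power_mono) auto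
        thus "ennreal (lp_norm q e ^ 4) \<le> ennreal (p_const q CARD('n) ^ 4)"
          unfolding power4_eq_square by (rule ennreal_leI)
      qed
      thus ?thesis using S.emeasure_space_1 by simp
    next
      case 2
      \<comment> \<open>The least \<open>k \<ge> 2\<close> with \<open>q' \<le> 2 * k\<close>;
        rounding keeps \<open>k \<le> 2 * q' - 1\<close>. The power of \<open>n\<close> lost by
        passing from \<open>q'\<close> to \<open>2 * k\<close>, squared, combines with the one of
        the moment bound to exactly \<open>n powr (2 / q' - 1)\<close>.\<close>
      define k where "k = max 2 (nat \<lceil>q' / 2\<rceil>)"
      have k: "k \<ge> 2" "q' \<le> 2 * real k" "real k \<le> 2 * q' - 1"
        using 2 unfolding k_def by (auto simp: max_def) linarith+
      show ?thesis
      proof (rule scale[OF k(1), of "n powr (1 / q' - 1 / (2 * real k))"])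
        show "lp_norm q e \<le> n powr (1 / q' - 1 / (2 * real k)) * lp_norm (ereal (2 * real k)) e" for e :: "real^'n"
          unfolding fin n_def by (rule lp_norm_power_mean) (use fin k in auto)
        have "(n powr (1 / q' - 1 / (2 * real k)))\<^sup>2 = n powr (2 / q' - 1 / real k)"
          using k by (simp add: powr_square right_diff_distrib)
        hence "(n powr (1 / q' - 1 / (2 * real k)))\<^sup>2 * (real k * n powr (1 / real k - 1)) = real k * n powr (2 / q' - 1)"
          using n by (simp add: mult.left_commute flip: powr_add)
        also have "\<dots> \<le> (2 * q' - 1) * n powr (2 / q' - 1)" using k by (intro mult_right_mono) auto
        also have "\<dots> = (p_const q CARD('n))\<^sup>2" unfolding fin(1) pc(1) using 2 by simp
        finally show "(n powr (1 / q' - 1 / (2 * real k)))\<^sup>2 * (real k * n powr (1 / real k - 1)) \<le> (p_const q CARD('n))\<^sup>2" .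
      qed simp
    next
      case 3
      show ?thesis
      proof (rule big)
        show "ereal L \<le> 2 * q - 1" using 3 e fin by simp
        have "L * n powr (- 1) \<le> L * n powr (2 / q' - 1)"
          using n fin pc(2) by (intro mult_left_mono powr_mono) auto
        thus "L * n powr (- 1) \<le> (p_const q CARD('n))\<^sup>2" unfolding fin(1) pc(1) using 3 by simp
      qed
    qed
  qed
qed

text \<open>Turns a Euclidean Lipschitz constant into one for the \<open>p\<close>-norm, as the
  mirror steps require. It suffices that the squared comparison constant is at most \<open>n\<close>
  times the square of \<open>p_const\<close>; that square is 1 for \<open>p \<le> 2\<close>,
  \<open>n powr (2 / q - 1)\<close> for finite \<open>p > 2\<close>, and \<open>n\<close> for
  \<open>p = \<infinity>\<close>.\<close>

lemma norm_le_p_const_lp_norm: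
  fixes x :: "real^'n"
  assumes n2: "CARD('n) \<ge> 2" and pq: "1 \<le> p" "1 \<le> q" "1 / p + 1 / q = (1::ereal)"
  shows "norm x \<le> sqrt (real CARD('n)) * p_const q CARD('n) * lp_norm p x"
proof -
  define n where "n = real CARD('n)"
  have n: "n \<ge> 2" using n2 by (simp add: n_def)
  have sq: "c \<le> sqrt n * p_const q CARD('n)" if "c\<^sup>2 \<le> n * (p_const q CARD('n))\<^sup>2" for c
  proof -
    have "p_const q CARD('n) \<ge> 0" using p_const_pos[OF n2 pq(2)] by simp
    hence nn: "0 \<le> sqrt n * p_const q CARD('n)" using n by simp
    have "(sqrt n * p_const q CARD('n))\<^sup>2 = n * (p_const q CARD('n))\<^sup>2"
      unfolding power_mult_distrib by (subst real_sqrt_pow2) (use n in auto)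
    hence "c\<^sup>2 \<le> (sqrt n * p_const q CARD('n))\<^sup>2" using that by argo
    thus ?thesis using nn by (rule power2_le_imp_le)
  qed
  have "\<exists>c\<ge>0. norm x \<le> c * lp_norm p x \<and> c\<^sup>2 \<le> n * (p_const q CARD('n))\<^sup>2"
    using pq
  proof (cases rule: holder_dual_ereal)
    case (fin p' q')
    note pc = p_const_sq_fin[OF n2, of q', folded n_def]
    have q1: "1 \<le> q'" using fin by simp
    have pc': "n powr (2 / q' - 1) \<le> (p_const q CARD('n))\<^sup>2"
      using mult_right_mono[OF pc(2)[OF q1], of "n powr (2 / q' - 1)"] unfolding fin(2) pc(1)[OF q1] by simp
    have one: "1 \<le> n * (p_const q CARD('n))\<^sup>2"
    proof -
      have "1 \<le> n * n powr (2 / q' - 1)" using n fin by (simp add: powr_diff ge_one_powr_ge_zero)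
      also have "\<dots> \<le> n * (p_const q CARD('n))\<^sup>2" using n pc' by (intro mult_left_mono) auto
      finally show ?thesis .
    qed
    show ?thesis
    proof (cases "p' \<le> 2")
      case True
      hence "norm x \<le> 1 * lp_norm p x"
        using lp_norm_antimono[of p "ereal 2" x] lp_norm_2[of x] fin pq by simp
      thus ?thesis using one by (intro exI[of _ 1]) auto
    next
      case False
      have "norm x \<le> n powr (1 / 2 - 1 / p') * lp_norm p x"
        using lp_norm_power_mean[of 2 p' x] lp_norm_2[of x] False fin by (simp add: n_def)
      moreover have "1 / 2 - 1 / p' = 1 / q' - 1 / 2" using fin by simp
      moreover have "(n powr (1 / q' - 1 / 2))\<^sup>2 = n powr (2 / q' - 1)"
        by (simp add: powr_square right_diff_distrib)
      moreover have "n powr (2 / q' - 1) \<le> n * (p_const q CARD('n))\<^sup>2"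
        using pc' n mult_right_mono[of 1 n "(p_const q CARD('n))\<^sup>2"] by simp
      ultimately show ?thesis by (intro exI[of _ "n powr (1 / q' - 1 / 2)"]) auto
    qed
  next
    case inf1
    note pc = p_const_sq_inf[OF n2, folded n_def]
    have "norm x \<le> 1 * lp_norm p x"
      using lp_norm_antimono[of 1 "ereal 2" x] lp_norm_2[of x] inf1 by simp
    moreover have "1\<^sup>2 \<le> n * (p_const q CARD('n))\<^sup>2"
      unfolding inf1 pc(1) using pc(2) n by (simp add: powr_minus field_simps)
    ultimately show ?thesis by (intro exI[of _ 1]) auto
  next
    case inf2
    note pc = p_const_sq_fin[OF n2, of 1, folded n_def]
    have "norm x \<le> sqrt n * lp_norm p x"
      using norm_le_lp_norm[of p x] pq by (simp add: n_def)
    moreover have "1 \<le> n" using n by simp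
    moreover have "1 * n \<le> (p_const q CARD('n))\<^sup>2"
      unfolding inf2 one_ereal_def pc(1)[OF order.refl] using pc(2) n by (intro mult_mono) auto
    hence "(sqrt n)\<^sup>2 \<le> n * (p_const q CARD('n))\<^sup>2"
      using n mult_right_mono[of 1 n "(p_const q CARD('n))\<^sup>2"] by simp
    ultimately show ?thesis using n by (intro exI[of _ "sqrt n"]) auto
  qed
  then obtain c where "norm x \<le> c * lp_norm p x" "c \<le> sqrt n * p_const q CARD('n)"
    using sq by blast
  thus ?thesis unfolding n_def by (meson lp_norm_nonneg mult_right_mono order.trans)
qed

section \<open>Smoothing over a ball\<close>

lemma lipschitz_UNIV_D: "G-lipschitz_on UNIV f \<Longrightarrow> \<bar>f x - f y\<bar> \<le> G * norm (x - y)" for f :: "'a::real_normed_vector \<Rightarrow> real"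
  using lipschitz_onD[of G UNIV f x y] by (simp add: dist_norm)

lemma lipschitz_UNIV_shift: "G-lipschitz_on UNIV f \<Longrightarrow> \<bar>f (x + z) - f (y + z)\<bar> \<le> G * norm (x - y)" for f :: "'a::real_normed_vector \<Rightarrow> real"
  using lipschitz_UNIV_D[of G f "x + z" "y + z"] by simp

lemma lipschitz_UNIV_measurable:
  "G-lipschitz_on UNIV (f :: 'a::euclidean_space \<Rightarrow> real) \<Longrightarrow> f \<in> borel_measurable borel"
  by (intro borel_measurable_continuous_onI lipschitz_on_continuous_on)

lemma integrable_lborel_bounded_support:
  fixes h :: "'a::euclidean_space \<Rightarrow> real"
  assumes [measurable]: "h \<in> borel_measurable borel" and b: "\<And>z. \<bar>h z\<bar> \<le> C * indicator (cball 0 R) z"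
  shows "integrable lborel h"
proof (rule Bochner_Integration.integrable_bound)
  have "emeasure lborel (cball (0::'a) R) < \<infinity>" by (rule emeasure_lborel_cball_finite)
  thus "integrable lborel (\<lambda>z. C * indicator (cball (0::'a) R) z)"
    by (intro integrable_mult_right) (simp add: integrable_indicator_iff less_top)
  show "AE z in lborel. norm (h z) \<le> norm (C * indicator (cball 0 R) z)"
    using b by (intro AE_I2) (metis abs_ge_self order.trans real_norm_def)
qed simp

lemma integral_lborel_translate:
  fixes h :: "'a::euclidean_space \<Rightarrow> real"
  assumes [measurable]: "h \<in> borel_measurable borel"
  shows "(\<integral>z. h (c + z) \<partial>lborel) = (\<integral>z. h z \<partial>lborel)"
  using integral_distr[of "(+) c" lborel borel h] by (simp add: lborel_distr_plus)

lemma measure_lborel_ball: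
  fixes x :: "real^'n"
  assumes "0 \<le> a"
  shows "measure lborel (ball x a) = unit_ball_vol (real CARD('n)) * a ^ CARD('n)"
  using assms by (simp add: measure_def emeasure_ball_card)

lemma integral_uniform_ball:
  fixes h :: "real^'n \<Rightarrow> real"
  assumes [measurable]: "h \<in> borel_measurable borel" and a: "0 < a"
  shows "(\<integral>z. indicator (ball x a) z * h z \<partial>lborel) =
    unit_ball_vol (real CARD('n)) * a ^ CARD('n) * (\<integral>z. h z \<partial>uniform_measure lborel (ball x a))"
proof -
  let ?c = "unit_ball_vol (real CARD('n)) * a ^ CARD('n)"
  have c: "?c > 0" using a by simp
  have [measurable]: "ball x a \<in> sets borel" by simp
  have "uniform_measure lborel (ball x a) = density lborel (\<lambda>z. ennreal (indicator (ball x a) z / ?c))"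
    unfolding uniform_measure_def using a c
    by (intro density_cong) (auto simp: emeasure_ball_card divide_ennreal split: split_indicator simp flip: ennreal_1)
  hence "(\<integral>z. h z \<partial>uniform_measure lborel (ball x a)) = (\<integral>z. (indicator (ball x a) z / ?c) * h z \<partial>lborel)"
    using c by (simp add: integral_density)
  also have "\<dots> = (\<integral>z. indicator (ball x a) z * h z \<partial>lborel) / ?c"
    by simp
  finally show ?thesis using c by simp
qed

lemma prob_space_uniform_ball: "0 < a \<Longrightarrow> prob_space (uniform_measure lborel (ball (x::real^'n) a))"
  by (intro prob_space_uniform_measure) (auto simp: emeasure_ball_card ennreal_eq_0_iff not_le)

lemma distr_sgn_uniform_ball:
  assumes a: "0 < a"
  shows "distr (uniform_measure lborel (ball (0::real^'n) a)) borel sgn = uniform_sphere"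
proof (rule measure_eqI)
  fix A assume "A \<in> sets (distr (uniform_measure lborel (ball (0::real^'n) a)) borel sgn)"
  hence [measurable]: "A \<in> sets borel" by simp
  let ?c = "ennreal (unit_ball_vol (real CARD('n)) * a ^ CARD('n))"
  have c: "?c \<noteq> 0" "?c \<noteq> \<top>" using a by (auto simp: ennreal_eq_0_iff not_le)
  have "emeasure (distr (uniform_measure lborel (ball (0::real^'n) a)) borel sgn) A =
    (\<integral>\<^sup>+z. indicator A (sgn z) \<partial>uniform_measure lborel (ball (0::real^'n) a))"
    by (simp flip: nn_integral_indicator) (subst nn_integral_distr, auto)
  also have "\<dots> = (\<integral>\<^sup>+z. indicator A (sgn z) * indicator (ball (0::real^'n) a) z \<partial>lborel) / ?c"
    using a by (subst nn_integral_uniform_measure) (auto simp: emeasure_ball_card)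
  also have "\<dots> = (?c * emeasure uniform_sphere A) / ?c"
    using a by (subst nn_integral_sgn_ball) auto
  also have "\<dots> = emeasure uniform_sphere A"
    using c by (metis ennreal_mult_divide_eq mult.commute)
  finally show "emeasure (distr (uniform_measure lborel (ball (0::real^'n) a)) borel sgn) A = emeasure uniform_sphere A" .
qed simp

lemma integral_sgn_ball:
  fixes \<psi> :: "real^'n \<Rightarrow> real"
  assumes [measurable]: "\<psi> \<in> borel_measurable borel" and a: "0 < a"
  shows "(\<integral>z. indicator (ball 0 a) z * \<psi> (sgn z) \<partial>lborel) =
    unit_ball_vol (real CARD('n)) * a ^ CARD('n) * (\<integral>e. \<psi> e \<partial>uniform_sphere)"
  using a by (subst integral_uniform_ball) (auto simp flip: distr_sgn_uniform_ball[OF a] simp: integral_distr)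

definition smoothed :: "(real^'n \<Rightarrow> real) \<Rightarrow> real \<Rightarrow> real^'n \<Rightarrow> real" where
  "smoothed f r x = (\<integral>z. f (x + z) \<partial>uniform_measure lborel (ball 0 r))"

text \<open>By the divergence theorem this is the gradient of \<open>smoothed f r\<close>. That
  theorem is not invoked: the subgradient inequality is proved directly, and differentiability is
  then deduced from it for convex \<open>f\<close>.\<close>

definition sphere_grad :: "(real^'n \<Rightarrow> real) \<Rightarrow> real \<Rightarrow> real^'n \<Rightarrow> real^'n" where
  "sphere_grad f r x = (real CARD('n) / r) *\<^sub>R (\<integral>e. f (x + r *\<^sub>R e) *\<^sub>R e \<partial>uniform_sphere)"

lemma AE_uniform_ball: "0 < r \<Longrightarrow> AE z in uniform_measure lborel (ball (0::real^'n) r). norm z < r"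
  by (rule AE_uniform_measureI) auto

lemma integrable_smoothed:
  fixes f :: "real^'n \<Rightarrow> real"
  assumes f: "G-lipschitz_on UNIV f" and r: "0 < r"
  shows "integrable (uniform_measure lborel (ball 0 r)) (\<lambda>z. f (x + z))"
proof -
  note [measurable] = lipschitz_UNIV_measurable[OF f]
  interpret prob_space "uniform_measure lborel (ball (0::real^'n) r)" by (rule prob_space_uniform_ball[OF r])
  show ?thesis
  proof (rule integrable_const_bound[where B="\<bar>f x\<bar> + G * r"])
    show "AE z in uniform_measure lborel (ball 0 r). norm (f (x + z)) \<le> \<bar>f x\<bar> + G * r"
      using AE_uniform_ball[OF r]
    proof eventually_elim
      case (elim z)
      have "G \<ge> 0" using f by (rule lipschitz_on_nonneg)
      hence "G * norm z \<le> G * r" using elim by (intro mult_left_mono) auto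
      thus ?case using lipschitz_UNIV_D[OF f, of "x + z" x] by simp
    qed
  qed simp
qed

lemma smoothed_close:
  fixes f :: "real^'n \<Rightarrow> real"
  assumes f: "G-lipschitz_on UNIV f" and r: "0 < r"
  shows "\<bar>smoothed f r x - f x\<bar> \<le> r * G"
proof -
  note [measurable] = lipschitz_UNIV_measurable[OF f]
  interpret prob_space "uniform_measure lborel (ball (0::real^'n) r)" by (rule prob_space_uniform_ball[OF r])
  have G: "G \<ge> 0" using f by (rule lipschitz_on_nonneg)
  have "smoothed f r x - f x = (\<integral>z. f (x + z) - f x \<partial>uniform_measure lborel (ball 0 r))"
    unfolding smoothed_def using integrable_smoothed[OF f r, of x] prob_space by simp
  also have "\<bar>\<dots>\<bar> \<le> (\<integral>z. \<bar>f (x + z) - f x\<bar> \<partial>uniform_measure lborel (ball 0 r))"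
    by (rule integral_abs_bound)
  also have "\<dots> \<le> (\<integral>z. r * G \<partial>uniform_measure lborel (ball (0::real^'n) r))"
  proof (rule integral_mono_AE)
    show "AE z in uniform_measure lborel (ball 0 r). \<bar>f (x + z) - f x\<bar> \<le> r * G"
      using AE_uniform_ball[OF r]
    proof eventually_elim
      case (elim z)
      hence "G * norm z \<le> G * r" using G by (intro mult_left_mono) auto
      thus ?case using lipschitz_UNIV_D[OF f, of "x + z" x] by (simp add: mult.commute)
    qed
  qed (use integrable_smoothed[OF f r, of x] in auto)
  also have "\<dots> = r * G" using prob_space by simp
  finally show ?thesis .
qed

lemma smoothed_lipschitz:
  fixes f :: "real^'n \<Rightarrow> real"
  assumes f: "G-lipschitz_on UNIV f" and r: "0 < r"
  shows "G-lipschitz_on UNIV (smoothed f r)"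
proof (rule lipschitz_onI)
  fix x y :: "real^'n"
  interpret prob_space "uniform_measure lborel (ball (0::real^'n) r)" by (rule prob_space_uniform_ball[OF r])
  have "smoothed f r x - smoothed f r y = (\<integral>z. f (x + z) - f (y + z) \<partial>uniform_measure lborel (ball 0 r))"
    unfolding smoothed_def using integrable_smoothed[OF f r] by simp
  also have "\<bar>\<dots>\<bar> \<le> (\<integral>z. \<bar>f (x + z) - f (y + z)\<bar> \<partial>uniform_measure lborel (ball 0 r))"
    by (rule integral_abs_bound)
  also have "\<dots> \<le> (\<integral>z. G * norm (x - y) \<partial>uniform_measure lborel (ball (0::real^'n) r))"
    using integrable_smoothed[OF f r] lipschitz_UNIV_shift[OF f]
    by (intro integral_mono) auto
  also have "\<dots> = G * norm (x - y)" using prob_space by simp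
  finally show "dist (smoothed f r x) (smoothed f r y) \<le> G * dist x y"
    by (simp add: dist_norm)
qed (use f in \<open>rule lipschitz_on_nonneg\<close>)

lemma smoothed_convex:
  fixes f :: "real^'n \<Rightarrow> real"
  assumes f: "G-lipschitz_on UNIV f" and r: "0 < r" and cf: "convex_on UNIV f"
  shows "convex_on UNIV (smoothed f r)"
proof (rule convex_onI)
  fix t :: real and x y :: "real^'n" assume t: "0 < t" "t < 1"
  interpret prob_space "uniform_measure lborel (ball (0::real^'n) r)" by (rule prob_space_uniform_ball[OF r])
  have "smoothed f r ((1 - t) *\<^sub>R x + t *\<^sub>R y)
    \<le> (\<integral>z. (1 - t) * f (x + z) + t * f (y + z) \<partial>uniform_measure lborel (ball 0 r))"
    unfolding smoothed_def
  proof (rule integral_mono)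
    fix z
    have "(1 - t) *\<^sub>R x + t *\<^sub>R y + z = (1 - t) *\<^sub>R (x + z) + t *\<^sub>R (y + z)" by (simp add: algebra_simps)
    thus "f ((1 - t) *\<^sub>R x + t *\<^sub>R y + z) \<le> (1 - t) * f (x + z) + t * f (y + z)"
      using t convex_onD[OF cf, of t "x + z" "y + z"] by simp
  qed (use integrable_smoothed[OF f r] in auto)
  also have "\<dots> = (1 - t) * smoothed f r x + t * smoothed f r y"
    unfolding smoothed_def using integrable_smoothed[OF f r] by simp
  finally show "smoothed f r ((1 - t) *\<^sub>R x + t *\<^sub>R y) \<le> (1 - t) * smoothed f r x + t * smoothed f r y" .
qed simp

lemma integrable_sphere:
  fixes h :: "real^'n \<Rightarrow> 'b::{banach, second_countable_topology}"
  assumes "h \<in> borel_measurable borel" "\<And>e. norm e = 1 \<Longrightarrow> norm (h e) \<le> C"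
  shows "integrable uniform_sphere h"
proof -
  interpret prob_space "uniform_sphere :: (real^'n) measure" by (rule prob_space_uniform_sphere)
  show ?thesis
    using AE_uniform_sphere_norm assms
    by (intro integrable_const_bound[where B=C]) auto
qed

lemma sphere_point_bound:
  fixes f :: "real^'n \<Rightarrow> real"
  assumes f: "G-lipschitz_on UNIV f" and "0 < r" "norm e = 1"
  shows "\<bar>f (x + r *\<^sub>R e)\<bar> \<le> \<bar>f x\<bar> + G * r"
  using lipschitz_UNIV_D[OF f, of "x + r *\<^sub>R e" x] assms by simp

lemma integrable_sphere_grad:
  fixes f :: "real^'n \<Rightarrow> real"
  assumes f: "G-lipschitz_on UNIV f" and r: "0 < r"
  shows "integrable uniform_sphere (\<lambda>e. f (x + r *\<^sub>R e) *\<^sub>R e)"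
proof -
  note [measurable] = lipschitz_UNIV_measurable[OF f]
  show ?thesis
    by (rule integrable_sphere[where C="\<bar>f x\<bar> + G * r"]) (auto simp: sphere_point_bound[OF f r])
qed

lemma sphere_grad_inner:
  fixes f :: "real^'n \<Rightarrow> real"
  assumes f: "G-lipschitz_on UNIV f" and r: "0 < r"
  shows "sphere_grad f r x \<bullet> v = real CARD('n) / r * (\<integral>e. f (x + r *\<^sub>R e) * (e \<bullet> v) \<partial>uniform_sphere)"
  unfolding sphere_grad_def inner_scaleR_left
  by (subst integral_inner_left[symmetric]) (auto simp: integrable_sphere_grad[OF f r])

text \<open>Only values of \<open>f\<close> enter the average, so its Lipschitz bound is inherited.
  Continuity is what upgrades a subgradient to a derivative in
  \<open>has_derivative_of_continuous_subgradient\<close>.\<close>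

lemma sphere_grad_continuous:
  fixes f :: "real^'n \<Rightarrow> real"
  assumes f: "G-lipschitz_on UNIV f" and r: "0 < r"
  shows "continuous_on UNIV (sphere_grad f r)"
proof (rule lipschitz_on_continuous_on, rule lipschitz_onI)
  fix x y :: "real^'n"
  have G: "G \<ge> 0" using f by (rule lipschitz_on_nonneg)
  interpret prob_space "uniform_sphere :: (real^'n) measure" by (rule prob_space_uniform_sphere)
  note [measurable] = lipschitz_UNIV_measurable[OF f]
  have "sphere_grad f r x - sphere_grad f r y =
    (real CARD('n) / r) *\<^sub>R (\<integral>e. (f (x + r *\<^sub>R e) - f (y + r *\<^sub>R e)) *\<^sub>R e \<partial>uniform_sphere)"
    unfolding sphere_grad_def using integrable_sphere_grad[OF f r]
    by (simp add: scaleR_diff_left scaleR_diff_right)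
  hence "norm (sphere_grad f r x - sphere_grad f r y) =
    real CARD('n) / r * norm (\<integral>e. (f (x + r *\<^sub>R e) - f (y + r *\<^sub>R e)) *\<^sub>R e \<partial>uniform_sphere)"
    using r by simp
  also have "\<dots> \<le> real CARD('n) / r * (G * norm (x - y))"
  proof (rule mult_left_mono)
    have "norm (\<integral>e. (f (x + r *\<^sub>R e) - f (y + r *\<^sub>R e)) *\<^sub>R e \<partial>uniform_sphere)
      \<le> (\<integral>e. norm ((f (x + r *\<^sub>R e) - f (y + r *\<^sub>R e)) *\<^sub>R e) \<partial>uniform_sphere)"
      by (rule integral_norm_bound)
    also have "\<dots> \<le> (\<integral>e. G * norm (x - y) \<partial>(uniform_sphere :: (real^'n) measure))"
    proof (rule integral_mono_AE)
      show "AE e in uniform_sphere. norm ((f (x + r *\<^sub>R e) - f (y + r *\<^sub>R e)) *\<^sub>R e) \<le> G * norm (x - y)"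
        using AE_uniform_sphere_norm
        by eventually_elim (simp add: lipschitz_UNIV_shift[OF f])
      show "integrable uniform_sphere (\<lambda>e. norm ((f (x + r *\<^sub>R e) - f (y + r *\<^sub>R e)) *\<^sub>R e))"
        using integrable_sphere_grad[OF f r] by (simp add: scaleR_diff_left)
    qed simp
    also have "\<dots> = G * norm (x - y)" using prob_space by simp
    finally show "norm (\<integral>e. (f (x + r *\<^sub>R e) - f (y + r *\<^sub>R e)) *\<^sub>R e \<partial>uniform_sphere) \<le> G * norm (x - y)" .
  qed (use r in simp)
  finally show "dist (sphere_grad f r x) (sphere_grad f r y) \<le> (real CARD('n) / r * G) * dist x y"
    by (simp add: dist_norm)
  show "0 \<le> real CARD('n) / r * G" using r G by simp
qed

section \<open>A radial cutoff and the subgradient inequality for the ball average\<close>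

definition cutoff :: "real \<Rightarrow> real \<Rightarrow> real \<Rightarrow> real" where
  "cutoff a r t = max 0 (min 1 ((r - t) / (r - a)))"

lemma cutoff_range: "0 \<le> cutoff a r t" "cutoff a r t \<le> 1"
  by (auto simp: cutoff_def)

lemma cutoff_lipschitz:
  assumes "a < r"
  shows "\<bar>cutoff a r s - cutoff a r t\<bar> \<le> \<bar>s - t\<bar> / (r - a)"
proof -
  have "\<bar>cutoff a r s - cutoff a r t\<bar> \<le> \<bar>(r - s) / (r - a) - (r - t) / (r - a)\<bar>"
    unfolding cutoff_def by linarith
  also have "\<dots> = \<bar>s - t\<bar> / (r - a)"
    using assms by (simp flip: diff_divide_distrib)
  finally show ?thesis .
qed

lemma cutoff_inside: "a < r \<Longrightarrow> t \<le> a \<Longrightarrow> cutoff a r t = 1"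
  and cutoff_outside: "a < r \<Longrightarrow> r \<le> t \<Longrightarrow> cutoff a r t = 0"
  and cutoff_between: "a < r \<Longrightarrow> a \<le> t \<Longrightarrow> t \<le> r \<Longrightarrow> cutoff a r t = (r - t) / (r - a)"
  by (auto simp: cutoff_def field_simps)

lemma cutoff_deriv:
  assumes "a < r" "t \<noteq> a" "t \<noteq> r"
  shows "(cutoff a r has_real_derivative - (if a < t \<and> t < r then 1 / (r - a) else 0)) (at t)"
proof -
  consider "t < a" | "a < t" "t < r" | "r < t" using assms by linarith
  thus ?thesis
  proof cases
    case 1
    have "((\<lambda>_. 1) has_real_derivative 0) (at t)" by simp
    hence "(cutoff a r has_real_derivative 0) (at t)"
      by (rule has_field_derivative_transform_within_open[where S="{..<a}"])
         (use 1 assms cutoff_inside in auto)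
    thus ?thesis using 1 by simp
  next
    case 2
    have "((\<lambda>t. (r - t) / (r - a)) has_real_derivative - (1 / (r - a))) (at t)"
    proof -
      have "((\<lambda>t. r - t) has_real_derivative -1) (at t)" by (auto intro!: derivative_eq_intros)
      from DERIV_cdivide[OF this, of "r - a"] show ?thesis by simp
    qed
    hence "(cutoff a r has_real_derivative - (1 / (r - a))) (at t)"
      by (rule has_field_derivative_transform_within_open[where S="{a<..<r}"])
         (use 2 assms cutoff_between in auto)
    thus ?thesis using 2 by simp
  next
    case 3
    have "((\<lambda>_. 0) has_real_derivative 0) (at t)" by simp
    hence "(cutoff a r has_real_derivative 0) (at t)"
      by (rule has_field_derivative_transform_within_open[where S="{r<..}"])
         (use 3 assms cutoff_outside in auto)
    thus ?thesis using 3 by simp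
  qed
qed


text \<open>The centre \<open>d\<close> is free because difference quotients of the cutoff along a
  translation are integrated later.\<close>

lemma integrable_cutoff:
  fixes f :: "real^'n \<Rightarrow> real"
  assumes f: "G-lipschitz_on UNIV f" and ar: "0 < a" "a < r"
  shows "integrable lborel (\<lambda>z. f (c + z) * cutoff a r (norm (z - d)))"
proof (rule integrable_lborel_bounded_support)
  note [measurable] = lipschitz_UNIV_measurable[OF f]
  have G: "G \<ge> 0" using f by (rule lipschitz_on_nonneg)
  show "(\<lambda>z. f (c + z) * cutoff a r (norm (z - d))) \<in> borel_measurable borel"
    unfolding cutoff_def by measurable
  fix z :: "real^'n"
  show "\<bar>f (c + z) * cutoff a r (norm (z - d))\<bar> \<le> (\<bar>f c\<bar> + G * (r + norm d)) * indicator (cball 0 (r + norm d)) z"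
  proof (cases "norm z \<le> r + norm d")
    case True
    have "\<bar>f (c + z)\<bar> \<le> \<bar>f c\<bar> + G * norm z" using lipschitz_UNIV_D[OF f, of "c + z" c] by simp
    also have "\<dots> \<le> \<bar>f c\<bar> + G * (r + norm d)" using True G by (intro add_left_mono mult_left_mono) auto
    finally have "\<bar>f (c + z)\<bar> * \<bar>cutoff a r (norm (z - d))\<bar> \<le> (\<bar>f c\<bar> + G * (r + norm d)) * 1"
      using cutoff_range[of a r "norm (z - d)"] by (intro mult_mono) auto
    thus ?thesis using True by (simp add: abs_mult)
  next
    case False
    hence "r \<le> norm (z - d)" using norm_triangle_ineq2[of z d] by linarith
    thus ?thesis using False ar by (simp add: cutoff_outside)
  qed
qed

lemma norm_diff_deriv:
  fixes z v :: "'a::real_inner"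
  assumes "z \<noteq> 0"
  shows "((\<lambda>t. norm (z - t *\<^sub>R v)) has_real_derivative - (sgn z \<bullet> v)) (at 0)"
proof -
  have "(norm has_derivative (\<lambda>h. h \<bullet> sgn z)) (at (z - 0 *\<^sub>R v))"
    using assms has_derivative_norm[of z] by simp
  moreover have "((\<lambda>t. z - t *\<^sub>R v) has_derivative (\<lambda>t. - (t *\<^sub>R v))) (at 0)"
    by (auto intro!: derivative_eq_intros)
  ultimately have "((\<lambda>t. norm (z - t *\<^sub>R v)) has_derivative (\<lambda>t. (- (t *\<^sub>R v)) \<bullet> sgn z)) (at 0)"
    by (rule has_derivative_compose[rotated])
  moreover have "(\<lambda>t. (- (t *\<^sub>R v)) \<bullet> sgn z) = (*) (- (sgn z \<bullet> v))"
    by (auto simp: fun_eq_iff inner_commute)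
  ultimately show ?thesis unfolding has_field_derivative_def by simp
qed

lemma sphere_null: "AE z in lborel. norm (z::'a::euclidean_space) \<noteq> r"
proof (rule AE_I'[where N="sphere 0 r"])
  have "sphere (0::'a) r \<in> null_sets lebesgue"
    using negligible_sphere[of "0::'a" r] by (simp add: negligible_iff_null_sets)
  thus "sphere (0::'a) r \<in> null_sets lborel" by (auto simp: null_sets_def)
qed auto

text \<open>Convexity bounds the difference quotients of \<open>f\<close> along \<open>v\<close> by
  the full increment. Translation invariance moves the quotient from \<open>f\<close> to the cutoff,
  so that only the cutoff is differentiated in the limit and \<open>f\<close> may have kinks. The
  factor \<open>1 / (r - a)\<close> on the shell is the slope of the cutoff with the opposite
  sign.\<close>

lemma convex_annulus_ineq:
  fixes f :: "real^'n \<Rightarrow> real"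
  assumes f: "G-lipschitz_on UNIV f" and cf: "convex_on UNIV f" and ar: "0 < a" "a < r"
  shows "(\<integral>z. f (x + z) * ((indicator (ball 0 r) z - indicator (ball 0 a) z) * (sgn z \<bullet> v) / (r - a)) \<partial>lborel)
    \<le> (\<integral>z. (f (x + v + z) - f (x + z)) * cutoff a r (norm z) \<partial>lborel)"
proof -
  note [measurable] = lipschitz_UNIV_measurable[OF f]
  have [measurable]: "cutoff a r \<in> borel_measurable borel" unfolding cutoff_def[abs_def] by measurable
  have [measurable]: "ball (0::real^'n) b \<in> sets borel" for b by simp
  have G: "G \<ge> 0" using f by (rule lipschitz_on_nonneg)
  define t where "t = (\<lambda>m. inverse (real (Suc m)))"
  have t: "0 < t m" "t m \<le> 1" for m by (auto simp: t_def inverse_le_1_iff)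
  have t0: "t \<longlonglongrightarrow> 0" unfolding t_def by (rule LIMSEQ_inverse_real_of_nat)
  define s where "s = (\<lambda>m z. f (x + z) * ((cutoff a r (norm (z - t m *\<^sub>R v)) - cutoff a r (norm z)) / t m))"
  let ?D = "\<lambda>z. f (x + z) * ((indicator (ball 0 r) z - indicator (ball 0 a) z) * (sgn z \<bullet> v) / (r - a))"
  let ?J = "\<integral>z. (f (x + v + z) - f (x + z)) * cutoff a r (norm z) \<partial>lborel"
  have int: "integrable lborel (\<lambda>z. f (c + z) * cutoff a r (norm z))" for c
    using integrable_cutoff[OF f ar, of c 0] by simp
  have le: "(\<integral>z. s m z \<partial>lborel) \<le> ?J" for m
  proof -
    have "(\<integral>z. s m z \<partial>lborel) = ((\<integral>z. f (x + z) * cutoff a r (norm (z - t m *\<^sub>R v)) \<partial>lborel) - (\<integral>z. f (x + z) * cutoff a r (norm z) \<partial>lborel)) / t m"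
      unfolding s_def using integrable_cutoff[OF f ar, of x "t m *\<^sub>R v"] int[of x]
      by (simp add: right_diff_distrib diff_divide_distrib)
    also have "(\<integral>z. f (x + z) * cutoff a r (norm (z - t m *\<^sub>R v)) \<partial>lborel) = (\<integral>z. f (x + t m *\<^sub>R v + z) * cutoff a r (norm z) \<partial>lborel)"
      by (subst integral_lborel_translate[of _ "t m *\<^sub>R v", symmetric]) (auto simp: add_ac)
    also have "((\<integral>z. f (x + t m *\<^sub>R v + z) * cutoff a r (norm z) \<partial>lborel) - (\<integral>z. f (x + z) * cutoff a r (norm z) \<partial>lborel)) / t m
       = (\<integral>z. (f (x + t m *\<^sub>R v + z) - f (x + z)) / t m * cutoff a r (norm z) \<partial>lborel)"
      using int[of x] int[of "x + t m *\<^sub>R v"] by (simp add: left_diff_distrib diff_divide_distrib)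
    also have "\<dots> \<le> ?J"
    proof (rule integral_mono)
      fix z :: "real^'n"
      have "f ((1 - t m) *\<^sub>R (x + z) + t m *\<^sub>R (x + v + z)) \<le> (1 - t m) * f (x + z) + t m * f (x + v + z)"
        using t[of m] by (intro convex_onD[OF cf]) auto
      also have "(1 - t m) *\<^sub>R (x + z) + t m *\<^sub>R (x + v + z) = x + t m *\<^sub>R v + z" by (simp add: algebra_simps)
      finally have "(f (x + t m *\<^sub>R v + z) - f (x + z)) / t m \<le> f (x + v + z) - f (x + z)"
        using t[of m] by (simp add: field_simps)
      thus "(f (x + t m *\<^sub>R v + z) - f (x + z)) / t m * cutoff a r (norm z) \<le> (f (x + v + z) - f (x + z)) * cutoff a r (norm z)"
        by (intro mult_right_mono cutoff_range)
    qed (use int[of x] int[of "x + t m *\<^sub>R v"] int[of "x + v"] in \<open>auto simp: left_diff_distrib diff_divide_distrib\<close>)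
    finally show ?thesis .
  qed
  define R where "R = r + norm v"
  \<comment> \<open>A bound for all quotients \<open>s m\<close>: the cutoff has Lipschitz constant
    \<open>1 / (r - a)\<close>, and step sizes at most 1 keep the support in the ball of radius
    \<open>R\<close>.\<close>
  define C where "C = (\<bar>f x\<bar> + G * R) * (norm v / (r - a))"
  have "(\<lambda>m. \<integral>z. s m z \<partial>lborel) \<longlonglongrightarrow> (\<integral>z. ?D z \<partial>lborel)"
  proof (rule integral_dominated_convergence[where w="\<lambda>z. C * indicator (cball 0 R) z"])
    show "?D \<in> borel_measurable lborel" by measurable
    show "s m \<in> borel_measurable lborel" for m unfolding s_def by measurable
    have "emeasure lborel (cball (0::real^'n) R) < \<infinity>" by (rule emeasure_lborel_cball_finite)
    thus "integrable lborel (\<lambda>z. C * indicator (cball (0::real^'n) R) z)"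
      by (intro integrable_mult_right) (simp add: integrable_indicator_iff less_top)
    show "AE z in lborel. norm (s m z) \<le> C * indicator (cball 0 R) z" for m
    proof (rule AE_I2)
      fix z :: "real^'n"
      show "norm (s m z) \<le> C * indicator (cball 0 R) z"
      proof (cases "norm z \<le> R")
        case True
        have "\<bar>cutoff a r (norm (z - t m *\<^sub>R v)) - cutoff a r (norm z)\<bar> \<le> \<bar>norm (z - t m *\<^sub>R v) - norm z\<bar> / (r - a)"
          by (rule cutoff_lipschitz[OF ar(2)])
        also have "\<dots> \<le> (t m * norm v) / (r - a)"
          using ar t[of m] norm_triangle_ineq3[of "z - t m *\<^sub>R v" z] by (intro divide_right_mono) auto
        finally have "\<bar>cutoff a r (norm (z - t m *\<^sub>R v)) - cutoff a r (norm z)\<bar> / t m \<le> norm v / (r - a)"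
          using t[of m] by (simp add: field_simps)
        moreover have "\<bar>f (x + z)\<bar> \<le> \<bar>f x\<bar> + G * R"
        proof -
          have "\<bar>f (x + z)\<bar> \<le> \<bar>f x\<bar> + G * norm z" using lipschitz_UNIV_D[OF f, of "x + z" x] by simp
          also have "\<dots> \<le> \<bar>f x\<bar> + G * R" using True G by (intro add_left_mono mult_left_mono) auto
          finally show ?thesis .
        qed
        ultimately have "\<bar>f (x + z)\<bar> * (\<bar>cutoff a r (norm (z - t m *\<^sub>R v)) - cutoff a r (norm z)\<bar> / t m) \<le> C"
          unfolding C_def using t[of m] by (intro mult_mono) auto
        thus ?thesis using True t[of m] by (simp add: s_def abs_mult)
      next
        case False
        have "norm (t m *\<^sub>R v) \<le> 1 * norm v" using t[of m] by (simp only: norm_scaleR) (intro mult_right_mono, auto)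
        hence "r \<le> norm (z - t m *\<^sub>R v)" "r \<le> norm z"
          using False norm_triangle_ineq2[of z "t m *\<^sub>R v"] norm_ge_zero[of v] unfolding R_def by linarith+
        thus ?thesis using False ar by (simp add: s_def cutoff_outside)
      qed
    qed
    \<comment> \<open>The exceptional points form a null set: the kinks of the cutoff on two
      spheres, and the origin, where the norm is not differentiable.\<close>
    show "AE z in lborel. (\<lambda>m. s m z) \<longlonglongrightarrow> ?D z"
      using sphere_null[of a] sphere_null[of r] AE_lborel_nonzero
    proof eventually_elim
      case (elim z)
      let ?k = "- (if a < norm z \<and> norm z < r then 1 / (r - a) else 0)"
      have "((\<lambda>t. cutoff a r (norm (z - t *\<^sub>R v))) has_real_derivative ?k * - (sgn z \<bullet> v)) (at 0)"
        using elim ar cutoff_deriv[of a r "norm z"] norm_diff_deriv[of z v]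
        by (intro DERIV_chain2) auto
      hence "((\<lambda>t. (cutoff a r (norm (z - t *\<^sub>R v)) - cutoff a r (norm z)) / t) \<longlongrightarrow> ?k * - (sgn z \<bullet> v)) (at 0)"
        by (simp add: has_field_derivative_iff)
      moreover have "filterlim t (at 0) sequentially"
        using t0 t by (auto simp: filterlim_at intro!: always_eventually) (metis less_irrefl t(1))
      ultimately have "(\<lambda>m. (cutoff a r (norm (z - t m *\<^sub>R v)) - cutoff a r (norm z)) / t m) \<longlonglongrightarrow> ?k * - (sgn z \<bullet> v)"
        by (rule filterlim_compose)
      hence "(\<lambda>m. s m z) \<longlonglongrightarrow> f (x + z) * (?k * - (sgn z \<bullet> v))"
        unfolding s_def by (intro tendsto_intros)
      also have "f (x + z) * (?k * - (sgn z \<bullet> v)) = ?D z"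
        using elim ar by (auto simp: indicator_def)
      finally show ?case .
    qed
  qed
  thus ?thesis by (rule LIMSEQ_le_const2) (use le in auto)
qed


theorem sphere_grad_subgradient:
  fixes f :: "real^'n \<Rightarrow> real"
  assumes f: "G-lipschitz_on UNIV f" and cf: "convex_on UNIV f" and r: "0 < r"
  shows "sphere_grad f r x \<bullet> v \<le> smoothed f r (x + v) - smoothed f r x"
proof -
  note [measurable] = lipschitz_UNIV_measurable[OF f]
  have [measurable]: "ball (0::real^'n) b \<in> sets borel" for b by simp
  have G: "G \<ge> 0" using f by (rule lipschitz_on_nonneg)
  define n where "n = CARD('n)"
  define c where "c = unit_ball_vol (real CARD('n))"
  have c: "c > 0" by (simp add: c_def)
  have n: "n > 0" by (simp add: n_def)
  define A where "A = (\<integral>e. f (x + r *\<^sub>R e) * (e \<bullet> v) \<partial>uniform_sphere)"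
  define \<Delta> where "\<Delta> = smoothed f r (x + v) - smoothed f r x"
  \<comment> \<open>Two replacements are made on the shell: \<open>f\<close> is evaluated at the
    radial projection to the sphere of radius \<open>r\<close>, and the cutoff becomes the indicator
    of the ball. The projection moves points by at most \<open>r - a\<close>, which cancels the
    slope \<open>1 / (r - a)\<close>, so each replacement costs at most \<open>G * norm v\<close>
    times the volume of the shell; hence the 2.\<close>
  have ineq: "(a ^ n - r ^ n) / (a - r) * A \<le> r ^ n * \<Delta> + 2 * (G * norm v) * (r ^ n - a ^ n)" if a: "0 < a" "a < r" for a
  proof -
    define w :: "real^'n \<Rightarrow> real" where "w = (\<lambda>z. indicator (ball 0 r) z - indicator (ball 0 a) z)"
    have [measurable]: "w \<in> borel_measurable borel" unfolding w_def by measurable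
    have w: "w z = (if a \<le> norm z \<and> norm z < r then 1 else 0)" for z
      using a by (auto simp: w_def indicator_def)
    have iball: "integrable lborel (indicator (ball (0::real^'n) b) :: _ \<Rightarrow> real)" for b
      using emeasure_lborel_ball_finite[of "0::real^'n" b] by (simp add: integrable_indicator_iff less_top)
    have vol: "(\<integral>z. indicator (ball (0::real^'n) b) z \<partial>lborel) = c * b ^ n" if "0 < b" for b
      using that by (simp add: measure_lborel_ball c_def n_def)
    have iw: "integrable lborel w" unfolding w_def by (intro Bochner_Integration.integrable_diff iball)
    have Iw: "(\<integral>z. w z \<partial>lborel) = c * (r ^ n - a ^ n)"
      unfolding w_def using a r by (subst Bochner_Integration.integral_diff) (auto simp: iball measure_lborel_ball c_def n_def right_diff_distrib)
    have bd: "integrable lborel (\<lambda>z. k z * indicator (ball (0::real^'n) b) z)"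
      if [measurable]: "k \<in> borel_measurable borel" and "\<And>z. norm z < b \<Longrightarrow> \<bar>k z\<bar> \<le> C" and "0 \<le> C" for k :: "real^'n \<Rightarrow> real" and b C
      by (rule integrable_lborel_bounded_support[where C=C and R=b]) (use that in \<open>auto simp: indicator_def\<close>)
    have fb: "\<bar>f (y + z)\<bar> \<le> \<bar>f y\<bar> + G * r" if "norm z \<le> r" for y z
    proof -
      have "\<bar>f (y + z)\<bar> \<le> \<bar>f y\<bar> + G * norm z" using lipschitz_UNIV_D[OF f, of "y + z" y] by simp
      also have "\<dots> \<le> \<bar>f y\<bar> + G * r" using that G by (intro add_left_mono mult_left_mono) auto
      finally show ?thesis .
    qed
    have sv: "\<bar>sgn z \<bullet> v\<bar> \<le> norm v" for z
      using Cauchy_Schwarz_ineq2[of "sgn z" v] by (cases "z = 0") (auto simp: norm_sgn)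
    let ?\<psi> = "\<lambda>e. f (x + r *\<^sub>R e) * (e \<bullet> v)"
    have b\<psi>: "\<bar>?\<psi> (sgn z)\<bar> \<le> (\<bar>f x\<bar> + G * r) * norm v" for z
      unfolding abs_mult using r G sv[of z] fb[of "r *\<^sub>R sgn z" x]
      by (intro mult_mono) (auto simp: norm_sgn)
    have nn: "0 \<le> (\<bar>f x\<bar> + G * r) * norm v" using G r by simp
    have bs: "\<bar>f (x + z) * (sgn z \<bullet> v)\<bar> \<le> (\<bar>f x\<bar> + G * r) * norm v" if "norm z < r" for z
      unfolding abs_mult using that r sv[of z] fb[of z x] G by (intro mult_mono) auto
    have i\<psi>: "integrable lborel (\<lambda>z. ?\<psi> (sgn z) * indicator (ball 0 b) z)" if "0 < b" "b \<le> r" for b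
      by (rule bd[OF _ _ nn]) (use b\<psi> in auto)
    have ipw: "integrable lborel (\<lambda>z. ?\<psi> (sgn z) * w z)"
      using i\<psi>[of r] i\<psi>[of a] a unfolding w_def right_diff_distrib by auto
    have "(\<integral>z. ?\<psi> (sgn z) * w z \<partial>lborel) = c * (r ^ n - a ^ n) * A"
    proof -
      have "(\<integral>z. ?\<psi> (sgn z) * w z \<partial>lborel) = (\<integral>z. ?\<psi> (sgn z) * indicator (ball 0 r) z \<partial>lborel) - (\<integral>z. ?\<psi> (sgn z) * indicator (ball 0 a) z \<partial>lborel)"
        unfolding w_def right_diff_distrib using i\<psi> a r by (intro Bochner_Integration.integral_diff) auto
      also have "\<dots> = c * r ^ n * A - c * a ^ n * A"
        using integral_sgn_ball[of ?\<psi> r] integral_sgn_ball[of ?\<psi> a] a r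
        by (simp add: A_def c_def n_def mult.commute)
      finally show ?thesis by (simp add: algebra_simps)
    qed
    hence "c * ((r ^ n - a ^ n) / (r - a) * A - (G * norm v) * (r ^ n - a ^ n)) =
      (\<integral>z. ?\<psi> (sgn z) * w z / (r - a) - G * norm v * w z \<partial>lborel)"
    proof -
      have "(\<integral>z. ?\<psi> (sgn z) * w z / (r - a) - G * norm v * w z \<partial>lborel) =
        (\<integral>z. ?\<psi> (sgn z) * w z \<partial>lborel) / (r - a) - G * norm v * (\<integral>z. w z \<partial>lborel)"
        using iw ipw by simp
      thus ?thesis using \<open>(\<integral>z. ?\<psi> (sgn z) * w z \<partial>lborel) = c * (r ^ n - a ^ n) * A\<close> Iw
        by (simp add: algebra_simps)
    qed
    also have "\<dots> \<le> (\<integral>z. f (x + z) * (w z * (sgn z \<bullet> v) / (r - a)) \<partial>lborel)"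
    proof (rule integral_mono)
      show "integrable lborel (\<lambda>z. ?\<psi> (sgn z) * w z / (r - a) - G * norm v * w z)"
        using iw ipw by simp
      have "integrable lborel (\<lambda>z. (f (x + z) * (sgn z \<bullet> v)) * indicator (ball 0 b) z)" if "b \<le> r" for b
        by (rule bd[OF _ _ nn]) (use bs that in auto)
      from this[of r] this[of a] a have "integrable lborel (\<lambda>z. (f (x + z) * (sgn z \<bullet> v)) * w z / (r - a))"
        by (auto simp: w_def right_diff_distrib)
      thus "integrable lborel (\<lambda>z. f (x + z) * (w z * (sgn z \<bullet> v) / (r - a)))"
        by (simp add: mult_ac)
      fix z :: "real^'n"
      show "?\<psi> (sgn z) * w z / (r - a) - G * norm v * w z \<le> f (x + z) * (w z * (sgn z \<bullet> v) / (r - a))"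
      proof (cases "a \<le> norm z \<and> norm z < r")
        case True
        hence z0: "z \<noteq> 0" using a by auto
        have "x + r *\<^sub>R sgn z - (x + z) = (r - norm z) *\<^sub>R sgn z"
          using z0 by (simp add: sgn_div_norm algebra_simps)
        hence "norm (x + r *\<^sub>R sgn z - (x + z)) = r - norm z" using z0 True by (simp add: norm_sgn)
        hence "\<bar>f (x + r *\<^sub>R sgn z) - f (x + z)\<bar> \<le> G * (r - norm z)"
          using lipschitz_UNIV_D[OF f, of "x + r *\<^sub>R sgn z" "x + z"] by simp
        also have "\<dots> \<le> G * (r - a)" using True G by (intro mult_left_mono) auto
        finally have "\<bar>f (x + r *\<^sub>R sgn z) - f (x + z)\<bar> * \<bar>sgn z \<bullet> v\<bar> \<le> (G * (r - a)) * norm v"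
          using sv[of z] G a by (intro mult_mono) auto
        hence "(f (x + r *\<^sub>R sgn z) - f (x + z)) * (sgn z \<bullet> v) \<le> (G * (r - a)) * norm v"
          unfolding abs_mult[symmetric] by linarith
        hence "(f (x + r *\<^sub>R sgn z) - f (x + z)) * (sgn z \<bullet> v) / (r - a) \<le> G * norm v"
          using a by (simp add: pos_divide_le_eq mult_ac)
        thus ?thesis using True by (simp add: w left_diff_distrib diff_divide_distrib)
      next
        case False
        hence "w z = 0" by (auto simp: w)
        thus ?thesis by simp
      qed
    qed
    also have "\<dots> \<le> (\<integral>z. (f (x + v + z) - f (x + z)) * cutoff a r (norm z) \<partial>lborel)"
      unfolding w_def by (rule convex_annulus_ineq[OF f cf a])
    also have "\<dots> \<le> (\<integral>z. indicator (ball 0 r) z * (f (x + v + z) - f (x + z)) + G * norm v * w z \<partial>lborel)"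
    proof (rule integral_mono)
      show "integrable lborel (\<lambda>z. (f (x + v + z) - f (x + z)) * cutoff a r (norm z))"
        using integrable_cutoff[OF f a, of "x + v" 0] integrable_cutoff[OF f a, of x 0]
        by (simp add: left_diff_distrib)
      have "integrable lborel (\<lambda>z. f (y + z) * indicator (ball 0 r) z)" for y
        by (rule bd[where C="\<bar>f y\<bar> + G * r"]) (use fb G r in auto)
      from this[of "x + v"] this[of x] iw
      show "integrable lborel (\<lambda>z. indicator (ball 0 r) z * (f (x + v + z) - f (x + z)) + G * norm v * w z)"
        by (auto simp: right_diff_distrib mult.commute)
      fix z :: "real^'n"
      show "(f (x + v + z) - f (x + z)) * cutoff a r (norm z) \<le> indicator (ball 0 r) z * (f (x + v + z) - f (x + z)) + G * norm v * w z"
      proof (cases "a \<le> norm z \<and> norm z < r")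
        case True
        have "\<bar>f (x + v + z) - f (x + z)\<bar> \<le> G * norm v"
          using lipschitz_UNIV_shift[OF f, of "x + v" z x] by simp
        hence "\<bar>f (x + v + z) - f (x + z)\<bar> * (1 - cutoff a r (norm z)) \<le> (G * norm v) * 1"
          using cutoff_range[of a r "norm z"] by (intro mult_mono) auto
        moreover have "- (f (x + v + z) - f (x + z)) * (1 - cutoff a r (norm z)) \<le> \<bar>f (x + v + z) - f (x + z)\<bar> * (1 - cutoff a r (norm z))"
          using cutoff_range[of a r "norm z"] by (intro mult_right_mono) auto
        ultimately show ?thesis using True by (simp add: w algebra_simps)
      next
        case False
        thus ?thesis using a by (auto simp: w cutoff_inside cutoff_outside)
      qed
    qed
    also have "\<dots> = c * (r ^ n * \<Delta> + G * norm v * (r ^ n - a ^ n))"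
    proof -
      have i: "integrable lborel (\<lambda>z. indicator (ball 0 r) z * (f (x + v + z) - f (x + z)))"
      proof -
        have "integrable lborel (\<lambda>z. f (y + z) * indicator (ball 0 r) z)" for y
          by (rule bd[where C="\<bar>f y\<bar> + G * r"]) (use fb G r in auto)
        from this[of "x + v"] this[of x] show ?thesis by (auto simp: right_diff_distrib mult.commute)
      qed
      have "(\<integral>z. indicator (ball 0 r) z * (f (x + v + z) - f (x + z)) \<partial>lborel) = c * r ^ n * \<Delta>"
        unfolding \<Delta>_def smoothed_def c_def n_def using integrable_smoothed[OF f r]
        by (subst integral_uniform_ball[OF _ r]) auto
      moreover have "(\<integral>z. indicator (ball 0 r) z * (f (x + v + z) - f (x + z)) + G * norm v * w z \<partial>lborel) =
          (\<integral>z. indicator (ball 0 r) z * (f (x + v + z) - f (x + z)) \<partial>lborel) + G * norm v * (\<integral>z. w z \<partial>lborel)"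
        using i iw by simp
      ultimately show ?thesis unfolding Iw by (simp add: distrib_left mult_ac)
    qed
    finally have "(r ^ n - a ^ n) / (r - a) * A - (G * norm v) * (r ^ n - a ^ n) \<le> r ^ n * \<Delta> + G * norm v * (r ^ n - a ^ n)"
      using c by simp
    moreover have "(r ^ n - a ^ n) / (r - a) = (a ^ n - r ^ n) / (a - r)"
      by (metis minus_diff_eq minus_divide_divide)
    ultimately show ?thesis by simp
  qed
  \<comment> \<open>As \<open>a\<close> tends to \<open>r\<close> the quotient becomes the
    derivative of \<open>a ^ n\<close>, while the volume of the shell, and with it the error,
    vanishes.\<close>
  have "real n * r ^ (n - 1) * A \<le> r ^ n * \<Delta> + 2 * (G * norm v) * (r ^ n - r ^ n)"
  proof (rule tendsto_le[where F="at_left r"])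
    have "((\<lambda>a. a ^ n) has_real_derivative real n * r ^ (n - 1)) (at r)"
      by (auto intro!: derivative_eq_intros)
    hence "((\<lambda>a. (a ^ n - r ^ n) / (a - r)) \<longlongrightarrow> real n * r ^ (n - 1)) (at r)"
      by (simp add: has_field_derivative_iff) 
    hence "((\<lambda>a. (a ^ n - r ^ n) / (a - r)) \<longlongrightarrow> real n * r ^ (n - 1)) (at_left r)"
      by (rule tendsto_within_subset) simp
    thus "((\<lambda>a. (a ^ n - r ^ n) / (a - r) * A) \<longlongrightarrow> real n * r ^ (n - 1) * A) (at_left r)"
      by (intro tendsto_intros)
    show "((\<lambda>a. r ^ n * \<Delta> + 2 * (G * norm v) * (r ^ n - a ^ n)) \<longlongrightarrow> r ^ n * \<Delta> + 2 * (G * norm v) * (r ^ n - r ^ n)) (at_left r)"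
      by (intro tendsto_intros)
    show "\<forall>\<^sub>F a in at_left r. (a ^ n - r ^ n) / (a - r) * A \<le> r ^ n * \<Delta> + 2 * (G * norm v) * (r ^ n - a ^ n)"
      using eventually_at_left_real[OF r] by eventually_elim (use ineq in auto)
  qed simp
  moreover have "r ^ n = r * r ^ (n - 1)" using n by (cases n) auto
  ultimately have "r ^ (n - 1) * (real n * A) \<le> r ^ (n - 1) * (r * \<Delta>)" by (simp add: mult_ac)
  hence "real n * A \<le> r * \<Delta>" using r by simp
  thus ?thesis using r by (simp add: sphere_grad_inner[OF f r] A_def \<Delta>_def n_def field_simps)
qed

section \<open>Concentration on the sphere\<close>

text \<open>Only finiteness matters: it makes the dominating function in
  \<open>sphere_fourth_moment_C1\<close> integrable.\<close>

lemma gauss_norm4_finite: "(\<integral>\<^sup>+z. ennreal (norm z ^ 4) \<partial>(gauss :: (real^'n) measure)) < \<infinity>"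
proof -
  have "(\<integral>\<^sup>+z. ennreal (norm z ^ 4) \<partial>(gauss :: (real^'n) measure))
    \<le> (\<integral>\<^sup>+z. ennreal (real CARD('n)) * (\<Sum>b\<in>Basis. ennreal ((z \<bullet> b) ^ (2 * 2))) \<partial>(gauss :: (real^'n) measure))"
  proof (rule nn_integral_mono)
    fix z :: "real^'n"
    have "norm z ^ 4 = (\<Sum>b\<in>Basis. (z \<bullet> b)\<^sup>2)\<^sup>2" by (simp add: power2_norm_Basis[symmetric] flip: power_mult)
    also have "\<dots> \<le> real (card (Basis :: (real^'n) set)) * (\<Sum>b\<in>Basis. ((z \<bullet> b)\<^sup>2)\<^sup>2)"
      using sum_squared_le_sum_of_squares[of "\<lambda>b. (z \<bullet> b)\<^sup>2" Basis] by (simp add: mult.commute)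
    finally have "norm z ^ 4 \<le> real CARD('n) * (\<Sum>b\<in>Basis. (z \<bullet> b) ^ (2 * 2))"
      by (simp flip: power_mult)
    thus "ennreal (norm z ^ 4) \<le> ennreal (real CARD('n)) * (\<Sum>b\<in>Basis. ennreal ((z \<bullet> b) ^ (2 * 2)))"
      by (simp add: ennreal_mult'[symmetric] sum_nonneg ennreal_leI zero_le_even_power)
  qed
  also have "\<dots> = ennreal (real CARD('n)) * (\<Sum>b\<in>Basis. \<integral>\<^sup>+z. ennreal ((z \<bullet> b) ^ (2 * 2)) \<partial>(gauss :: (real^'n) measure))"
    by (simp add: nn_integral_cmult nn_integral_sum del: sum_ennreal)
  also have "\<dots> < \<infinity>"
    by (simp add: gauss_moment_even[where k=2, simplified] ennreal_mult_less_top of_nat_less_top)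
  finally show ?thesis .
qed

section \<open>Rotation invariance of pairs of Gaussian vectors\<close>

lemma nn_integral_lborel_translate:
  fixes f :: "'a::euclidean_space \<Rightarrow> ennreal"
  assumes [measurable]: "f \<in> borel_measurable borel"
  shows "(\<integral>\<^sup>+z. f (z + c) \<partial>lborel) = (\<integral>\<^sup>+z. f z \<partial>lborel)"
  using nn_integral_distr[of "(+) c" lborel borel f] by (simp add: lborel_distr_plus add.commute)

lemma nn_integral_shear_snd:
  fixes \<psi> :: "'a::euclidean_space \<Rightarrow> 'a \<Rightarrow> ennreal"
  assumes [measurable]: "case_prod \<psi> \<in> borel_measurable (borel \<Otimes>\<^sub>M borel)"
  shows "(\<integral>\<^sup>+x. \<integral>\<^sup>+y. \<psi> x (y + t *\<^sub>R x) \<partial>lborel \<partial>lborel) = (\<integral>\<^sup>+x. \<integral>\<^sup>+y. \<psi> x y \<partial>lborel \<partial>lborel)"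
  by (intro nn_integral_cong nn_integral_lborel_translate) measurable

lemma nn_integral_swap:
  fixes \<psi> :: "'a::euclidean_space \<Rightarrow> 'a \<Rightarrow> ennreal"
  assumes [measurable]: "case_prod \<psi> \<in> borel_measurable (borel \<Otimes>\<^sub>M borel)"
  shows "(\<integral>\<^sup>+x. \<integral>\<^sup>+y. \<psi> x y \<partial>lborel \<partial>lborel) = (\<integral>\<^sup>+y. \<integral>\<^sup>+x. \<psi> x y \<partial>lborel \<partial>lborel)"
  by (rule lborel_pair.Fubini'[symmetric]) measurable

lemma nn_integral_shear_fst:
  fixes \<psi> :: "'a::euclidean_space \<Rightarrow> 'a \<Rightarrow> ennreal"
  assumes [measurable]: "case_prod \<psi> \<in> borel_measurable (borel \<Otimes>\<^sub>M borel)"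
  shows "(\<integral>\<^sup>+x. \<integral>\<^sup>+y. \<psi> (x + t *\<^sub>R y) y \<partial>lborel \<partial>lborel) = (\<integral>\<^sup>+x. \<integral>\<^sup>+y. \<psi> x y \<partial>lborel \<partial>lborel)"
proof -
  have "(\<integral>\<^sup>+x. \<integral>\<^sup>+y. \<psi> (x + t *\<^sub>R y) y \<partial>lborel \<partial>lborel) = (\<integral>\<^sup>+y. \<integral>\<^sup>+x. \<psi> (x + t *\<^sub>R y) y \<partial>lborel \<partial>lborel)"
    by (rule nn_integral_swap) measurable
  also have "\<dots> = (\<integral>\<^sup>+y. \<integral>\<^sup>+x. \<psi> x y \<partial>lborel \<partial>lborel)"
    by (intro nn_integral_cong nn_integral_lborel_translate) measurable
  also have "\<dots> = (\<integral>\<^sup>+x. \<integral>\<^sup>+y. \<psi> x y \<partial>lborel \<partial>lborel)"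
    by (rule nn_integral_swap[symmetric]) measurable
  finally show ?thesis .
qed

text \<open>A rotation of the pair is a product of three shears.\<close>

lemma nn_integral_lborel_rotation:
  fixes \<psi> :: "'a::euclidean_space \<Rightarrow> 'a \<Rightarrow> ennreal"
  assumes [measurable]: "case_prod \<psi> \<in> borel_measurable (borel \<Otimes>\<^sub>M borel)"
    and cs: "c\<^sup>2 + s\<^sup>2 = 1" and s: "s \<noteq> 0"
  shows "(\<integral>\<^sup>+x. \<integral>\<^sup>+y. \<psi> (c *\<^sub>R x + s *\<^sub>R y) (c *\<^sub>R y - s *\<^sub>R x) \<partial>lborel \<partial>lborel) = (\<integral>\<^sup>+x. \<integral>\<^sup>+y. \<psi> x y \<partial>lborel \<partial>lborel)"
proof -
  \<comment> \<open>With \<open>c\<close> and \<open>s\<close> the cosine and sine of an angle,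
    \<open>t\<close> is the tangent of half of it. The two outer shears use \<open>t\<close>, the
    middle one \<open>- s\<close>.\<close>
  define t where "t = (1 - c) / s"
  have ts: "1 - t * s = c" using s by (simp add: t_def)
  have "t * (1 + c) * s = (1 - c) * (1 + c)" using s by (simp add: t_def)
  also have "\<dots> = s * s" using cs by (simp add: power2_eq_square algebra_simps)
  finally have "t * (1 + c) * s = s * s" .
  hence tc: "t * (1 + c) = s" using s by simp
  define \<psi>1 where "\<psi>1 = (\<lambda>x y. \<psi> (x + t *\<^sub>R y) y)"
  define \<psi>2 where "\<psi>2 = (\<lambda>x y. \<psi>1 x (y + (- s) *\<^sub>R x))"
  have [measurable]: "case_prod \<psi>1 \<in> borel_measurable (borel \<Otimes>\<^sub>M borel)" unfolding \<psi>1_def by measurable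
  have [measurable]: "case_prod \<psi>2 \<in> borel_measurable (borel \<Otimes>\<^sub>M borel)" unfolding \<psi>2_def by measurable
  have "\<psi> (c *\<^sub>R x + s *\<^sub>R y) (c *\<^sub>R y - s *\<^sub>R x) = \<psi>2 (x + t *\<^sub>R y) y" for x y
  proof -
    have a: "y + (- s) *\<^sub>R (x + t *\<^sub>R y) = (1 - t * s) *\<^sub>R y - s *\<^sub>R x" by (simp add: algebra_simps)
    have b: "x + t *\<^sub>R y + t *\<^sub>R (c *\<^sub>R y - s *\<^sub>R x) = (1 - t * s) *\<^sub>R x + (t * (1 + c)) *\<^sub>R y" by (simp add: algebra_simps)
    show ?thesis unfolding \<psi>2_def \<psi>1_def a ts b tc by simp
  qed
  hence "(\<integral>\<^sup>+x. \<integral>\<^sup>+y. \<psi> (c *\<^sub>R x + s *\<^sub>R y) (c *\<^sub>R y - s *\<^sub>R x) \<partial>lborel \<partial>lborel) = (\<integral>\<^sup>+x. \<integral>\<^sup>+y. \<psi>2 (x + t *\<^sub>R y) y \<partial>lborel \<partial>lborel)"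
    by simp
  also have "\<dots> = (\<integral>\<^sup>+x. \<integral>\<^sup>+y. \<psi>2 x y \<partial>lborel \<partial>lborel)" by (rule nn_integral_shear_fst) measurable
  also have "\<dots> = (\<integral>\<^sup>+x. \<integral>\<^sup>+y. \<psi>1 x y \<partial>lborel \<partial>lborel)" unfolding \<psi>2_def by (rule nn_integral_shear_snd) measurable
  also have "\<dots> = (\<integral>\<^sup>+x. \<integral>\<^sup>+y. \<psi> x y \<partial>lborel \<partial>lborel)" unfolding \<psi>1_def by (rule nn_integral_shear_fst) measurable
  finally show ?thesis .
qed

lemma nn_integral_gauss_pair:
  fixes \<psi> :: "real^'n \<Rightarrow> real^'n \<Rightarrow> ennreal"
  assumes [measurable]: "case_prod \<psi> \<in> borel_measurable (borel \<Otimes>\<^sub>M borel)"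
  shows "(\<integral>\<^sup>+x. \<integral>\<^sup>+y. \<psi> x y \<partial>gauss \<partial>gauss) =
    (\<integral>\<^sup>+x. \<integral>\<^sup>+y. ennreal ((1 / sqrt (2 * pi)) ^ CARD('n) * (1 / sqrt (2 * pi)) ^ CARD('n) * exp (- ((norm x)\<^sup>2 + (norm y)\<^sup>2) / 2)) * \<psi> x y \<partial>lborel \<partial>lborel)"
proof -
  interpret prob_space "gauss :: (real^'n) measure" by (rule prob_space_gauss)
  have "(\<integral>\<^sup>+x. \<integral>\<^sup>+y. \<psi> x y \<partial>gauss \<partial>gauss) =
    (\<integral>\<^sup>+x. ennreal ((1 / sqrt (2 * pi)) ^ CARD('n) * exp (- (norm x)\<^sup>2 / 2)) *
      (\<integral>\<^sup>+y. ennreal ((1 / sqrt (2 * pi)) ^ CARD('n) * exp (- (norm y)\<^sup>2 / 2)) * \<psi> x y \<partial>lborel) \<partial>lborel)"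
    by (subst nn_integral_gauss) (simp_all add: gauss_density_norm nn_integral_gauss)
  also have "\<dots> = (\<integral>\<^sup>+x. \<integral>\<^sup>+y. ennreal ((1 / sqrt (2 * pi)) ^ CARD('n) * exp (- (norm x)\<^sup>2 / 2)) *
      (ennreal ((1 / sqrt (2 * pi)) ^ CARD('n) * exp (- (norm y)\<^sup>2 / 2)) * \<psi> x y) \<partial>lborel \<partial>lborel)"
    by (intro nn_integral_cong nn_integral_cmult[symmetric]) measurable
  also have "\<dots> = (\<integral>\<^sup>+x. \<integral>\<^sup>+y. ennreal ((1 / sqrt (2 * pi)) ^ CARD('n) * (1 / sqrt (2 * pi)) ^ CARD('n) * exp (- ((norm x)\<^sup>2 + (norm y)\<^sup>2) / 2)) * \<psi> x y \<partial>lborel \<partial>lborel)"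
  proof (intro nn_integral_cong)
    fix x y :: "real^'n"
    have "exp (- ((norm x)\<^sup>2 + (norm y)\<^sup>2) / 2) = exp (- (norm x)\<^sup>2 / 2) * exp (- (norm y)\<^sup>2 / 2)"
      by (simp add: add_divide_distrib flip: exp_add)
    thus "ennreal ((1 / sqrt (2 * pi)) ^ CARD('n) * exp (- (norm x)\<^sup>2 / 2)) *
      (ennreal ((1 / sqrt (2 * pi)) ^ CARD('n) * exp (- (norm y)\<^sup>2 / 2)) * \<psi> x y) =
      ennreal ((1 / sqrt (2 * pi)) ^ CARD('n) * (1 / sqrt (2 * pi)) ^ CARD('n) * exp (- ((norm x)\<^sup>2 + (norm y)\<^sup>2) / 2)) * \<psi> x y"
      by (simp only: mult.assoc[symmetric]) (subst ennreal_mult'[symmetric], simp, simp add: mult_ac)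
  qed
  finally show ?thesis .
qed

text \<open>The joint density depends only on \<open>(norm x)\<^sup>2 + (norm y)\<^sup>2\<close>,
  which the rotation preserves.\<close>

lemma nn_integral_gauss_rotation:
  fixes \<psi> :: "real^'n \<Rightarrow> real^'n \<Rightarrow> ennreal"
  assumes [measurable]: "case_prod \<psi> \<in> borel_measurable (borel \<Otimes>\<^sub>M borel)"
    and cs: "c\<^sup>2 + s\<^sup>2 = 1" and s: "s \<noteq> 0"
  shows "(\<integral>\<^sup>+x. \<integral>\<^sup>+y. \<psi> (c *\<^sub>R x + s *\<^sub>R y) (c *\<^sub>R y - s *\<^sub>R x) \<partial>gauss \<partial>gauss) = (\<integral>\<^sup>+x. \<integral>\<^sup>+y. \<psi> x y \<partial>gauss \<partial>gauss)"
proof -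
  let ?C = "(1 / sqrt (2 * pi)) ^ CARD('n) * (1 / sqrt (2 * pi)) ^ CARD('n)"
  let ?\<psi> = "\<lambda>x y. ennreal (?C * exp (- ((norm x)\<^sup>2 + (norm y)\<^sup>2) / 2)) * \<psi> x y"
  have inv: "(norm (c *\<^sub>R x + s *\<^sub>R y))\<^sup>2 + (norm (c *\<^sub>R y - s *\<^sub>R x))\<^sup>2 = (norm x)\<^sup>2 + (norm y)\<^sup>2" for x y :: "real^'n"
  proof -
    have "(norm (c *\<^sub>R x + s *\<^sub>R y))\<^sup>2 + (norm (c *\<^sub>R y - s *\<^sub>R x))\<^sup>2 = (c\<^sup>2 + s\<^sup>2) * (x \<bullet> x) + (c\<^sup>2 + s\<^sup>2) * (y \<bullet> y)"
      unfolding power2_norm_eq_inner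
      by (simp add: inner_add_left inner_add_right inner_diff_left inner_diff_right inner_commute power2_eq_square algebra_simps)
    thus ?thesis by (simp add: cs power2_norm_eq_inner)
  qed
  have "(\<integral>\<^sup>+x. \<integral>\<^sup>+y. \<psi> (c *\<^sub>R x + s *\<^sub>R y) (c *\<^sub>R y - s *\<^sub>R x) \<partial>gauss \<partial>gauss)
    = (\<integral>\<^sup>+x. \<integral>\<^sup>+y. ?\<psi> (c *\<^sub>R x + s *\<^sub>R y) (c *\<^sub>R y - s *\<^sub>R x) \<partial>lborel \<partial>lborel)"
    unfolding inv by (rule nn_integral_gauss_pair) measurable
  also have "\<dots> = (\<integral>\<^sup>+x. \<integral>\<^sup>+y. ?\<psi> x y \<partial>lborel \<partial>lborel)"
    by (rule nn_integral_lborel_rotation[where \<psi>="?\<psi>", OF _ cs s]) measurable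
  also have "\<dots> = (\<integral>\<^sup>+x. \<integral>\<^sup>+y. \<psi> x y \<partial>gauss \<partial>gauss)"
    by (rule nn_integral_gauss_pair[symmetric]) measurable
  finally show ?thesis .
qed

text \<open>The Cauchy-Schwarz inequality, twice. Applied to \<open>N\<close> increments of equal
  law, the factor \<open>N ^ 3\<close> becomes the \<open>N ^ 4\<close> that turns an increment into
  a difference quotient.\<close>

lemma sum_power4_le: "(\<Sum>k<N. a k) ^ 4 \<le> real N ^ 3 * (\<Sum>k<N. a k ^ 4)" for a :: "nat \<Rightarrow> real"
proof -
  have 1: "(\<Sum>k<N. a k)\<^sup>2 \<le> real N * (\<Sum>k<N. (a k)\<^sup>2)"
    using sum_squared_le_sum_of_squares[of a "{..<N}"] by (simp add: mult.commute)
  have 2: "(\<Sum>k<N. (a k)\<^sup>2)\<^sup>2 \<le> real N * (\<Sum>k<N. ((a k)\<^sup>2)\<^sup>2)"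
    using sum_squared_le_sum_of_squares[of "\<lambda>k. (a k)\<^sup>2" "{..<N}"] by (simp add: mult.commute)
  have "(\<Sum>k<N. a k) ^ 4 = ((\<Sum>k<N. a k)\<^sup>2)\<^sup>2" by (rule power4_eq_square)
  also have "\<dots> \<le> (real N * (\<Sum>k<N. (a k)\<^sup>2))\<^sup>2" by (rule power_mono[OF 1]) simp
  also have "\<dots> \<le> (real N)\<^sup>2 * (real N * (\<Sum>k<N. ((a k)\<^sup>2)\<^sup>2))"
    unfolding power_mult_distrib by (intro mult_left_mono 2) auto
  finally show ?thesis by (simp add: power4_eq_square power3_eq_cube power2_eq_square mult.assoc)
qed

text \<open>The positively homogeneous extension of \<open>e \<mapsto> \<phi> (x + r e) - \<phi> x\<close> from the sphere.\<close>

definition cone_ext :: "('a::euclidean_space \<Rightarrow> real) \<Rightarrow> real \<Rightarrow> 'a \<Rightarrow> 'a \<Rightarrow> real" where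
  "cone_ext \<phi> r x z = norm z * (\<phi> (x + r *\<^sub>R sgn z) - \<phi> x)"

text \<open>Moving \<open>z\<close> changes its length, at a cost of \<open>r * G\<close>, and its
  direction, at a cost of \<open>2 * r * G\<close>. The constant only dominates difference
  quotients; the final bound rests on \<open>norm_cone_grad\<close>.\<close>

lemma cone_ext_lipschitz:
  fixes \<phi> :: "'a::euclidean_space \<Rightarrow> real"
  assumes lip: "\<And>y w. \<bar>\<phi> y - \<phi> w\<bar> \<le> G * norm (y - w)" and G: "0 \<le> G" and r: "0 < r"
  shows "\<bar>cone_ext \<phi> r x z - cone_ext \<phi> r x w\<bar> \<le> 3 * r * G * norm (z - w)"
proof -
  let ?h = "\<lambda>z. \<phi> (x + r *\<^sub>R sgn z) - \<phi> x"
  have sg: "norm z *\<^sub>R sgn z = z" for z :: 'a by (cases "z = 0") (auto simp: sgn_div_norm)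
  have "\<bar>?h z\<bar> \<le> G * norm (r *\<^sub>R sgn z)" using lip[of "x + r *\<^sub>R sgn z" x] by simp
  also have "\<dots> \<le> G * r" using G r by (intro mult_left_mono) (auto simp: norm_sgn)
  finally have hz: "\<bar>?h z\<bar> \<le> G * r" .
  have "\<bar>(norm z - norm w) * ?h z\<bar> \<le> norm (z - w) * (G * r)"
    unfolding abs_mult by (intro mult_mono hz norm_triangle_ineq3) auto
  moreover have "norm w * norm (sgn z - sgn w) \<le> 2 * norm (z - w)"
  proof -
    have "norm w * norm (sgn z - sgn w) = norm (norm w *\<^sub>R sgn z - w)"
      using sg[of w] by (metis abs_norm_cancel norm_scaleR scaleR_diff_right)
    also have "norm w *\<^sub>R sgn z - w = (norm w - norm z) *\<^sub>R sgn z + (z - w)"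
      using sg[of z] by (simp add: algebra_simps)
    also have "norm \<dots> \<le> \<bar>norm w - norm z\<bar> * norm (sgn z) + norm (z - w)"
      by (rule order.trans[OF norm_triangle_ineq]) simp
    also have "\<bar>norm w - norm z\<bar> * norm (sgn z) \<le> norm (z - w) * 1"
      using norm_triangle_ineq3[of w z] by (intro mult_mono) (auto simp: norm_sgn norm_minus_commute)
    finally show ?thesis by simp
  qed
  hence "\<bar>norm w * (?h z - ?h w)\<bar> \<le> G * r * (2 * norm (z - w))"
  proof -
    have "\<bar>?h z - ?h w\<bar> \<le> G * norm (r *\<^sub>R (sgn z - sgn w))"
      using lip[of "x + r *\<^sub>R sgn z" "x + r *\<^sub>R sgn w"] by (simp add: algebra_simps)
    hence "norm w * \<bar>?h z - ?h w\<bar> \<le> norm w * (G * (r * norm (sgn z - sgn w)))"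
      using r by (intro mult_left_mono) auto
    also have "\<dots> = G * r * (norm w * norm (sgn z - sgn w))" by simp
    also have "\<dots> \<le> G * r * (2 * norm (z - w))"
      using G r \<open>norm w * norm (sgn z - sgn w) \<le> 2 * norm (z - w)\<close> by (intro mult_left_mono) auto
    finally show ?thesis by (simp add: abs_mult)
  qed
  moreover have "cone_ext \<phi> r x z - cone_ext \<phi> r x w = (norm z - norm w) * ?h z + norm w * (?h z - ?h w)"
    by (simp add: cone_ext_def algebra_simps)
  ultimately show ?thesis by (simp add: algebra_simps)
qed

text \<open>The gradient of \<open>cone_ext\<close> off the origin if \<open>s\<close> is the
  gradient of \<open>\<phi>\<close>: along \<open>sgn z\<close> the value on the sphere, by
  homogeneity, and across it the tangential part of \<open>r\<close> times \<open>s\<close>. The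
  powers of \<open>norm z\<close> cancel.\<close>

definition cone_grad :: "('a::euclidean_space \<Rightarrow> real) \<Rightarrow> ('a \<Rightarrow> 'a) \<Rightarrow> real \<Rightarrow> 'a \<Rightarrow> 'a \<Rightarrow> 'a" where
  "cone_grad \<phi> s r x z = (\<phi> (x + r *\<^sub>R sgn z) - \<phi> x) *\<^sub>R sgn z +
     r *\<^sub>R (s (x + r *\<^sub>R sgn z) - (s (x + r *\<^sub>R sgn z) \<bullet> sgn z) *\<^sub>R sgn z)"

text \<open>The radial and the tangential part are orthogonal and have length at most
  \<open>r * G\<close> each, so the squared norm is at most
  \<open>2 * (r\<^sup>2 * G\<^sup>2)\<close>.\<close>

lemma norm_cone_grad:
  fixes \<phi> :: "'a::euclidean_space \<Rightarrow> real"
  assumes lip: "\<And>y w. \<bar>\<phi> y - \<phi> w\<bar> \<le> G * norm (y - w)" and s: "\<And>y. norm (s y) \<le> G"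
    and r: "0 < r" and z: "z \<noteq> 0"
  shows "norm (cone_grad \<phi> s r x z) ^ 4 \<le> 4 * r ^ 4 * G ^ 4"
proof -
  define u where "u = sgn z"
  define h where "h = \<phi> (x + r *\<^sub>R u) - \<phi> x"
  define w where "w = s (x + r *\<^sub>R u)"
  have u: "u \<bullet> u = 1" using z by (simp add: u_def norm_sgn flip: power2_norm_eq_inner)
  have "\<bar>h\<bar> \<le> G * r" using lip[of "x + r *\<^sub>R u" x] r z by (simp add: h_def u_def norm_sgn)
  hence h: "h\<^sup>2 \<le> r\<^sup>2 * G\<^sup>2" using power_mono[of "\<bar>h\<bar>" "G * r" 2] by (simp add: power_mult_distrib mult.commute)
  have "w \<bullet> w \<le> G\<^sup>2" using power_mono[OF s[of "x + r *\<^sub>R u"] norm_ge_zero, of 2] by (simp add: w_def power2_norm_eq_inner)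
  hence "r\<^sup>2 * (w \<bullet> w) \<le> r\<^sup>2 * G\<^sup>2" by (intro mult_left_mono) auto
  moreover have "(norm (cone_grad \<phi> s r x z))\<^sup>2 = h\<^sup>2 + r\<^sup>2 * (w \<bullet> w) - r\<^sup>2 * (w \<bullet> u)\<^sup>2"
    unfolding cone_grad_def u_def[symmetric] h_def[symmetric] w_def[symmetric] power2_norm_eq_inner
    using u by (simp add: inner_add_left inner_add_right inner_diff_left inner_diff_right inner_commute power2_eq_square algebra_simps)
  moreover have "0 \<le> r\<^sup>2 * (w \<bullet> u)\<^sup>2" by simp
  ultimately have "(norm (cone_grad \<phi> s r x z))\<^sup>2 \<le> 2 * (r\<^sup>2 * G\<^sup>2)" using h by linarith
  hence "((norm (cone_grad \<phi> s r x z))\<^sup>2)\<^sup>2 \<le> (2 * (r\<^sup>2 * G\<^sup>2))\<^sup>2" by (rule power_mono) simp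
  thus ?thesis by (simp add: power_mult_distrib flip: power_mult)
qed

text \<open>The circle leaves \<open>z\<close> with velocity \<open>w\<close>. The derivative at
  angle 0 suffices, because by rotation invariance every step of the path has the law of the first
  one.\<close>

lemma cone_ext_circle_deriv:
  fixes \<phi> :: "'a::euclidean_space \<Rightarrow> real"
  assumes d: "\<And>y. (\<phi> has_derivative (\<lambda>h. s y \<bullet> h)) (at y)" and z: "z \<noteq> 0"
  shows "((\<lambda>\<theta>. cone_ext \<phi> r x (cos \<theta> *\<^sub>R z + sin \<theta> *\<^sub>R w)) has_real_derivative cone_grad \<phi> s r x z \<bullet> w) (at 0)"
proof -
  let ?\<gamma> = "\<lambda>\<theta>. cos \<theta> *\<^sub>R z + sin \<theta> *\<^sub>R w"
  let ?u = "\<lambda>\<theta>. inverse (norm (?\<gamma> \<theta>)) *\<^sub>R ?\<gamma> \<theta>"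
  let ?u' = "inverse (norm z) *\<^sub>R w - (inverse (norm z) * (sgn z \<bullet> w) * inverse (norm z)) *\<^sub>R z"
  have \<gamma>: "(?\<gamma> has_vector_derivative w) (at 0)"
    by (auto intro!: derivative_eq_intros simp: has_vector_derivative_def)
  have "(norm has_derivative (\<lambda>h. h \<bullet> sgn z)) (at (?\<gamma> 0))" using has_derivative_norm[OF z] by simp
  hence "((\<lambda>\<theta>. norm (?\<gamma> \<theta>)) has_derivative (\<lambda>t. (t *\<^sub>R w) \<bullet> sgn z)) (at 0)"
    using \<gamma> unfolding has_vector_derivative_def by (rule has_derivative_compose[rotated])
  moreover have "(\<lambda>t. (t *\<^sub>R w) \<bullet> sgn z) = (*) (sgn z \<bullet> w)" by (auto simp: fun_eq_iff inner_commute)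
  ultimately have n: "((\<lambda>\<theta>. norm (?\<gamma> \<theta>)) has_real_derivative sgn z \<bullet> w) (at 0)"
    by (simp add: has_field_derivative_def)
  have i: "((\<lambda>\<theta>. inverse (norm (?\<gamma> \<theta>))) has_real_derivative - (inverse (norm z) * (sgn z \<bullet> w) * inverse (norm z))) (at 0)"
    using DERIV_inverse'[OF n] z by simp
  have "(?u has_vector_derivative (inverse (norm (?\<gamma> 0)) *\<^sub>R w + (- (inverse (norm z) * (sgn z \<bullet> w) * inverse (norm z))) *\<^sub>R ?\<gamma> 0)) (at 0)"
    by (rule has_vector_derivative_scaleR[OF i \<gamma>])
  hence u: "(?u has_vector_derivative ?u') (at 0)" by simp
  have "((\<lambda>\<theta>. x + r *\<^sub>R ?u \<theta>) has_vector_derivative 0 + r *\<^sub>R ?u') (at 0)"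
    by (intro has_vector_derivative_add has_vector_derivative_const
          bounded_linear.has_vector_derivative[OF bounded_linear_scaleR_right u])
  hence v: "((\<lambda>\<theta>. x + r *\<^sub>R ?u \<theta>) has_derivative (\<lambda>t. t *\<^sub>R (r *\<^sub>R ?u'))) (at 0)"
    by (simp add: has_vector_derivative_def)
  let ?y = "x + r *\<^sub>R sgn z"
  have "(\<phi> has_derivative (\<lambda>h. s ?y \<bullet> h)) (at (x + r *\<^sub>R ?u 0))" using d[of ?y] by (simp add: sgn_div_norm)
  hence "((\<lambda>\<theta>. \<phi> (x + r *\<^sub>R ?u \<theta>)) has_derivative (\<lambda>t. s ?y \<bullet> (t *\<^sub>R (r *\<^sub>R ?u')))) (at 0)"
    by (rule has_derivative_compose[OF v])
  moreover have "(\<lambda>t. s ?y \<bullet> (t *\<^sub>R (r *\<^sub>R ?u'))) = (*) (s ?y \<bullet> (r *\<^sub>R ?u'))" by (auto simp: fun_eq_iff)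
  ultimately have "((\<lambda>\<theta>. \<phi> (x + r *\<^sub>R ?u \<theta>)) has_real_derivative s ?y \<bullet> (r *\<^sub>R ?u')) (at 0)"
    unfolding has_field_derivative_def by (simp only:)
  from DERIV_diff[OF this DERIV_const]
  have p: "((\<lambda>\<theta>. \<phi> (x + r *\<^sub>R ?u \<theta>) - \<phi> x) has_real_derivative s ?y \<bullet> (r *\<^sub>R ?u')) (at 0)"
    by (simp only: diff_0_right)
  have "((\<lambda>\<theta>. norm (?\<gamma> \<theta>) * (\<phi> (x + r *\<^sub>R ?u \<theta>) - \<phi> x)) has_real_derivative
     norm (?\<gamma> 0) * (s ?y \<bullet> (r *\<^sub>R ?u')) + (sgn z \<bullet> w) * (\<phi> (x + r *\<^sub>R ?u 0) - \<phi> x)) (at 0)"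
    by (rule DERIV_mult'[OF n p])
  moreover have "norm (?\<gamma> 0) * (s ?y \<bullet> (r *\<^sub>R ?u')) + (sgn z \<bullet> w) * (\<phi> (x + r *\<^sub>R ?u 0) - \<phi> x) = cone_grad \<phi> s r x z \<bullet> w"
  proof -
    have "norm z *\<^sub>R ?u' = w - (sgn z \<bullet> w) *\<^sub>R sgn z"
      using z by (simp add: scaleR_diff_right sgn_div_norm mult.assoc[symmetric])
    hence e: "norm z * (s ?y \<bullet> (r *\<^sub>R ?u')) = r * (s ?y \<bullet> (w - (sgn z \<bullet> w) *\<^sub>R sgn z))"
      by (metis inner_scaleR_right mult.left_commute)
    show ?thesis
      unfolding cos_zero sin_zero scaleR_one scaleR_zero_left add_0_right e sgn_div_norm[symmetric] cone_grad_def
      by (simp add: inner_add_left inner_diff_left inner_diff_right algebra_simps)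
  qed
  ultimately show ?thesis by (simp add: cone_ext_def sgn_div_norm)
qed


text \<open>The subgradient inequality at \<open>y\<close> makes the first-order remainder
  nonnegative; the one at \<open>y + h\<close> in direction \<open>- h\<close> bounds it by
  \<open>(s (y + h) - s y) \<bullet> h\<close>, which continuity makes small compared with
  \<open>norm h\<close>.\<close>

lemma has_derivative_of_continuous_subgradient:
  fixes \<phi> :: "'a::euclidean_space \<Rightarrow> real"
  assumes sub: "\<And>y v. \<phi> y + s y \<bullet> v \<le> \<phi> (y + v)" and sc: "continuous_on UNIV s"
  shows "(\<phi> has_derivative (\<lambda>h. s y \<bullet> h)) (at y)"
  unfolding has_derivative_at
proof
  show "bounded_linear (\<lambda>h. s y \<bullet> h)" by (rule bounded_linear_inner_right)
  have "((\<lambda>h. norm (s (y + h) - s y)) \<longlongrightarrow> norm (s (y + 0) - s y)) (at 0)"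
    using sc by (intro tendsto_intros isCont_tendsto_compose[of _ s])
      (auto simp: continuous_on_eq_continuous_at intro!: tendsto_eq_intros)
  hence lim: "((\<lambda>h. norm (s (y + h) - s y)) \<longlongrightarrow> 0) (at 0)" by simp
  show "(\<lambda>h. norm (\<phi> (y + h) - \<phi> y - s y \<bullet> h) / norm h) \<midarrow>0\<rightarrow> 0"
  proof (rule tendsto_sandwich[OF _ _ tendsto_const lim])
    show "\<forall>\<^sub>F h in at 0. norm (\<phi> (y + h) - \<phi> y - s y \<bullet> h) / norm h \<le> norm (s (y + h) - s y)"
    proof (rule eventually_at_topological[THEN iffD2], intro exI[of _ UNIV] conjI ballI impI)
      fix h :: 'a assume h: "h \<noteq> 0"
      have "0 \<le> \<phi> (y + h) - \<phi> y - s y \<bullet> h" using sub[of y h] by simp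
      moreover have "\<phi> (y + h) - \<phi> y - s y \<bullet> h \<le> (s (y + h) - s y) \<bullet> h"
        using sub[of "y + h" "- h"] by (simp add: inner_diff_left)
      moreover have "(s (y + h) - s y) \<bullet> h \<le> norm (s (y + h) - s y) * norm h" by (rule norm_cauchy_schwarz)
      ultimately show "norm (\<phi> (y + h) - \<phi> y - s y \<bullet> h) / norm h \<le> norm (s (y + h) - s y)"
        using h by (simp add: divide_le_eq)
    qed auto
  qed (auto intro!: always_eventually)
qed

lemma lipschitz_of_bounded_subgradient:
  fixes \<phi> :: "'a::real_inner \<Rightarrow> real"
  assumes sub: "\<And>y v. \<phi> y + s y \<bullet> v \<le> \<phi> (y + v)" and sG: "\<And>y. norm (s y) \<le> G"
  shows "\<bar>\<phi> y - \<phi> w\<bar> \<le> G * norm (y - w)"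
proof -
  have *: "\<phi> a - \<phi> b \<le> G * norm (a - b)" for a b
  proof -
    have "\<phi> a - \<phi> b \<le> s a \<bullet> (a - b)" using sub[of a "b - a"] by (simp add: inner_diff_right)
    also have "\<dots> \<le> norm (s a) * norm (a - b)" by (rule norm_cauchy_schwarz)
    also have "\<dots> \<le> G * norm (a - b)" by (intro mult_right_mono sG) auto
    finally show ?thesis .
  qed
  show ?thesis using *[of y w] *[of w y] by (simp add: norm_minus_commute abs_le_iff)
qed

text \<open>The path from \<open>z\<close> to \<open>-z\<close> along the circle through an independent copy is cut into \<open>N\<close> rotation
  steps, which all have the same law; letting \<open>N\<close> tend to infinity turns the step into a derivative.\<close>

lemma gauss_antipodal_steps:
  fixes F :: "real^'n \<Rightarrow> real"
  assumes [measurable]: "F \<in> borel_measurable borel" and N: "2 \<le> N"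
  shows "(\<integral>\<^sup>+z. ennreal ((F (- z) - F z) ^ 4) \<partial>gauss) \<le>
    (\<integral>\<^sup>+z. \<integral>\<^sup>+w. ennreal ((real N * (F (cos (pi / real N) *\<^sub>R z + sin (pi / real N) *\<^sub>R w) - F z)) ^ 4) \<partial>gauss \<partial>gauss)"
proof -
  interpret prob_space "gauss :: (real^'n) measure" by (rule prob_space_gauss)
  define \<theta> where "\<theta> = pi / real N"
  define p where "p = (\<lambda>k z w. cos (real k * \<theta>) *\<^sub>R z + sin (real k * \<theta>) *\<^sub>R (w :: real^'n))"
  have pm [measurable]: "(\<lambda>(z, w). p k z w) \<in> borel_measurable (borel \<Otimes>\<^sub>M borel)" for k
    unfolding p_def by measurable
  define I where "I = (\<integral>\<^sup>+z. \<integral>\<^sup>+w. ennreal ((F (cos \<theta> *\<^sub>R z + sin \<theta> *\<^sub>R w) - F z) ^ 4) \<partial>gauss \<partial>gauss)"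
  have step: "(\<integral>\<^sup>+z. \<integral>\<^sup>+w. ennreal ((F (p (Suc k) z w) - F (p k z w)) ^ 4) \<partial>gauss \<partial>gauss) = I" if "k < N" for k
  \<comment> \<open>\<open>nn_integral_gauss_rotation\<close> excludes a vanishing sine, hence the
    separate first step; for the others the angle lies strictly between 0 and
    \<open>pi\<close>.\<close>
  proof (cases "k = 0")
    case True
    thus ?thesis by (simp add: p_def I_def)
  next
    case False
    have "0 < real k * \<theta>" "real k * \<theta> < pi" using False that by (auto simp: \<theta>_def field_simps)
    hence s: "sin (real k * \<theta>) \<noteq> 0" using sin_gt_zero by force
    let ?c = "cos (real k * \<theta>)" and ?s = "sin (real k * \<theta>)"
    \<comment> \<open>The \<open>k\<close>-th point and the point a quarter turn ahead of it form a
      rotated pair, and the next point arises from this pair just as the first step arises from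
      \<open>z\<close> and \<open>w\<close>.\<close>
    have "p (Suc k) z w = cos \<theta> *\<^sub>R (?c *\<^sub>R z + ?s *\<^sub>R w) + sin \<theta> *\<^sub>R (?c *\<^sub>R w - ?s *\<^sub>R z)" for z w
    proof -
      have "real (Suc k) * \<theta> = \<theta> + real k * \<theta>" by (simp add: algebra_simps)
      thus ?thesis unfolding p_def by (simp only: cos_add sin_add) (simp add: algebra_simps)
    qed
    hence "(\<integral>\<^sup>+z. \<integral>\<^sup>+w. ennreal ((F (p (Suc k) z w) - F (p k z w)) ^ 4) \<partial>gauss \<partial>gauss) =
      (\<integral>\<^sup>+z. \<integral>\<^sup>+w. (\<lambda>a b. ennreal ((F (cos \<theta> *\<^sub>R a + sin \<theta> *\<^sub>R b) - F a) ^ 4)) (?c *\<^sub>R z + ?s *\<^sub>R w) (?c *\<^sub>R w - ?s *\<^sub>R z) \<partial>gauss \<partial>gauss)"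
      by (simp add: p_def)
    also have "\<dots> = I" unfolding I_def
      by (rule nn_integral_gauss_rotation[OF _ sin_cos_squared_add2 s]) measurable
    finally show ?thesis .
  qed
  have p0: "p 0 z w = z" and pN: "p N z w = - z" for z w
    using N by (simp_all add: p_def \<theta>_def)
  have pm' [measurable]: "(\<lambda>w. p k z w) \<in> borel_measurable borel" for k z unfolding p_def by measurable
  have "(\<integral>\<^sup>+z. ennreal ((F (- z) - F z) ^ 4) \<partial>gauss) = (\<integral>\<^sup>+z. \<integral>\<^sup>+w. ennreal ((F (p N z w) - F (p 0 z w)) ^ 4) \<partial>gauss \<partial>gauss)"
    using emeasure_space_1 by (simp add: p0 pN)
  also have "\<dots> \<le> (\<integral>\<^sup>+z. \<integral>\<^sup>+w. (\<Sum>k<N. ennreal (real N ^ 3) * ennreal ((F (p (Suc k) z w) - F (p k z w)) ^ 4)) \<partial>gauss \<partial>gauss)"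
  proof (intro nn_integral_mono)
    fix z w
    have "(F (p N z w) - F (p 0 z w)) ^ 4 = (\<Sum>k<N. F (p (Suc k) z w) - F (p k z w)) ^ 4"
      using sum_lessThan_telescope[of "\<lambda>k. F (p k z w)" N] by simp
    also have "\<dots> \<le> real N ^ 3 * (\<Sum>k<N. (F (p (Suc k) z w) - F (p k z w)) ^ 4)" by (rule sum_power4_le)
    finally show "ennreal ((F (p N z w) - F (p 0 z w)) ^ 4) \<le> (\<Sum>k<N. ennreal (real N ^ 3) * ennreal ((F (p (Suc k) z w) - F (p k z w)) ^ 4))"
      by (simp add: ennreal_mult'[symmetric] sum_distrib_left sum_nonneg ennreal_leI)
  qed
  also have "\<dots> = (\<Sum>k<N. ennreal (real N ^ 3) * (\<integral>\<^sup>+z. \<integral>\<^sup>+w. ennreal ((F (p (Suc k) z w) - F (p k z w)) ^ 4) \<partial>gauss \<partial>gauss))"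
    by (simp add: nn_integral_sum nn_integral_cmult del: sum_ennreal)
  also have "\<dots> = (\<Sum>k<N. ennreal (real N ^ 3) * I)" using step by (intro sum.cong) auto
  also have "\<dots> = ennreal (real N ^ 4) * I"
    using N by (simp add: ennreal_of_nat_eq_real_of_nat mult.assoc[symmetric] ennreal_mult'[symmetric] power_Suc[symmetric] del: power_Suc)
  also have "\<dots> = (\<integral>\<^sup>+z. \<integral>\<^sup>+w. ennreal ((real N * (F (cos \<theta> *\<^sub>R z + sin \<theta> *\<^sub>R w) - F z)) ^ 4) \<partial>gauss \<partial>gauss)"
    unfolding I_def by (simp add: power_mult_distrib ennreal_mult' nn_integral_cmult)
  finally show ?thesis by (simp add: \<theta>_def)
qed


text \<open>The Gaussian bound \<open>I0\<close> for the antipodal difference of the homogeneous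
  extension is free of the dimension. By homogeneity it factors into the wanted moment on the sphere
  and the fourth moment of the length, and the latter is at least \<open>n\<^sup>2\<close>. The
  constant collects \<open>pi ^ 4 \<le> 4 ^ 4\<close>, 27 / 2 from
  \<open>gauss_fourth_moment\<close> and 4 from \<open>norm_cone_grad\<close>.\<close>

lemma sphere_fourth_moment_C1:
  fixes \<phi> :: "real^'n \<Rightarrow> real"
  assumes sub: "\<And>y v. \<phi> y + s y \<bullet> v \<le> \<phi> (y + v)" and sc: "continuous_on UNIV s"
    and sG: "\<And>y. norm (s y) \<le> G" and r: "0 < r"
  shows "(\<integral>\<^sup>+e. ennreal ((\<phi> (x + r *\<^sub>R e) - \<phi> (x - r *\<^sub>R e)) ^ 4) \<partial>uniform_sphere)
    \<le> ennreal (13824 * r ^ 4 * G ^ 4 / (real CARD('n))\<^sup>2)"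
proof -
  interpret prob_space "gauss :: (real^'n) measure" by (rule prob_space_gauss)
  interpret P: pair_prob_space "gauss :: (real^'n) measure" "gauss :: (real^'n) measure" ..
  interpret S: prob_space "uniform_sphere :: (real^'n) measure" by (rule prob_space_uniform_sphere)
  have G: "0 \<le> G" using sG[of 0] norm_ge_zero order.trans by blast
  note lip = lipschitz_of_bounded_subgradient[OF sub sG]
  note der = has_derivative_of_continuous_subgradient[OF sub sc]
  have "continuous_on UNIV \<phi>"
    using der by (auto intro!: continuous_at_imp_continuous_on has_derivative_continuous)
  hence [measurable]: "\<phi> \<in> borel_measurable borel" by (rule borel_measurable_continuous_onI)
  define F where "F = cone_ext \<phi> r x"
  have [measurable]: "F \<in> borel_measurable borel" unfolding F_def cone_ext_def[abs_def] by measurable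
  have [measurable]: "s \<in> borel_measurable borel" using sc by (rule borel_measurable_continuous_onI)
  have [measurable]: "cone_grad \<phi> s r x \<in> borel_measurable borel" unfolding cone_grad_def[abs_def] by measurable
  \<comment> \<open>The path has \<open>m + 2\<close> steps, since
    \<open>gauss_antipodal_steps\<close> is stated for at least two.\<close>
  define \<theta> where "\<theta> = (\<lambda>m. pi / real (m + 2))"
  have \<theta>: "0 < \<theta> m" for m by (simp add: \<theta>_def)
  have \<theta>lim: "\<theta> \<longlonglongrightarrow> 0" unfolding \<theta>_def by (rule LIMSEQ_ignore_initial_segment[OF lim_const_over_n])
  let ?\<Gamma> = "(gauss :: (real^'n) measure) \<Otimes>\<^sub>M (gauss :: (real^'n) measure)"
  define u where "u = (\<lambda>m (z, w). ennreal ((real (m + 2) * (F (cos (\<theta> m) *\<^sub>R z + sin (\<theta> m) *\<^sub>R w) - F z)) ^ 4))"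
  define I0 where "I0 = (\<integral>\<^sup>+z. ennreal ((F (- z) - F z) ^ 4) \<partial>gauss)"
  have um [measurable]: "u m \<in> borel_measurable ?\<Gamma>" for m unfolding u_def by measurable
  have le: "I0 \<le> (\<integral>\<^sup>+p. u m p \<partial>?\<Gamma>)" for m
  proof -
    have "I0 \<le> (\<integral>\<^sup>+z. \<integral>\<^sup>+w. u m (z, w) \<partial>gauss \<partial>gauss)"
      unfolding I0_def u_def \<theta>_def prod.case by (rule gauss_antipodal_steps) auto
    also have "\<dots> = (\<integral>\<^sup>+p. u m p \<partial>?\<Gamma>)" by (rule nn_integral_fst) measurable
    finally show ?thesis .
  qed
  define U where "U = (\<lambda>(z, w). ennreal ((pi * (cone_grad \<phi> s r x z \<bullet> w)) ^ 4))"
  have Um [measurable]: "U \<in> borel_measurable ?\<Gamma>" unfolding U_def by measurable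
  \<comment> \<open>Dominates every \<open>u m\<close>: \<open>3 * r * G\<close> is the Lipschitz
    constant of \<open>F\<close>, \<open>pi\<close> the total angle, and the 8 comes from splitting
    the fourth power of \<open>norm z + norm w\<close>.\<close>
  define W where "W = (\<lambda>(z, w). ennreal (8 * (3 * r * G * pi) ^ 4) * (ennreal (norm (z::real^'n) ^ 4) + ennreal (norm (w::real^'n) ^ 4)))"
  have Wm [measurable]: "W \<in> borel_measurable ?\<Gamma>" unfolding W_def by measurable
  have lim: "(\<lambda>m. \<integral>\<^sup>+p. u m p \<partial>?\<Gamma>) \<longlonglongrightarrow> (\<integral>\<^sup>+p. U p \<partial>?\<Gamma>)"
  proof (rule nn_integral_dominated_convergence[where w=W])
    show "AE p in ?\<Gamma>. u m p \<le> W p" for m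
    proof (rule AE_I2, clarify)
      fix z w :: "real^'n"
      have c: "\<bar>cos (\<theta> m) - 1\<bar> \<le> \<theta> m"
      proof -
        have "1 - cos (\<theta> m) = 2 * (sin (\<theta> m / 2))\<^sup>2" using cos_double_sin[of "\<theta> m / 2"] by simp
        also have "\<dots> \<le> 2 * (\<bar>\<theta> m / 2\<bar> * 1)"
          using mult_mono[OF abs_sin_x_le_abs_x[of "\<theta> m / 2"] abs_sin_le_one[of "\<theta> m / 2"]]
          by (simp add: power2_eq_square)
        finally show ?thesis using \<theta>[of m] cos_le_one[of "\<theta> m"] by simp
      qed
      have sn: "\<bar>sin (\<theta> m)\<bar> \<le> \<theta> m" using abs_sin_x_le_abs_x[of "\<theta> m"] \<theta>[of m] by simp
      have "cos (\<theta> m) *\<^sub>R z + sin (\<theta> m) *\<^sub>R w - z = (cos (\<theta> m) - 1) *\<^sub>R z + sin (\<theta> m) *\<^sub>R w"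
        by (simp add: algebra_simps)
      also have "norm \<dots> \<le> \<bar>cos (\<theta> m) - 1\<bar> * norm z + \<bar>sin (\<theta> m)\<bar> * norm w"
        by (rule order.trans[OF norm_triangle_ineq]) simp
      also have "\<dots> \<le> \<theta> m * norm z + \<theta> m * norm w"
        by (intro add_mono mult_right_mono c sn) auto
      finally have n: "norm (cos (\<theta> m) *\<^sub>R z + sin (\<theta> m) *\<^sub>R w - z) \<le> \<theta> m * (norm z + norm w)"
        by (simp add: algebra_simps)
      have "\<bar>F (cos (\<theta> m) *\<^sub>R z + sin (\<theta> m) *\<^sub>R w) - F z\<bar> \<le> 3 * r * G * norm (cos (\<theta> m) *\<^sub>R z + sin (\<theta> m) *\<^sub>R w - z)"
        unfolding F_def by (rule cone_ext_lipschitz[OF lip G r])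
      also have "\<dots> \<le> 3 * r * G * (\<theta> m * (norm z + norm w))" using G r by (intro mult_left_mono n) auto
      finally have "real (m + 2) * \<bar>F (cos (\<theta> m) *\<^sub>R z + sin (\<theta> m) *\<^sub>R w) - F z\<bar> \<le> real (m + 2) * (3 * r * G * (\<theta> m * (norm z + norm w)))"
        by (intro mult_left_mono) auto
      also have "\<dots> = 3 * r * G * ((real (m + 2) * \<theta> m) * (norm z + norm w))" by (simp only: mult_ac)
      also have "real (m + 2) * \<theta> m = pi" by (simp add: \<theta>_def)
      finally have "\<bar>real (m + 2) * (F (cos (\<theta> m) *\<^sub>R z + sin (\<theta> m) *\<^sub>R w) - F z)\<bar> \<le> (3 * r * G * pi) * (norm z + norm w)"
        by (simp add: abs_mult mult.assoc)
      hence "\<bar>real (m + 2) * (F (cos (\<theta> m) *\<^sub>R z + sin (\<theta> m) *\<^sub>R w) - F z)\<bar> ^ 4 \<le> ((3 * r * G * pi) * (norm z + norm w)) ^ 4"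
        by (rule power_mono) simp
      also have "\<dots> \<le> (3 * r * G * pi) ^ 4 * (8 * (norm z ^ 4 + norm w ^ 4))"
      proof -
        have "(norm z + norm w) ^ 4 \<le> 8 * (norm z ^ 4 + norm w ^ 4)"
          using sum_power4_le[of "\<lambda>i. if i = 0 then norm z else norm w" 2]
          by (simp add: lessThan_Suc numeral_2_eq_2 add.commute)
        thus ?thesis unfolding power_mult_distrib[of "3 * r * G * pi"]
          by (rule mult_left_mono) (rule zero_le_even_power, simp)
      qed
      finally have "(real (m + 2) * (F (cos (\<theta> m) *\<^sub>R z + sin (\<theta> m) *\<^sub>R w) - F z)) ^ 4 \<le> 8 * (3 * r * G * pi) ^ 4 * (norm z ^ 4 + norm w ^ 4)"
        by (simp only: power_even_abs even_numeral mult_ac)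
      hence "ennreal ((real (m + 2) * (F (cos (\<theta> m) *\<^sub>R z + sin (\<theta> m) *\<^sub>R w) - F z)) ^ 4) \<le> ennreal (8 * (3 * r * G * pi) ^ 4 * (norm z ^ 4 + norm w ^ 4))"
        by (rule ennreal_leI)
      also have "\<dots> = ennreal (8 * (3 * r * G * pi) ^ 4) * (ennreal (norm z ^ 4) + ennreal (norm w ^ 4))"
        by (subst ennreal_plus[symmetric], simp, simp, subst ennreal_mult', simp, rule refl)
      finally show "u m (z, w) \<le> W (z, w)" by (simp add: u_def W_def)
    qed
    have "(\<integral>\<^sup>+p. W p \<partial>?\<Gamma>) = (\<integral>\<^sup>+z. \<integral>\<^sup>+w. W (z, w) \<partial>gauss \<partial>gauss)"
      by (rule nn_integral_fst[symmetric]) measurable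
    also have "\<dots> = ennreal (8 * (3 * r * G * pi) ^ 4) * ((\<integral>\<^sup>+z. ennreal (norm z ^ 4) \<partial>(gauss :: (real^'n) measure)) + (\<integral>\<^sup>+z. ennreal (norm z ^ 4) \<partial>(gauss :: (real^'n) measure)))"
      unfolding W_def prod.case using emeasure_space_1
      by (simp add: nn_integral_cmult nn_integral_add)
    also have "\<dots> < \<infinity>"
      using gauss_norm4_finite[where 'n='n] by (simp add: ennreal_mult_less_top)
    finally show "(\<integral>\<^sup>+p. W p \<partial>?\<Gamma>) < \<infinity>" .
    have "AE p in ?\<Gamma>. fst p \<noteq> 0"
    proof -
      have "AE z in gauss. z \<noteq> (0::real^'n)"
        unfolding gauss_def by (subst AE_density) (use AE_lborel_nonzero in auto)
      hence "AE z in gauss. AE w in (gauss :: (real^'n) measure). fst (z, w) \<noteq> (0::real^'n)" by simp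
      moreover have "{p \<in> space ?\<Gamma>. fst p \<noteq> 0} \<in> sets ?\<Gamma>" by measurable
      ultimately show ?thesis by (intro P.AE_pair_measure[of "\<lambda>p. fst p \<noteq> 0"])
    qed
    thus "AE p in ?\<Gamma>. (\<lambda>m. u m p) \<longlonglongrightarrow> U p"
    proof eventually_elim
      case (elim p)
      obtain z w where p: "p = (z, w)" by (cases p)
      hence z: "z \<noteq> 0" using elim by simp
      have "((\<lambda>\<theta>. (F (cos \<theta> *\<^sub>R z + sin \<theta> *\<^sub>R w) - F z) / \<theta>) \<longlongrightarrow> cone_grad \<phi> s r x z \<bullet> w) (at 0)"
        using cone_ext_circle_deriv[where \<phi>=\<phi> and s=s and r=r and x=x and w=w, OF der z]
        by (simp add: has_field_derivative_iff F_def)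
      moreover have "filterlim \<theta> (at 0) sequentially"
        unfolding filterlim_at using \<theta>lim \<theta> by (auto intro!: always_eventually) (metis less_irrefl \<theta>)
      ultimately have "(\<lambda>m. (F (cos (\<theta> m) *\<^sub>R z + sin (\<theta> m) *\<^sub>R w) - F z) / \<theta> m) \<longlonglongrightarrow> cone_grad \<phi> s r x z \<bullet> w"
        by (rule filterlim_compose)
      hence "(\<lambda>m. ennreal ((pi * ((F (cos (\<theta> m) *\<^sub>R z + sin (\<theta> m) *\<^sub>R w) - F z) / \<theta> m)) ^ 4)) \<longlonglongrightarrow> U p"
        unfolding p U_def prod.case by (intro tendsto_intros)
      moreover have "pi * (a / \<theta> m) = real (m + 2) * a" for a m by (simp add: \<theta>_def)
      ultimately show ?case unfolding p u_def prod.case by simp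
    qed
  qed auto
  have "I0 \<le> (\<integral>\<^sup>+p. U p \<partial>?\<Gamma>)" by (rule LIMSEQ_le_const[OF lim]) (use le in auto)
  also have "\<dots> = (\<integral>\<^sup>+z. \<integral>\<^sup>+w. U (z, w) \<partial>gauss \<partial>gauss)" by (rule nn_integral_fst[symmetric]) measurable
  \<comment> \<open>For fixed \<open>z\<close> the inner integral is the fourth moment of a linear
    form in the independent copy \<open>w\<close>, with coefficient vector
    \<open>cone_grad\<close>.\<close>
  also have "\<dots> \<le> (\<integral>\<^sup>+z. ennreal (13824 * r ^ 4 * G ^ 4) \<partial>(gauss :: (real^'n) measure))"
  proof (rule nn_integral_mono_AE)
    have "AE z in gauss. z \<noteq> (0::real^'n)"
      unfolding gauss_def by (subst AE_density) (use AE_lborel_nonzero in auto)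
    thus "AE z in gauss. (\<integral>\<^sup>+w. U (z, w) \<partial>gauss) \<le> ennreal (13824 * r ^ 4 * G ^ 4)"
    proof eventually_elim
      case (elim z)
      let ?a = "cone_grad \<phi> s r x z"
      have "(\<integral>\<^sup>+w. U (z, w) \<partial>gauss) = ennreal (pi ^ 4) * (\<integral>\<^sup>+w. ennreal ((?a \<bullet> w) ^ 4) \<partial>gauss)"
        unfolding U_def prod.case by (simp add: power_mult_distrib ennreal_mult' nn_integral_cmult)
      also have "\<dots> \<le> ennreal (pi ^ 4) * ennreal (27 / 2 * norm ?a ^ 4)"
        by (intro mult_left_mono gauss_fourth_moment) auto
      also have "\<dots> = ennreal (pi ^ 4 * (27 / 2 * norm ?a ^ 4))" by (subst ennreal_mult'[symmetric]) auto
      also have "\<dots> \<le> ennreal (4 ^ 4 * (27 / 2 * (4 * r ^ 4 * G ^ 4)))"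
        using norm_cone_grad[where \<phi>=\<phi> and s=s and r=r and G=G and x=x and z=z, OF lip sG r elim] pi_less_4
        by (intro ennreal_leI mult_mono power_mono mult_left_mono) auto
      also have "4 ^ 4 * (27 / 2 * (4 * r ^ 4 * G ^ 4)) = 13824 * r ^ 4 * G ^ 4" by simp
      finally show ?case .
    qed
  qed
  also have "\<dots> = ennreal (13824 * r ^ 4 * G ^ 4)" using emeasure_space_1 by simp
  finally have I0: "I0 \<le> ennreal (13824 * r ^ 4 * G ^ 4)" .
  let ?h = "\<lambda>e. \<phi> (x + r *\<^sub>R e) - \<phi> (x - r *\<^sub>R e)"
  let ?E = "\<integral>\<^sup>+e. ennreal (?h e ^ 4) \<partial>uniform_sphere"
  have fin: "?E < \<infinity>"
  proof -
    have "?E \<le> (\<integral>\<^sup>+e. ennreal ((2 * r * G) ^ 4) \<partial>(uniform_sphere :: (real^'n) measure))"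
    proof (rule nn_integral_mono_AE, use AE_uniform_sphere_norm in eventually_elim)
      fix e :: "real^'n" assume e: "norm e = 1"
      have "x + r *\<^sub>R e - (x - r *\<^sub>R e) = (2 * r) *\<^sub>R e" by (simp add: algebra_simps flip: scaleR_2)
      hence "norm (x + r *\<^sub>R e - (x - r *\<^sub>R e)) = 2 * r" using r e by simp
      hence "\<bar>?h e\<bar> \<le> 2 * r * G" using lip[of "x + r *\<^sub>R e" "x - r *\<^sub>R e"] by (simp add: mult_ac)
      hence "\<bar>?h e\<bar> ^ 4 \<le> (2 * r * G) ^ 4" by (rule power_mono) simp
      thus "ennreal (?h e ^ 4) \<le> ennreal ((2 * r * G) ^ 4)" by (intro ennreal_leI) (simp add: power_even_abs)
    qed
    thus ?thesis using S.emeasure_space_1 by (simp add: order_le_less_trans)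
  qed
  have "?E * ennreal ((real CARD('n))\<^sup>2) \<le> ?E * (\<integral>\<^sup>+z. ennreal (norm z ^ 4) \<partial>(gauss :: (real^'n) measure))"
    using gauss_norm_moment_lower[where 'n='n and k=2] by (intro mult_left_mono) auto
  also have "\<dots> = (\<integral>\<^sup>+z. ennreal (norm z ^ 4) * ennreal (?h (sgn z) ^ 4) \<partial>gauss)"
    by (rule gauss_polar[symmetric]) (use fin in auto)
  also have "\<dots> = I0"
  proof -
    have "norm z ^ 4 * ?h (sgn z) ^ 4 = (F (- z) - F z) ^ 4" for z
    proof -
      have "F (- z) - F z = - (norm z * ?h (sgn z))" by (simp add: F_def cone_ext_def sgn_minus algebra_simps)
      thus ?thesis by (simp add: power_mult_distrib)
    qed
    thus ?thesis unfolding I0_def by (simp add: ennreal_mult'[symmetric])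
  qed
  also note I0
  finally have *: "?E * ennreal ((real CARD('n))\<^sup>2) \<le> ennreal (13824 * r ^ 4 * G ^ 4)" .
  obtain E where E: "?E = ennreal E" "0 \<le> E" using fin by (cases ?E) auto
  have "E * (real CARD('n))\<^sup>2 \<le> 13824 * r ^ 4 * G ^ 4"
    using * E r G by (simp add: ennreal_mult'[symmetric])
  thus ?thesis using E by (simp add: ennreal_leI field_simps)
qed

text \<open>Test the subgradient inequality in the direction of the vector itself, and use that the
  smoothed function inherits the Lipschitz constant.\<close>

lemma norm_sphere_grad_le:
  fixes f :: "real^'n \<Rightarrow> real"
  assumes f: "G-lipschitz_on UNIV f" and cf: "convex_on UNIV f" and r: "0 < r"
  shows "norm (sphere_grad f r y) \<le> G"
proof -
  let ?s = "sphere_grad f r y"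
  have "(norm ?s)\<^sup>2 \<le> smoothed f r (y + ?s) - smoothed f r y"
    using sphere_grad_subgradient[OF f cf r, of y ?s] by (simp add: power2_norm_eq_inner)
  also have "\<dots> \<le> G * norm ?s" using lipschitz_UNIV_D[OF smoothed_lipschitz[OF f r], of "y + ?s" y] by simp
  finally have "norm ?s * norm ?s \<le> G * norm ?s" by (simp add: power2_eq_square)
  thus ?thesis using lipschitz_on_nonneg[OF f] by (cases "?s = 0") auto
qed

text \<open>\<open>sphere_fourth_moment_C1\<close> wants a continuous subgradient. Smoothing at an
  auxiliary radius \<open>\<delta>\<close> provides one, still bounded by \<open>G\<close> whatever
  \<open>\<delta>\<close> is, and changes the fourth powers by at most
  \<open>\<epsilon>\<close>.\<close>

lemma sphere_fourth_moment_convex: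
  fixes f :: "real^'n \<Rightarrow> real"
  assumes f: "G-lipschitz_on UNIV f" and cf: "convex_on UNIV f" and r: "0 < r"
  shows "(\<integral>\<^sup>+e. ennreal ((f (x + r *\<^sub>R e) - f (x - r *\<^sub>R e)) ^ 4) \<partial>uniform_sphere)
    \<le> ennreal (13824 * r ^ 4 * G ^ 4 / (real CARD('n))\<^sup>2)"
proof (rule ennreal_le_epsilon)
  interpret S: prob_space "uniform_sphere :: (real^'n) measure" by (rule prob_space_uniform_sphere)
  note [measurable] = lipschitz_UNIV_measurable[OF f]
  have G: "0 \<le> G" using f by (rule lipschitz_on_nonneg)
  fix \<epsilon> :: real assume \<epsilon>: "0 < \<epsilon>"
  define c where "c = 2 * r * G"
  have c: "0 \<le> c" using r G by (simp add: c_def)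
  \<comment> \<open>The added 1 keeps the denominator positive when \<open>G = 0\<close>.\<close>
  define \<delta> where "\<delta> = \<epsilon> / (8 * G * c ^ 3 + 1)"
  have \<delta>: "0 < \<delta>" using \<epsilon> G c by (simp add: \<delta>_def add_nonneg_pos)
  have d\<epsilon>: "8 * \<delta> * G * c ^ 3 \<le> \<epsilon>"
  proof -
    have "8 * \<delta> * G * c ^ 3 \<le> \<delta> * (8 * G * c ^ 3 + 1)" using \<delta> by (simp add: algebra_simps)
    also have "\<dots> = \<epsilon>" using G c by (simp add: \<delta>_def add_nonneg_eq_0_iff)
    finally show ?thesis .
  qed
  define \<phi> where "\<phi> = smoothed f \<delta>"
  have l\<phi>: "G-lipschitz_on UNIV \<phi>" unfolding \<phi>_def by (rule smoothed_lipschitz[OF f \<delta>])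
  note [measurable] = lipschitz_UNIV_measurable[OF l\<phi>]
  let ?h = "\<lambda>g e. g (x + r *\<^sub>R e) - g (x - r *\<^sub>R e)"
  have hb: "\<bar>?h g e\<bar> \<le> c" if "G-lipschitz_on UNIV g" "norm e = 1" for g e
  proof -
    have "x + r *\<^sub>R e - (x - r *\<^sub>R e) = (2 * r) *\<^sub>R e" by (simp add: algebra_simps flip: scaleR_2)
    hence "norm (x + r *\<^sub>R e - (x - r *\<^sub>R e)) = 2 * r" using r that by simp
    thus ?thesis using lipschitz_UNIV_D[OF that(1), of "x + r *\<^sub>R e" "x - r *\<^sub>R e"] by (simp add: c_def mult_ac)
  qed
  have "(\<integral>\<^sup>+e. ennreal (?h f e ^ 4) \<partial>uniform_sphere) \<le> (\<integral>\<^sup>+e. ennreal (?h \<phi> e ^ 4) + ennreal (8 * \<delta> * G * c ^ 3) \<partial>uniform_sphere)"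
  proof (rule nn_integral_mono_AE, use AE_uniform_sphere_norm in eventually_elim)
    fix e :: "real^'n" assume e: "norm e = 1"
    define a where "a = ?h f e"
    define b where "b = ?h \<phi> e"
    have ab: "\<bar>a\<bar> \<le> c" "\<bar>b\<bar> \<le> c" using hb[OF f e] hb[OF l\<phi> e] by (auto simp: a_def b_def)
    \<comment> \<open>The difference \<open>a ^ 4 - b ^ 4\<close> factors into \<open>a - b\<close>,
      \<open>a + b\<close> and \<open>a\<^sup>2 + b\<^sup>2\<close>; only the first factor is small
      with \<open>\<delta>\<close>.\<close>
    have "\<bar>a - b\<bar> \<le> 2 * (\<delta> * G)"
      using smoothed_close[OF f \<delta>, of "x + r *\<^sub>R e"] smoothed_close[OF f \<delta>, of "x - r *\<^sub>R e"]
      unfolding a_def b_def \<phi>_def by linarith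
    moreover have "\<bar>a + b\<bar> \<le> 2 * c" using ab by linarith
    moreover have "\<bar>a\<^sup>2 + b\<^sup>2\<bar> \<le> 2 * c\<^sup>2"
      using power_mono[OF ab(1), of 2] power_mono[OF ab(2), of 2] by simp
    ultimately have "\<bar>a - b\<bar> * (\<bar>a + b\<bar> * \<bar>a\<^sup>2 + b\<^sup>2\<bar>) \<le> 2 * (\<delta> * G) * (2 * c * (2 * c\<^sup>2))"
      using \<delta> G c by (intro mult_mono) auto
    hence "\<bar>(a - b) * ((a + b) * (a\<^sup>2 + b\<^sup>2))\<bar> \<le> 8 * \<delta> * G * c ^ 3"
      unfolding abs_mult by (simp add: power3_eq_cube power2_eq_square mult_ac)
    moreover have "(a - b) * ((a + b) * (a\<^sup>2 + b\<^sup>2)) = a ^ 4 - b ^ 4"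
      by (simp add: power4_eq_xxxx power2_eq_square algebra_simps)
    ultimately have "a ^ 4 \<le> b ^ 4 + 8 * \<delta> * G * c ^ 3" by linarith
    hence "ennreal (a ^ 4) \<le> ennreal (b ^ 4 + 8 * \<delta> * G * c ^ 3)" by (rule ennreal_leI)
    also have "\<dots> = ennreal (b ^ 4) + ennreal (8 * \<delta> * G * c ^ 3)"
      using \<delta> G c by (intro ennreal_plus) auto
    finally show "ennreal (?h f e ^ 4) \<le> ennreal (?h \<phi> e ^ 4) + ennreal (8 * \<delta> * G * c ^ 3)"
      by (simp add: a_def b_def)
  qed
  also have "\<dots> = (\<integral>\<^sup>+e. ennreal (?h \<phi> e ^ 4) \<partial>uniform_sphere) + ennreal (8 * \<delta> * G * c ^ 3)"
    using S.emeasure_space_1 by (simp add: nn_integral_add)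
  also have "\<dots> \<le> ennreal (13824 * r ^ 4 * G ^ 4 / (real CARD('n))\<^sup>2) + ennreal \<epsilon>"
  proof (intro add_mono ennreal_leI d\<epsilon>)
    show "(\<integral>\<^sup>+e. ennreal (?h \<phi> e ^ 4) \<partial>uniform_sphere) \<le> ennreal (13824 * r ^ 4 * G ^ 4 / (real CARD('n))\<^sup>2)"
    proof (rule sphere_fourth_moment_C1[where s="sphere_grad f \<delta>", OF _ _ _ r])
      show "\<phi> y + sphere_grad f \<delta> y \<bullet> v \<le> \<phi> (y + v)" for y v
        using sphere_grad_subgradient[OF f cf \<delta>, of y v] by (simp add: \<phi>_def)
    qed (auto simp: sphere_grad_continuous[OF f \<delta>] norm_sphere_grad_le[OF f cf \<delta>])
  qed
  finally show "(\<integral>\<^sup>+e. ennreal (?h f e ^ 4) \<partial>uniform_sphere) \<le> ennreal (13824 * r ^ 4 * G ^ 4 / (real CARD('n))\<^sup>2) + ennreal \<epsilon>" .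
qed

text \<open>The pointwise inequality \<open>t \<le> t\<^sup>2 / (2 * c) + c / 2\<close>, with
  \<open>c\<close> the root of the fourth-moment bound, replaces the Cauchy-Schwarz
  inequality.\<close>

lemma sphere_lp_second_moment:
  assumes n2: "CARD('n::finite) \<ge> 2" and q: "1 \<le> q"
  shows "(\<integral>\<^sup>+e. ennreal ((lp_norm q e)\<^sup>2) \<partial>(uniform_sphere :: (real^'n) measure))
    \<le> ennreal ((p_const q CARD('n))\<^sup>2)"
proof -
  interpret S: prob_space "uniform_sphere :: (real^'n) measure" by (rule prob_space_uniform_sphere)
  define c where "c = (p_const q CARD('n))\<^sup>2"
  have c: "0 < c" using p_const_pos[OF n2 q] by (simp add: c_def)
  have c4: "p_const q CARD('n) ^ 4 = c\<^sup>2" by (simp only: c_def power4_eq_square)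
  have "(\<integral>\<^sup>+e. ennreal ((lp_norm q e)\<^sup>2) \<partial>(uniform_sphere :: (real^'n) measure))
    \<le> (\<integral>\<^sup>+e. ennreal (1 / (2 * c)) * ennreal (lp_norm q e ^ 4) + ennreal (c / 2) \<partial>(uniform_sphere :: (real^'n) measure))"
  proof (rule nn_integral_mono)
    fix e :: "real^'n"
    have "0 \<le> ((lp_norm q e)\<^sup>2 - c)\<^sup>2 / (2 * c)" using c by simp
    also have "\<dots> = 1 / (2 * c) * lp_norm q e ^ 4 + c / 2 - (lp_norm q e)\<^sup>2"
      using c by (simp add: power2_diff power4_eq_square field_simps power2_eq_square)
    finally have "(lp_norm q e)\<^sup>2 \<le> 1 / (2 * c) * lp_norm q e ^ 4 + c / 2" by simp
    thus "ennreal ((lp_norm q e)\<^sup>2) \<le> ennreal (1 / (2 * c)) * ennreal (lp_norm q e ^ 4) + ennreal (c / 2)"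
      using c by (simp add: ennreal_mult'[symmetric] ennreal_plus[symmetric] ennreal_leI del: ennreal_plus)
  qed
  also have "\<dots> = ennreal (1 / (2 * c)) * (\<integral>\<^sup>+e. ennreal (lp_norm q e ^ 4) \<partial>(uniform_sphere :: (real^'n) measure)) + ennreal (c / 2)"
    using S.emeasure_space_1 by (simp add: nn_integral_add nn_integral_cmult)
  also have "\<dots> \<le> ennreal (1 / (2 * c)) * ennreal (p_const q CARD('n) ^ 4) + ennreal (c / 2)"
    by (intro add_mono mult_left_mono sphere_lp_fourth_moment n2 q) auto
  also have "\<dots> = ennreal (1 / (2 * c) * c\<^sup>2 + c / 2)"
    unfolding c4 using c by (simp add: ennreal_mult'[symmetric] ennreal_plus[symmetric] del: ennreal_plus)
  also have "1 / (2 * c) * c\<^sup>2 + c / 2 = c" using c by (simp add: power2_eq_square)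
  finally show ?thesis by (simp add: c_def)
qed

text \<open>The Cauchy-Schwarz inequality in arithmetic-geometric form: the weights
  \<open>c / (2 * k)\<close> and \<open>k / (2 * c)\<close> balance the two fourth-moment bounds
  \<open>k\<^sup>2\<close> and \<open>c\<^sup>2\<close>, so that \<open>k * c\<close> results. The
  square of 118 is 13924, just above 13824.\<close>

lemma sphere_weighted_second_moment:
  fixes f :: "real^'n \<Rightarrow> real"
  assumes f: "G-lipschitz_on UNIV f" and cf: "convex_on UNIV f" and r: "0 < r" and G: "0 < G"
    and n2: "CARD('n) \<ge> 2" and q: "1 \<le> q"
  shows "(\<integral>\<^sup>+e. ennreal ((f (x + r *\<^sub>R e) - f (x - r *\<^sub>R e))\<^sup>2 * (lp_norm q e)\<^sup>2) \<partial>uniform_sphere)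
    \<le> ennreal (118 * r\<^sup>2 * G\<^sup>2 / real CARD('n) * (p_const q CARD('n))\<^sup>2)"
proof -
  note [measurable] = lipschitz_UNIV_measurable[OF f]
  define c where "c = (p_const q CARD('n))\<^sup>2"
  have c: "0 < c" using p_const_pos[OF n2 q] by (simp add: c_def)
  have c4: "p_const q CARD('n) ^ 4 = c\<^sup>2" by (simp only: c_def power4_eq_square)
  define k where "k = 118 * r\<^sup>2 * G\<^sup>2 / real CARD('n)"
  have k: "0 < k" using r G by (simp add: k_def)
  have k2: "13824 * r ^ 4 * G ^ 4 / (real CARD('n))\<^sup>2 \<le> k\<^sup>2"
    unfolding k_def power_divide power_mult_distrib power4_eq_square
    by (intro divide_right_mono mult_right_mono) auto
  let ?h = "\<lambda>e. f (x + r *\<^sub>R e) - f (x - r *\<^sub>R e)"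
  have "(\<integral>\<^sup>+e. ennreal ((?h e)\<^sup>2 * (lp_norm q e)\<^sup>2) \<partial>uniform_sphere)
    \<le> (\<integral>\<^sup>+e. ennreal (c / (2 * k)) * ennreal (?h e ^ 4) + ennreal (k / (2 * c)) * ennreal (lp_norm q e ^ 4) \<partial>uniform_sphere)"
  proof (rule nn_integral_mono)
    fix e :: "real^'n"
    define a where "a = (?h e)\<^sup>2"
    define b where "b = (lp_norm q e)\<^sup>2"
    have "0 \<le> (c * a - k * b)\<^sup>2 / (2 * k * c)" using c k by simp
    also have "\<dots> = c / (2 * k) * a\<^sup>2 + k / (2 * c) * b\<^sup>2 - a * b"
      using c k by (simp add: power2_diff power2_eq_square field_simps)
    finally have "a * b \<le> c / (2 * k) * a\<^sup>2 + k / (2 * c) * b\<^sup>2" by simp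
    hence "ennreal (a * b) \<le> ennreal (c / (2 * k) * a\<^sup>2 + k / (2 * c) * b\<^sup>2)" by (rule ennreal_leI)
    also have "\<dots> = ennreal (c / (2 * k)) * ennreal (a\<^sup>2) + ennreal (k / (2 * c)) * ennreal (b\<^sup>2)"
      using c k by (simp add: ennreal_mult'[symmetric] ennreal_plus[symmetric] del: ennreal_plus)
    finally show "ennreal ((?h e)\<^sup>2 * (lp_norm q e)\<^sup>2) \<le> ennreal (c / (2 * k)) * ennreal (?h e ^ 4) + ennreal (k / (2 * c)) * ennreal (lp_norm q e ^ 4)"
      by (simp only: a_def b_def power4_eq_square)
  qed
  also have "\<dots> = ennreal (c / (2 * k)) * (\<integral>\<^sup>+e. ennreal (?h e ^ 4) \<partial>uniform_sphere) + ennreal (k / (2 * c)) * (\<integral>\<^sup>+e. ennreal (lp_norm q e ^ 4) \<partial>(uniform_sphere :: (real^'n) measure))"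
    by (simp add: nn_integral_add nn_integral_cmult)
  also have "\<dots> \<le> ennreal (c / (2 * k)) * ennreal (k\<^sup>2) + ennreal (k / (2 * c)) * ennreal (p_const q CARD('n) ^ 4)"
    by (intro add_mono mult_left_mono sphere_lp_fourth_moment n2 q order.trans[OF sphere_fourth_moment_convex[OF f cf r] ennreal_leI[OF k2]]) auto
  also have "\<dots> = ennreal (c / (2 * k) * k\<^sup>2 + k / (2 * c) * c\<^sup>2)"
    unfolding c4 using c k by (simp add: ennreal_mult'[symmetric] ennreal_plus[symmetric] del: ennreal_plus)
  also have "c / (2 * k) * k\<^sup>2 + k / (2 * c) * c\<^sup>2 = k * c" using c k by (simp add: power2_eq_square)
  finally show ?thesis by (simp add: c_def k_def)
qed

text \<open>Infimal convolution with \<open>G |x|\<close>.\<close>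

lemma convex_lipschitz_extension:
  fixes f :: "real^'n \<Rightarrow> real"
  assumes cf: "convex_on K f" and f: "G-lipschitz_on K f" and K: "K \<noteq> {}"
  obtains F where "convex_on UNIV F" "G-lipschitz_on UNIV F" "\<And>x. x \<in> K \<Longrightarrow> F x = f x"
proof -
  have G: "0 \<le> G" using f by (rule lipschitz_on_nonneg)
  have cK: "convex K" using cf by (simp add: convex_on_def)
  define F where "F = (\<lambda>x. INF z\<in>K. f z + G * norm (x - z))"
  obtain z0 where z0: "z0 \<in> K" using K by blast
  have lipK: "f z - f w \<le> G * norm (z - w)" if "z \<in> K" "w \<in> K" for z w
    using lipschitz_onD[OF f that] by (simp add: dist_norm)
  have bdd: "bdd_below ((\<lambda>z. f z + G * norm (x - z)) ` K)" for x
  proof (rule bdd_belowI2)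
    fix z assume z: "z \<in> K"
    have "f z0 - f z \<le> G * norm (z0 - z)" by (rule lipK[OF z0 z])
    also have "\<dots> \<le> G * (norm (x - z0) + norm (x - z))"
      using norm_triangle_ineq4[of "x - z" "x - z0"] G by (intro mult_left_mono) auto
    finally show "f z0 - G * norm (x - z0) \<le> f z + G * norm (x - z)" by (simp add: algebra_simps)
  qed
  have le: "F x \<le> f z + G * norm (x - z)" if "z \<in> K" for x z
    unfolding F_def by (rule cINF_lower[OF bdd that])
  \<comment> \<open>The infimum need not be attained, so near-minimisers take the place of
    minimisers, and an arbitrary \<open>\<epsilon>\<close> is carried through.\<close>
  have approx: "\<exists>z\<in>K. f z + G * norm (x - z) < F x + \<epsilon>" if "\<epsilon> > 0" for x \<epsilon>
    using cINF_less_iff[OF K bdd, of x "F x + \<epsilon>"] that unfolding F_def[symmetric] by (auto simp: F_def)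
  have "F x = f x" if x: "x \<in> K" for x
  proof (rule antisym)
    show "F x \<le> f x" using le[OF x, of x] by simp
    show "f x \<le> F x" unfolding F_def
      by (rule cINF_greatest[OF K]) (use lipK[OF x] in \<open>auto simp: algebra_simps\<close>)
  qed
  moreover have "G-lipschitz_on UNIV F"
  proof (rule lipschitz_onI)
    have *: "F x - F y \<le> G * norm (x - y)" for x y
    proof (rule field_le_epsilon)
      fix \<epsilon> :: real assume "\<epsilon> > 0"
      then obtain z where z: "z \<in> K" "f z + G * norm (y - z) < F y + \<epsilon>" using approx by blast
      have "G * norm (x - z) \<le> G * (norm (x - y) + norm (y - z))"
        using norm_triangle_ineq[of "x - y" "y - z"] G by (intro mult_left_mono) auto
      thus "F x - F y \<le> G * norm (x - y) + \<epsilon>" using le[OF z(1), of x] z(2) by (simp add: distrib_left)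
    qed
    show "dist (F x) (F y) \<le> G * dist x y" for x y
      using *[of x y] *[of y x] by (simp add: dist_norm abs_le_iff norm_minus_commute)
  qed (rule G)
  moreover have "convex_on UNIV F"
  proof (rule convex_onI)
    fix t :: real and x y :: "real^'n" assume t: "0 < t" "t < 1"
    show "F ((1 - t) *\<^sub>R x + t *\<^sub>R y) \<le> (1 - t) * F x + t * F y"
    proof (rule field_le_epsilon)
      fix \<epsilon> :: real assume "\<epsilon> > 0"
      then obtain z w where z: "z \<in> K" "f z + G * norm (x - z) < F x + \<epsilon>"
        and w: "w \<in> K" "f w + G * norm (y - w) < F y + \<epsilon>" using approx by meson
      have m: "(1 - t) *\<^sub>R z + t *\<^sub>R w \<in> K" using z w t by (intro convexD[OF cK]) auto
      have "(1 - t) *\<^sub>R x + t *\<^sub>R y - ((1 - t) *\<^sub>R z + t *\<^sub>R w) = (1 - t) *\<^sub>R (x - z) + t *\<^sub>R (y - w)"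
        by (simp add: algebra_simps)
      hence "norm ((1 - t) *\<^sub>R x + t *\<^sub>R y - ((1 - t) *\<^sub>R z + t *\<^sub>R w)) \<le> (1 - t) * norm (x - z) + t * norm (y - w)"
        using t norm_triangle_ineq[of "(1 - t) *\<^sub>R (x - z)" "t *\<^sub>R (y - w)"] by simp
      hence "G * norm ((1 - t) *\<^sub>R x + t *\<^sub>R y - ((1 - t) *\<^sub>R z + t *\<^sub>R w)) \<le> G * ((1 - t) * norm (x - z) + t * norm (y - w))"
        using G by (intro mult_left_mono)
      moreover have "f ((1 - t) *\<^sub>R z + t *\<^sub>R w) \<le> (1 - t) * f z + t * f w"
        using t z w by (intro convex_onD[OF cf]) auto
      moreover have "(1 - t) * (f z + G * norm (x - z)) \<le> (1 - t) * (F x + \<epsilon>)"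
        "t * (f w + G * norm (y - w)) \<le> t * (F y + \<epsilon>)"
        using t z w by (auto intro!: mult_left_mono)
      ultimately show "F ((1 - t) *\<^sub>R x + t *\<^sub>R y) \<le> (1 - t) * F x + t * F y + \<epsilon>"
        using le[OF m, of "(1 - t) *\<^sub>R x + t *\<^sub>R y"] by (simp add: algebra_simps)
    qed
  qed simp
  ultimately show ?thesis using that by blast
qed

section \<open>Mirror descent steps and the sliding scheme\<close>

text \<open>Gradients are taken within \<open>S\<close>, so endpoints may lie on its boundary.
  Restricting to a segment, with derivatives within \<open>{0..1}\<close>, reduces the convexity
  arguments below to calculus in one variable.\<close>

lemma segment_has_derivative:
  fixes f :: "'a::real_inner \<Rightarrow> real"
  assumes "has_gradient_on f f' S" "convex S" "x \<in> S" "y \<in> S" "t \<in> {0..1}"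
  shows "((\<lambda>t. f (x + t *\<^sub>R (y - x))) has_real_derivative f' (x + t *\<^sub>R (y - x)) \<bullet> (y - x)) (at t within {0..1})"
proof -
  let ?c = "\<lambda>t. x + t *\<^sub>R (y - x)"
  have seg: "?c s \<in> S" if "s \<in> {0..1}" for s
  proof -
    have "(1 - s) *\<^sub>R x + s *\<^sub>R y \<in> S" using that assms by (intro convexD) auto
    thus ?thesis by (simp add: algebra_simps)
  qed
  have "(f has_derivative (\<lambda>h. f' (?c t) \<bullet> h)) (at (?c t) within ?c ` {0..1})"
    using assms seg unfolding has_gradient_on_def by (blast intro: has_derivative_subset)
  moreover have "(?c has_derivative (\<lambda>s. s *\<^sub>R (y - x))) (at t within {0..1})"
    by (auto intro!: derivative_eq_intros)
  ultimately have "((\<lambda>t. f (?c t)) has_derivative (\<lambda>s. f' (?c t) \<bullet> (s *\<^sub>R (y - x)))) (at t within {0..1})"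
    by (rule has_derivative_in_compose[rotated])
  thus ?thesis by (simp add: has_field_derivative_def mult_commute_abs)
qed

lemma directional_limit:
  fixes f :: "'a::real_inner \<Rightarrow> real"
  assumes "has_gradient_on f f' S" "convex S" "x \<in> S" "y \<in> S"
  shows "((\<lambda>t. (f (x + t *\<^sub>R (y - x)) - f x) / t) \<longlongrightarrow> f' x \<bullet> (y - x)) (at_right 0)"
  using segment_has_derivative[OF assms, of 0]
  by (simp add: has_field_derivative_iff at_within_Icc_at_right)

lemma eventually_at_right_0_1: "eventually (\<lambda>t. 0 < t \<and> t < (1::real)) (at_right 0)"
  by (rule eventually_mono[OF eventually_at_right_real[of 0 1]]) auto

lemma convex_combination_eq: "(1 - t) *\<^sub>R x + t *\<^sub>R y = x + t *\<^sub>R (y - (x::'a::real_vector))"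
  by (simp add: algebra_simps)

lemma convex_on_gradient_ineq:
  fixes f :: "'a::real_inner \<Rightarrow> real"
  assumes "has_gradient_on f f' S" "convex_on S f" "x \<in> S" "y \<in> S"
  shows "f x + f' x \<bullet> (y - x) \<le> f y"
proof -
  have S: "convex S" using assms(2) by (simp add: convex_on_def)
  have "f' x \<bullet> (y - x) \<le> f y - f x"
  proof (rule tendsto_upperbound[OF directional_limit[OF assms(1) S assms(3,4)]])
    show "\<forall>\<^sub>F t in at_right 0. (f (x + t *\<^sub>R (y - x)) - f x) / t \<le> f y - f x"
      using eventually_at_right_0_1
    proof eventually_elim
      case (elim t)
      have "f ((1 - t) *\<^sub>R x + t *\<^sub>R y) \<le> (1 - t) * f x + t * f y"
        using elim assms by (intro convex_onD) auto
      thus ?case using elim unfolding convex_combination_eq by (simp add: field_simps)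
    qed
  qed simp
  thus ?thesis by simp
qed

text \<open>Divide the strong convexity inequality by the weight \<open>t\<close> of
  \<open>y\<close> and let \<open>t\<close> tend to 0; the other weight \<open>1 - t\<close> tends
  to 1.\<close>

lemma strongly_convex_bregman:
  fixes f :: "'a::real_inner \<Rightarrow> real"
  assumes "has_gradient_on f f' S" "strongly_convex_on nrm \<mu> S f" "x \<in> S" "y \<in> S"
  shows "\<mu> / 2 * (nrm (x - y))\<^sup>2 \<le> bregman f f' x y"
proof -
  have S: "convex S" using assms(2) by (simp add: strongly_convex_on_def)
  have "f' x \<bullet> (y - x) \<le> f y - f x - \<mu> / 2 * (1 - 0) * (nrm (x - y))\<^sup>2"
  proof (rule tendsto_le[OF _ _ directional_limit[OF assms(1) S assms(3,4)]])
    show "((\<lambda>t. f y - f x - \<mu> / 2 * (1 - t) * (nrm (x - y))\<^sup>2) \<longlongrightarrow> f y - f x - \<mu> / 2 * (1 - 0) * (nrm (x - y))\<^sup>2) (at_right 0)"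
      by (intro tendsto_intros)
    show "\<forall>\<^sub>F t in at_right 0. (f (x + t *\<^sub>R (y - x)) - f x) / t \<le> f y - f x - \<mu> / 2 * (1 - t) * (nrm (x - y))\<^sup>2"
      using eventually_at_right_0_1
    proof eventually_elim
      case (elim t)
      have "f ((1 - t) *\<^sub>R x + t *\<^sub>R y) \<le> (1 - t) * f x + t * f y - \<mu> / 2 * (1 - t) * t * (nrm (x - y))\<^sup>2"
        using elim assms unfolding strongly_convex_on_def by auto
      thus ?case using elim unfolding convex_combination_eq by (simp add: field_simps)
    qed
  qed simp
  thus ?thesis by (simp add: bregman_def)
qed

text \<open>Subtract the quadratic model from \<open>g\<close> along the segment. The Hoelder
  inequality and smoothness make the derivative of the difference nonpositive, so monotonicity takes
  the place of an integral formula.\<close>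

lemma smooth_on_descent:
  fixes g :: "'a::real_inner \<Rightarrow> real"
  assumes "smooth_on nrm dual L S g g'" "convex S" "x \<in> S" "y \<in> S"
    and holder: "\<And>a b. \<bar>a \<bullet> b\<bar> \<le> dual a * nrm b" and scale: "\<And>c b. nrm (c *\<^sub>R b) = \<bar>c\<bar> * nrm b"
    and nn: "\<And>b. 0 \<le> nrm b"
  shows "g y \<le> g x + g' x \<bullet> (y - x) + L / 2 * (nrm (y - x))\<^sup>2"
proof -
  have G: "has_gradient_on g g' S" using assms(1) by (simp add: smooth_on_def)
  let ?c = "\<lambda>t. x + t *\<^sub>R (y - x)" and ?D = "(nrm (y - x))\<^sup>2"
  let ?\<phi> = "\<lambda>t. g (?c t) - t * (g' x \<bullet> (y - x)) - L / 2 * t\<^sup>2 * ?D"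
  have der: "(?\<phi> has_real_derivative (g' (?c t) - g' x) \<bullet> (y - x) - L * t * ?D) (at t within {0..1})" if "t \<in> {0..1}" for t
    by (rule derivative_eq_intros segment_has_derivative[OF G assms(2-4) that] refl | simp add: inner_diff_left)+
  have "?\<phi> 1 \<le> ?\<phi> 0"
  proof (rule DERIV_nonpos_imp_decreasing_open[of 0 1 ?\<phi>])
    show "continuous_on {0..1} ?\<phi>"
      using der by (intro DERIV_continuous_on) auto
    fix t :: real assume t: "0 < t" "t < 1"
    have "(?\<phi> has_real_derivative (g' (?c t) - g' x) \<bullet> (y - x) - L * t * ?D) (at t)"
      using der[of t] t by (simp add: at_within_Icc_at)
    moreover have "(g' (?c t) - g' x) \<bullet> (y - x) - L * t * ?D \<le> 0"
    proof -
      have "(1 - t) *\<^sub>R x + t *\<^sub>R y \<in> S" using t assms by (intro convexD) auto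
      hence "?c t \<in> S" by (simp add: convex_combination_eq)
      hence "dual (g' (?c t) - g' x) \<le> L * nrm (?c t - x)"
        using assms(1,3) unfolding smooth_on_def by blast
      also have "nrm (?c t - x) = t * nrm (y - x)" using t by (simp add: scale)
      finally have "dual (g' (?c t) - g' x) * nrm (y - x) \<le> L * (t * nrm (y - x)) * nrm (y - x)"
        by (intro mult_right_mono nn)
      moreover have "(g' (?c t) - g' x) \<bullet> (y - x) \<le> dual (g' (?c t) - g' x) * nrm (y - x)"
        using holder[of "g' (?c t) - g' x" "y - x"] by linarith
      ultimately show ?thesis by (simp add: power2_eq_square mult_ac)
    qed
    ultimately show "\<exists>d. (?\<phi> has_real_derivative d) (at t) \<and> d \<le> 0" by blast
  qed simp
  thus ?thesis by simp
qed

text \<open>\<open>arg_min_on\<close> is a Hilbert choice: the chosen points are equal because the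
  predicates that they are chosen from coincide.\<close>

lemma arg_min_on_add_const:
  fixes f :: "'a \<Rightarrow> real"
  assumes "\<And>v. v \<in> S \<Longrightarrow> f v = g v + c"
  shows "arg_min_on f S = arg_min_on g S"
proof -
  have "is_arg_min f (\<lambda>v. v \<in> S) = is_arg_min g (\<lambda>v. v \<in> S)"
    using assms by (auto simp: is_arg_min_def fun_eq_iff)
  thus ?thesis by (simp add: arg_min_on_def arg_min_def)
qed

text \<open>\<open>\<kappa>\<close> compares the Euclidean norm with \<open>nrm\<close>. It serves
  the continuity of the proximal map, and through it measurability; the rate does not contain
  it.\<close>

locale mirror_setup =
  fixes X :: "'a::euclidean_space set" and \<nu> :: "'a \<Rightarrow> real" and \<nu>' :: "'a \<Rightarrow> 'a"
    and nrm dual :: "'a \<Rightarrow> real" and \<kappa> :: real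
  assumes compact_X: "compact X" and convex_X: "convex X" and X_ne: "X \<noteq> {}"
    and grad_\<nu>: "has_gradient_on \<nu> \<nu>' X" and cont_\<nu>': "continuous_on X \<nu>'"
    and strong_\<nu>: "strongly_convex_on nrm 1 X \<nu>"
    and holder: "\<bar>a \<bullet> b\<bar> \<le> dual a * nrm b"
    and nrm_scale: "nrm (c *\<^sub>R b) = \<bar>c\<bar> * nrm b"
    and nrm_nonneg: "0 \<le> nrm b" and dual_nonneg: "0 \<le> dual b"
    and norm_le_nrm: "norm b \<le> \<kappa> * nrm b" and \<kappa>_pos: "0 < \<kappa>"
begin

abbreviation "V \<equiv> bregman \<nu> \<nu>'"

lemma cont_\<nu>: "continuous_on X \<nu>"
  using grad_\<nu> unfolding has_gradient_on_def continuous_on_eq_continuous_within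
  by (blast intro: has_derivative_continuous)

lemma nrm_minus_commute: "nrm (a - b) = nrm (b - a)"
  using nrm_scale[of "-1" "a - b"] by simp

lemma V_lower: "x \<in> X \<Longrightarrow> y \<in> X \<Longrightarrow> (nrm (y - x))\<^sup>2 \<le> 2 * V x y"
  using strongly_convex_bregman[OF grad_\<nu> strong_\<nu>, of x y] by (simp add: nrm_minus_commute)

lemma V_nonneg: "x \<in> X \<Longrightarrow> y \<in> X \<Longrightarrow> 0 \<le> V x y"
  using V_lower[of x y] by (smt (verit) zero_le_power2)

lemma V_three_point: "V x u = V x v + V v u + (\<nu>' v - \<nu>' x) \<bullet> (u - v)"
  by (simp add: bregman_def inner_diff_left inner_diff_right)

text \<open>The form of every inner step: the linear model and the linear parts of the divergences
  collect in \<open>c\<close>, the copies of \<open>\<nu>\<close> in \<open>w\<close>. All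
  randomness then sits in \<open>c\<close>, and iterates are measurable because
  \<open>prox w\<close> is continuous.\<close>

definition prox :: "real \<Rightarrow> 'a \<Rightarrow> 'a" where
  "prox w c = arg_min_on (\<lambda>v. c \<bullet> v + w * \<nu> v) X"

lemma prox_minimal: "prox w c \<in> X \<and> (\<forall>u\<in>X. c \<bullet> prox w c + w * \<nu> (prox w c) \<le> c \<bullet> u + w * \<nu> u)"
proof -
  have "continuous_on X (\<lambda>v. c \<bullet> v + w * \<nu> v)"
    by (intro continuous_intros cont_\<nu>)
  then obtain x where x: "x \<in> X" "\<forall>y\<in>X. c \<bullet> x + w * \<nu> x \<le> c \<bullet> y + w * \<nu> y"
    using continuous_attains_inf[OF compact_X X_ne] by blast
  hence "is_arg_min (\<lambda>v. c \<bullet> v + w * \<nu> v) (\<lambda>v. v \<in> X) x"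
    by (auto simp: is_arg_min_linorder)
  hence "is_arg_min (\<lambda>v. c \<bullet> v + w * \<nu> v) (\<lambda>v. v \<in> X) (prox w c)"
    unfolding prox_def arg_min_on_def arg_min_def by (rule someI)
  thus ?thesis by (auto simp: is_arg_min_linorder)
qed

lemma prox_in [simp]: "prox w c \<in> X" using prox_minimal by blast

lemma prox_optimal:
  assumes u: "u \<in> X"
  shows "0 \<le> (c + w *\<^sub>R \<nu>' (prox w c)) \<bullet> (u - prox w c)"
proof -
  let ?v = "prox w c"
  have "((\<lambda>t. c \<bullet> (u - ?v) + w * ((\<nu> (?v + t *\<^sub>R (u - ?v)) - \<nu> ?v) / t)) \<longlongrightarrow> c \<bullet> (u - ?v) + w * (\<nu>' ?v \<bullet> (u - ?v))) (at_right 0)"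
    by (intro tendsto_intros directional_limit[OF grad_\<nu> convex_X _ u]) simp
  hence "0 \<le> c \<bullet> (u - ?v) + w * (\<nu>' ?v \<bullet> (u - ?v))"
  proof (rule tendsto_lowerbound)
    show "\<forall>\<^sub>F t in at_right 0. 0 \<le> c \<bullet> (u - ?v) + w * ((\<nu> (?v + t *\<^sub>R (u - ?v)) - \<nu> ?v) / t)"
      using eventually_at_right_0_1
    proof eventually_elim
      case (elim t)
      have "(1 - t) *\<^sub>R ?v + t *\<^sub>R u \<in> X" using elim u by (intro convexD[OF convex_X]) auto
      hence "c \<bullet> ?v + w * \<nu> ?v \<le> c \<bullet> (?v + t *\<^sub>R (u - ?v)) + w * \<nu> (?v + t *\<^sub>R (u - ?v))"
        using prox_minimal unfolding convex_combination_eq by blast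
      hence "0 \<le> (t * (c \<bullet> (u - ?v)) + w * (\<nu> (?v + t *\<^sub>R (u - ?v)) - \<nu> ?v)) / t"
        using elim by (intro divide_nonneg_pos) (auto simp: inner_add_right algebra_simps)
      thus ?case using elim by (simp add: add_divide_distrib)
    qed
  qed simp
  thus ?thesis by (simp add: inner_add_left)
qed

text \<open>Add the optimality conditions of the two points, each tested with the other one; strong
  convexity makes \<open>\<nu>'\<close> strongly monotone.\<close>

lemma prox_lipschitz:
  assumes "w > 0"
  shows "norm (prox w c - prox w d) \<le> \<kappa>\<^sup>2 / w * norm (c - d)"
proof -
  let ?u = "prox w c" and ?v = "prox w d"
  have "0 \<le> (c + w *\<^sub>R \<nu>' ?u) \<bullet> (?v - ?u)" "0 \<le> (d + w *\<^sub>R \<nu>' ?v) \<bullet> (?u - ?v)"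
    by (rule prox_optimal, simp)+
  hence 1: "w * ((\<nu>' ?v - \<nu>' ?u) \<bullet> (?v - ?u)) \<le> (c - d) \<bullet> (?v - ?u)"
    by (simp add: inner_diff_left inner_diff_right inner_add_left algebra_simps)
  have "(nrm (?v - ?u))\<^sup>2 \<le> (\<nu>' ?v - \<nu>' ?u) \<bullet> (?v - ?u)"
    using V_lower[of ?u ?v] V_lower[of ?v ?u] nrm_minus_commute[of ?u ?v]
    by (simp add: bregman_def inner_diff_left inner_diff_right)
  hence "w * (nrm (?v - ?u))\<^sup>2 \<le> (c - d) \<bullet> (?v - ?u)" using 1 assms by (smt (verit) mult_left_mono)
  also have "\<dots> \<le> norm (c - d) * norm (?v - ?u)" by (rule norm_cauchy_schwarz)
  finally have "w * (nrm (?v - ?u))\<^sup>2 \<le> norm (c - d) * norm (?v - ?u)" .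
  moreover have "(norm (?v - ?u))\<^sup>2 \<le> \<kappa>\<^sup>2 * (nrm (?v - ?u))\<^sup>2"
    using power_mono[OF norm_le_nrm[of "?v - ?u"] norm_ge_zero, of 2] by (simp add: power_mult_distrib)
  ultimately have "w * (norm (?v - ?u))\<^sup>2 \<le> \<kappa>\<^sup>2 * (norm (c - d) * norm (?v - ?u))"
    using assms \<kappa>_pos by (smt (verit, ccfv_SIG) mult.left_commute mult_left_mono zero_le_power2)
  hence "norm (?v - ?u) * (w * norm (?v - ?u)) \<le> norm (?v - ?u) * (\<kappa>\<^sup>2 * norm (c - d))"
    by (simp add: power2_eq_square mult_ac)
  hence "norm (?v - ?u) = 0 \<or> w * norm (?v - ?u) \<le> \<kappa>\<^sup>2 * norm (c - d)"
    by (metis mult_left_le_imp_le norm_ge_zero less_eq_real_def)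
  hence "w * norm (?v - ?u) \<le> \<kappa>\<^sup>2 * norm (c - d)" by auto
  thus ?thesis using assms by (simp add: field_simps norm_minus_commute)
qed

lemma continuous_prox: "w > 0 \<Longrightarrow> continuous_on UNIV (prox w)"
  by (rule lipschitz_on_continuous_on[where L="\<kappa>\<^sup>2 / w"], rule lipschitz_onI)
     (simp_all only: dist_norm prox_lipschitz, simp)

lemma prox_step_eq:
  assumes "\<And>v. h v = a + b \<bullet> (v - z)"
  shows "arg_min_on (\<lambda>v. h v + G \<bullet> v + \<beta> * V x v + \<beta> * s * V u v) X =
    prox (\<beta> * (1 + s)) (b + G - \<beta> *\<^sub>R \<nu>' x - (\<beta> * s) *\<^sub>R \<nu>' u)"
  unfolding prox_def
proof (rule arg_min_on_add_const)
  fix v show "h v + G \<bullet> v + \<beta> * V x v + \<beta> * s * V u v =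
     ((b + G - \<beta> *\<^sub>R \<nu>' x - (\<beta> * s) *\<^sub>R \<nu>' u) \<bullet> v + \<beta> * (1 + s) * \<nu> v) +
     (a - b \<bullet> z - \<beta> * \<nu> x + \<beta> * (\<nu>' x \<bullet> x) - \<beta> * s * \<nu> u + \<beta> * s * (\<nu>' u \<bullet> u))"
    by (simp add: assms bregman_def inner_diff_left inner_diff_right inner_add_left algebra_simps)
qed

text \<open>This is \<open>prox_optimal\<close> after the three-point identity: the gradient
  differences turn into divergences, and both proximal terms leave a copy of \<open>V v u\<close>,
  with total weight \<open>\<beta> * (1 + s)\<close>.\<close>

lemma prox_step_ineq:
  assumes h: "\<And>v. h v = a + b \<bullet> (v - z)" and u: "u \<in> X" and y: "y \<in> X"
    and v: "v = arg_min_on (\<lambda>v. h v + G \<bullet> v + \<beta> * V x v + \<beta> * s * V y v) X"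
  shows "v \<in> X"
    and "h v + G \<bullet> v + \<beta> * V x v + \<beta> * s * V y v + \<beta> * (1 + s) * V v u
       \<le> h u + G \<bullet> u + \<beta> * V x u + \<beta> * s * V y u"
proof -
  let ?c = "b + G - \<beta> *\<^sub>R \<nu>' x - (\<beta> * s) *\<^sub>R \<nu>' y"
  have v: "v = prox (\<beta> * (1 + s)) ?c"
    unfolding v by (rule prox_step_eq[OF h])
  thus "v \<in> X" by simp
  have "0 \<le> (?c + (\<beta> * (1 + s)) *\<^sub>R \<nu>' v) \<bullet> (u - v)"
    unfolding v by (rule prox_optimal[OF u])
  thus "h v + G \<bullet> v + \<beta> * V x v + \<beta> * s * V y v + \<beta> * (1 + s) * V v u
       \<le> h u + G \<bullet> u + \<beta> * V x u + \<beta> * s * V y u"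
    unfolding V_three_point[of x u v] V_three_point[of y u v]
    by (simp add: h inner_diff_left inner_diff_right inner_add_left algebra_simps)
qed

end

section \<open>The inner procedure\<close>

context mirror_setup begin

lemma prox_sliding_Suc:
  "prox_sliding X V s \<theta> G h x \<beta> (Suc t) =
    (let u = fst (prox_sliding X V s \<theta> G h x \<beta> t); w = snd (prox_sliding X V s \<theta> G h x \<beta> t);
         v = arg_min_on (\<lambda>v. h v + G t u \<bullet> v + \<beta> * V x v + \<beta> * s (Suc t) * V u v) X
     in (v, (1 - \<theta> (Suc t)) *\<^sub>R w + \<theta> (Suc t) *\<^sub>R v))"
  by (simp add: Let_def split_beta)

lemma prox_sliding_in:
  assumes h: "\<And>v. h v = a + b \<bullet> (v - z)" and x: "x \<in> X" and th: "\<And>t. 0 \<le> \<theta> t \<and> \<theta> t \<le> 1"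
  shows "fst (prox_sliding X V s \<theta> G h x \<beta> t) \<in> X \<and> snd (prox_sliding X V s \<theta> G h x \<beta> t) \<in> X"
proof (induction t)
  case (Suc t)
  show ?case
    using Suc th[of "Suc t"] prox_step_ineq(1)[OF h x conjunct1[OF Suc] refl]
    by (simp add: prox_sliding_Suc Let_def convexD[OF convex_X] del: prox_sliding.simps)
qed (use x in simp)

lemma quadratic_bound:
  fixes a b c :: real
  assumes "c > 0"
  shows "a * b - c / 2 * b\<^sup>2 \<le> a\<^sup>2 / (2 * c)"
proof -
  have "0 \<le> (a - c * b)\<^sup>2 / (2 * c)" using assms by simp
  also have "\<dots> = a\<^sup>2 / (2 * c) - a * b + c / 2 * b\<^sup>2"
    using assms by (simp add: power2_eq_square field_simps)
  finally show ?thesis by simp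
qed

abbreviation "step_p \<equiv> \<lambda>t::nat. real t / 2"
abbreviation "step_\<theta> \<equiv> \<lambda>t::nat. 2 * (real t + 1) / (real t * (real t + 3))"

text \<open>At \<open>t = 0\<close> the division by zero gives 0, so the bounds hold for every
  index.\<close>

lemma step_\<theta>_range: "0 \<le> step_\<theta> t \<and> step_\<theta> t \<le> 1"
proof (cases t)
  case (Suc j)
  have "2 * (real j + 2) \<le> (real j + 1) * (real j + 4)"
    by (simp add: algebra_simps)
  moreover have "0 < (real j + 1) * (real j + 4)" by simp
  ultimately have "2 * (real j + 2) / ((real j + 1) * (real j + 4)) \<le> 1" by (simp only: divide_le_eq_1_pos)
  moreover have "step_\<theta> (Suc j) = 2 * (real j + 2) / ((real j + 1) * (real j + 4))"
    by (simp add: add_ac)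
  ultimately show ?thesis unfolding Suc by simp
qed simp

text \<open>With \<open>s\<close> counted from 0, step \<open>s\<close> has weight
  \<open>s + 2\<close>, and these weights add up to \<open>t * (t + 3) / 2\<close>. Since the
  proximal parameter is half the step number, the coefficient of the divergence that one weighted
  step leaves is the one that the next consumes, so the divergences telescope. No property of the
  oracle is used; its errors are collected in \<open>err\<close>, to be averaged later.\<close>

lemma prox_sliding_invariant:
  fixes F :: "'a \<Rightarrow> real" and \<beta> M :: real
  defines "P \<equiv> \<lambda>G h x t. prox_sliding X V step_p step_\<theta> G h x \<beta> t"
  defines "err \<equiv> \<lambda>G h x u t. G t (fst (P G h x t)) \<bullet> (u - fst (P G h x t)) + F (fst (P G h x t)) - F u
             + (M + dual (G t (fst (P G h x t))))\<^sup>2 / (\<beta> * (real t + 1))"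
  assumes h: "\<And>v. h v = a + b \<bullet> (v - z)" and x: "x \<in> X" and u: "u \<in> X" and \<beta>: "\<beta> > 0"
    and F: "convex_on X F" and FM: "\<And>v w. v \<in> X \<Longrightarrow> w \<in> X \<Longrightarrow> F v - F w \<le> M * nrm (v - w)"
  shows "real t * (real t + 3) / 2 *
       ((h (snd (P G h x t)) + F (snd (P G h x t)) + \<beta> * V x (snd (P G h x t))) - (h u + F u + \<beta> * V x u))
     + \<beta> / 2 * ((real t + 1) * (real t + 2)) * V (fst (P G h x t)) u
    \<le> \<beta> * V x u + (\<Sum>s<t. (real s + 2) * err G h x u s)"
proof (induction t)
  case 0
  show ?case by (simp add: P_def)
next
  case (Suc t)
  define y where "y = fst (P G h x t)"
  define w where "w = snd (P G h x t)"
  define v where "v = arg_min_on (\<lambda>v. h v + G t y \<bullet> v + \<beta> * V x v + \<beta> * step_p (Suc t) * V y v) X"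
  define \<theta> where "\<theta> = step_\<theta> (Suc t)"
  have PS: "P G h x (Suc t) = (v, (1 - \<theta>) *\<^sub>R w + \<theta> *\<^sub>R v)"
    unfolding P_def prox_sliding_Suc v_def w_def y_def \<theta>_def by (simp add: Let_def P_def)
  have yw: "y \<in> X" "w \<in> X"
    using prox_sliding_in[OF h x step_\<theta>_range] by (auto simp: y_def w_def P_def)
  note ps = prox_step_ineq[OF h u yw(1) v_def]
  have v: "v \<in> X" by (rule ps(1))
  define \<Phi> where "\<Phi> = (\<lambda>v. h v + F v + \<beta> * V x v)"
  define r where "r = real t + 1"
  have r: "r > 0" by (simp add: r_def)
  let ?g = "G t y"
  let ?e = "err G h x u t"
  have e: "?e = ?g \<bullet> (u - y) + F y - F u + (M + dual ?g)\<^sup>2 / (\<beta> * r)"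
    by (simp add: err_def y_def r_def)
  \<comment> \<open>The estimate belongs to the old point \<open>y\<close>. Passing to
    \<open>v\<close> costs a term linear in \<open>nrm (y - v)\<close>, which the proximal term
    \<open>\<beta> * (r / 2) * V y v\<close> absorbs up to the quadratic remainder in
    \<open>err\<close>.\<close>
  have "?g \<bullet> (y - v) \<le> dual ?g * nrm (y - v)"
    using holder[of ?g "y - v"] by linarith
  moreover have "F v \<le> F y + M * nrm (y - v)" using FM[OF v yw(1)] by (simp add: nrm_minus_commute)
  moreover have "(M + dual ?g) * nrm (y - v) - (\<beta> * (r / 2)) / 2 * (nrm (y - v))\<^sup>2 \<le> (M + dual ?g)\<^sup>2 / (2 * (\<beta> * (r / 2)))"
    by (rule quadratic_bound) (use \<beta> r in simp)
  moreover have "\<beta> * (r / 2) * ((nrm (y - v))\<^sup>2 / 2) \<le> \<beta> * (r / 2) * V y v"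
    using V_lower[OF yw(1) v] \<beta> r by (intro mult_left_mono) (auto simp: nrm_minus_commute)
  ultimately have *: "?g \<bullet> (y - v) + F v - \<beta> * (r / 2) * V y v \<le> F y + (M + dual ?g)\<^sup>2 / (\<beta> * r)"
    by (simp add: algebra_simps)
  have "h v + ?g \<bullet> v + \<beta> * V x v + \<beta> * (r / 2) * V y v + \<beta> * (1 + r / 2) * V v u
       \<le> h u + ?g \<bullet> u + \<beta> * V x u + \<beta> * (r / 2) * V y u"
    using ps(2) by (simp add: r_def add.commute)
  hence "\<Phi> v - \<Phi> u \<le> ?e + \<beta> * (r / 2) * V y u - \<beta> * (1 + r / 2) * V v u"
    using * unfolding e \<Phi>_def by (simp add: inner_diff_right)
  hence "(r + 1) * (\<Phi> v - \<Phi> u) \<le> (r + 1) * (?e + \<beta> * (r / 2) * V y u - \<beta> * (1 + r / 2) * V v u)"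
    using r by (intro mult_left_mono) auto
  hence step: "(r + 1) * (\<Phi> v - \<Phi> u) + \<beta> / 2 * ((r + 1) * (r + 2)) * V v u \<le> (r + 1) * ?e + \<beta> / 2 * (r * (r + 1)) * V y u"
    by (simp add: field_simps)
  have avg: "r * (r + 3) / 2 * \<Phi> ((1 - \<theta>) *\<^sub>R w + \<theta> *\<^sub>R v) \<le> (r - 1) * (r + 2) / 2 * \<Phi> w + (r + 1) * \<Phi> v"
  proof -
    have th: "0 \<le> \<theta>" "\<theta> \<le> 1" using step_\<theta>_range[of "Suc t"] by (auto simp: \<theta>_def)
    have conv: "\<Phi> ((1 - \<theta>) *\<^sub>R w + \<theta> *\<^sub>R v) \<le> (1 - \<theta>) * \<Phi> w + \<theta> * \<Phi> v"
    proof -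
      define m where "m = (1 - \<theta>) *\<^sub>R w + \<theta> *\<^sub>R v"
      have lin: "c \<bullet> (m - d) = (1 - \<theta>) * (c \<bullet> (w - d)) + \<theta> * (c \<bullet> (v - d))" for c d
        by (simp add: m_def inner_diff_right inner_add_right algebra_simps)
      have "F m \<le> (1 - \<theta>) * F w + \<theta> * F v"
        unfolding m_def using th yw v F by (intro convex_onD) auto
      moreover have "\<nu> m \<le> (1 - \<theta>) * \<nu> w + \<theta> * \<nu> v - 1 / 2 * (1 - \<theta>) * \<theta> * (nrm (w - v))\<^sup>2"
        unfolding m_def using strong_\<nu> th yw v unfolding strongly_convex_on_def by auto
      moreover have "0 \<le> 1 / 2 * (1 - \<theta>) * \<theta> * (nrm (w - v))\<^sup>2" using th by simp
      ultimately have Fm: "F m \<le> (1 - \<theta>) * F w + \<theta> * F v" and \<nu>m: "\<nu> m \<le> (1 - \<theta>) * \<nu> w + \<theta> * \<nu> v"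
        by linarith+
      have "V x m \<le> (1 - \<theta>) * V x w + \<theta> * V x v"
        using \<nu>m unfolding bregman_def lin by (simp add: algebra_simps)
      hence "\<beta> * V x m \<le> \<beta> * ((1 - \<theta>) * V x w + \<theta> * V x v)" using \<beta> by (intro mult_left_mono) auto
      moreover have "h m = (1 - \<theta>) * h w + \<theta> * h v"
        unfolding h lin by (simp add: algebra_simps)
      ultimately show ?thesis unfolding m_def[symmetric] \<Phi>_def using Fm by (simp add: algebra_simps)
    qed
    have distr: "c * ((1 - \<theta>) * a + \<theta> * d) = (c - c * \<theta>) * a + (c * \<theta>) * d" for a c d :: real
      by (simp add: algebra_simps)
    \<comment> \<open>\<open>\<theta>\<close> is the weight \<open>r + 1\<close> of the new point
      divided by the total weight \<open>r * (r + 3) / 2\<close>.\<close>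
    have t1: "r * (r + 3) / 2 * \<theta> = r + 1" proof -
      have "\<theta> = 2 * (r + 1) / (r * (r + 3))" by (simp add: \<theta>_def r_def add_ac)
      thus ?thesis using r by simp
    qed
    have "r * (r + 3) / 2 * \<Phi> ((1 - \<theta>) *\<^sub>R w + \<theta> *\<^sub>R v) \<le> r * (r + 3) / 2 * ((1 - \<theta>) * \<Phi> w + \<theta> * \<Phi> v)"
      using r by (intro mult_left_mono conv) auto
    also have "\<dots> = (r * (r + 3) / 2 - r * (r + 3) / 2 * \<theta>) * \<Phi> w + (r * (r + 3) / 2 * \<theta>) * \<Phi> v"
      by (rule distr)
    also have "\<dots> = (r - 1) * (r + 2) / 2 * \<Phi> w + (r + 1) * \<Phi> v"
      unfolding t1 by (simp add: field_simps)
    finally show ?thesis .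
  qed
  have IH: "(r - 1) * (r + 2) / 2 * (\<Phi> w - \<Phi> u) + \<beta> / 2 * (r * (r + 1)) * V y u
      \<le> \<beta> * V x u + (\<Sum>s<t. (real s + 2) * err G h x u s)"
    using Suc unfolding y_def[symmetric] w_def[symmetric] \<Phi>_def r_def by (simp add: add.commute)
  have "r * (r + 3) / 2 * \<Phi> u = (r - 1) * (r + 2) / 2 * \<Phi> u + (r + 1) * \<Phi> u" by (simp add: field_simps)
  hence "r * (r + 3) / 2 * (\<Phi> ((1 - \<theta>) *\<^sub>R w + \<theta> *\<^sub>R v) - \<Phi> u) + \<beta> / 2 * ((r + 1) * (r + 2)) * V v u
     \<le> \<beta> * V x u + ((\<Sum>s<t. (real s + 2) * err G h x u s) + (r + 1) * ?e)"
    using IH step avg unfolding right_diff_distrib[of _ "\<Phi> _" "\<Phi> _"] by linarith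
  moreover have "(\<Sum>s<Suc t. (real s + 2) * err G h x u s) = (\<Sum>s<t. (real s + 2) * err G h x u s) + (r + 1) * ?e"
    by (simp add: r_def add.commute)
  moreover have "real (Suc t) = r" by (simp add: r_def)
  ultimately show ?case unfolding PS fst_conv snd_conv \<Phi>_def by presburger
qed

end

section \<open>The outer scheme\<close>

locale sliding_setup = mirror_setup +
  fixes g :: "'a \<Rightarrow> real" and g' :: "'a \<Rightarrow> 'a" and L :: real and T :: "nat \<Rightarrow> nat" and x0 :: 'a
  assumes L_pos: "L > 0" and convex_g: "convex_on X g" and smooth_g: "smooth_on nrm dual L X g g'"
    and x0: "x0 \<in> X" and T_ge_1: "1 \<le> T k" and T_mono: "T k \<le> T (Suc k)"
begin

abbreviation "step_\<beta> \<equiv> \<lambda>k::nat. 2 * L / real k"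
abbreviation "step_\<gamma> \<equiv> \<lambda>k::nat. 2 / (real k + 1)"

definition "outer G k = sliding X V g g' step_p step_\<theta> step_\<beta> step_\<gamma> T G x0 k"

definition "und G k = (1 - step_\<gamma> (Suc k)) *\<^sub>R snd (outer G k) + step_\<gamma> (Suc k) *\<^sub>R fst (outer G k)"

definition "model G k y = g (und G k) + g' (und G k) \<bullet> (y - und G k)"

definition "inner_state G k t =
  prox_sliding X V step_p step_\<theta> (G (Suc k)) (model G k) (fst (outer G k)) (step_\<beta> (Suc k)) t"

lemma outer_0 [simp]: "outer G 0 = (x0, x0)"
  by (simp add: outer_def)

lemma outer_Suc:
  "outer G (Suc k) = (fst (inner_state G k (T (Suc k))),
     (1 - step_\<gamma> (Suc k)) *\<^sub>R snd (outer G k) + step_\<gamma> (Suc k) *\<^sub>R snd (inner_state G k (T (Suc k))))"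
  unfolding inner_state_def model_def[abs_def] und_def
  by (simp add: outer_def Let_def split_beta)

lemma step_\<gamma>_range: "0 \<le> step_\<gamma> (Suc k)" "step_\<gamma> (Suc k) \<le> 1"
  by (auto simp: field_simps)

lemma outer_in: "fst (outer G k) \<in> X" "snd (outer G k) \<in> X"
  and und_in: "und G k \<in> X"
  and inner_state_in: "fst (inner_state G k t) \<in> X" "snd (inner_state G k t) \<in> X"
proof -
  have comb: "(1 - step_\<gamma> (Suc k)) *\<^sub>R a + step_\<gamma> (Suc k) *\<^sub>R b \<in> X" if "a \<in> X" "b \<in> X" for a b k
    using that step_\<gamma>_range[of k] by (intro convexD[OF convex_X]) auto
  have inn: "fst (inner_state G k t) \<in> X \<and> snd (inner_state G k t) \<in> X" if "fst (outer G k) \<in> X" for k t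
    unfolding inner_state_def by (rule prox_sliding_in[OF _ that step_\<theta>_range]) (rule model_def)
  have out: "fst (outer G k) \<in> X \<and> snd (outer G k) \<in> X" for k
  proof (induction k)
    case (Suc k)
    thus ?case using inn[of k "T (Suc k)"] comb by (simp only: outer_Suc fst_conv snd_conv)
  next
    case 0
    show ?case using x0 by simp
  qed
  show "fst (outer G k) \<in> X" "snd (outer G k) \<in> X" "und G k \<in> X"
     "fst (inner_state G k t) \<in> X" "snd (inner_state G k t) \<in> X"
    using out inn comb unfolding und_def by blast+
qed

definition "step_err F M u G k t =
   G (Suc k) t (fst (inner_state G k t)) \<bullet> (u - fst (inner_state G k t)) + F (fst (inner_state G k t)) - F u
     + (M + dual (G (Suc k) t (fst (inner_state G k t))))\<^sup>2 / (step_\<beta> (Suc k) * (real t + 1))"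

text \<open>The total weight of the inner steps: the sum of \<open>t + 2\<close> over
  \<open>t < T k\<close>.\<close>

definition "tri k = real (T k) * (real (T k) + 3) / 2"

lemma tri_ge_2: "2 \<le> tri k"
proof -
  have "1 * 4 \<le> real (T k) * (real (T k) + 3)" using T_ge_1[of k] by (intro mult_mono) auto
  thus ?thesis by (simp add: tri_def)
qed

lemma tri_mono: "tri k \<le> tri (Suc k)"
  using T_mono[of k] unfolding tri_def by (intro divide_right_mono mult_mono) auto

text \<open>Outer iteration \<open>K\<close> adds \<open>K\<close> to the total weight
  \<open>K * (K + 1) / 2\<close>, which is why \<open>\<gamma>\<close> is their quotient. As
  \<open>K\<close> times \<open>\<beta>\<close> is the constant \<open>2 * L\<close>, the
  divergences telescope up to the factor \<open>1 + 1 / tri k\<close>, a trace of the initial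
  divergence of the inner procedure. Initially there is no such factor, and \<open>3 * L\<close>
  bounds the first one because \<open>tri\<close> is at least 2.\<close>

lemma sliding_invariant:
  assumes u: "u \<in> X" and F: "convex_on X F"
    and FM: "\<And>v w. v \<in> X \<Longrightarrow> w \<in> X \<Longrightarrow> F v - F w \<le> M * nrm (v - w)"
  shows "real k * (real k + 1) / 2 * (F (snd (outer G k)) + g (snd (outer G k)) - (F u + g u))
      + (if k = 0 then 3 * L else 2 * L * (1 + 1 / tri k)) * V (fst (outer G k)) u
    \<le> 3 * L * V x0 u + (\<Sum>j<k. (real j + 1) / tri (Suc j) * (\<Sum>t<T (Suc j). (real t + 2) * step_err F M u G j t))"
proof (induction k)
  case 0
  show ?case by simp
next
  case (Suc k)
  define K where "K = real k + 1"
  have K: "K > 0" by (simp add: K_def)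
  define x where "x = fst (outer G k)"
  define xa where "xa = snd (outer G k)"
  define xt where "xt = snd (inner_state G k (T (Suc k)))"
  define x' where "x' = fst (outer G (Suc k))"
  define xa' where "xa' = snd (outer G (Suc k))"
  define \<gamma> where "\<gamma> = step_\<gamma> (Suc k)"
  have \<gamma>: "0 \<le> \<gamma>" "\<gamma> \<le> 1" using step_\<gamma>_range[of k] by (auto simp: \<gamma>_def)
  have mem: "x \<in> X" "xa \<in> X" "xt \<in> X" "x' \<in> X" "xa' \<in> X" "und G k \<in> X"
    using outer_in inner_state_in und_in by (auto simp: x_def xa_def xt_def x'_def xa'_def)
  have x'eq: "x' = fst (inner_state G k (T (Suc k)))" and xa'eq: "xa' = (1 - \<gamma>) *\<^sub>R xa + \<gamma> *\<^sub>R xt"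
    by (simp_all add: x'_def xa'_def outer_Suc xa_def xt_def \<gamma>_def)
  define S where "S = tri (Suc k)"
  have S: "S \<ge> 2" using tri_ge_2 by (simp add: S_def)
  define h where "h = model G k"
  define b where "b = step_\<beta> (Suc k)"
  have b: "b > 0" "K * b = 2 * L" using L_pos by (auto simp: b_def K_def field_simps)
  define R where "R = (\<Sum>t<T (Suc k). (real t + 2) * step_err F M u G k t)"
  define W where "W = (if k = 0 then 3 * L else 2 * L * (1 + 1 / tri k))"
  \<comment> \<open>At the last inner step the coefficient \<open>(T + 1) * (T + 2) / 2\<close> of
    the divergence is \<open>S + 1\<close>, one more than the total weight.\<close>
  have inner: "S * ((h xt + F xt + b * V x xt) - (h u + F u + b * V x u)) + b * (S + 1) * V x' u \<le> b * V x u + R"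
  proof -
    have "b * (S + 1) = b / 2 * ((real (T (Suc k)) + 1) * (real (T (Suc k)) + 2))"
      by (simp add: S_def tri_def field_simps)
    thus ?thesis
      using prox_sliding_invariant[of h "g (und G k)" "g' (und G k)" "und G k" x u b F M "T (Suc k)" "G (Suc k)"]
        mem u b F FM
      unfolding R_def step_err_def S_def tri_def inner_state_def[symmetric] x'eq xt_def h_def b_def x_def
      by (simp add: model_def)
  qed
  have "h xt + F xt + b * V x xt - (h u + F u) + b * (1 + 1 / S) * V x' u \<le> b * (1 + 1 / S) * V x u + R / S"
  proof -
    have "(S * ((h xt + F xt + b * V x xt) - (h u + F u + b * V x u)) + b * (S + 1) * V x' u) / S \<le> (b * V x u + R) / S"
      using S by (intro divide_right_mono inner) auto
    thus ?thesis using S by (simp add: field_simps)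
  qed
  hence "K * (h xt + F xt + b * V x xt - (h u + F u) + b * (1 + 1 / S) * V x' u) \<le> K * (b * (1 + 1 / S) * V x u + R / S)"
    using K by (intro mult_left_mono) auto
  hence 1: "K * (h xt + F xt + b * V x xt - (h u + F u)) + (K * b) * ((1 + 1 / S) * V x' u) \<le> (K * b) * ((1 + 1 / S) * V x u) + K / S * R"
    by (simp add: algebra_simps)
  have hle: "h y \<le> g y" if "y \<in> X" for y
    using convex_on_gradient_ineq[of g g' X "und G k" y] smooth_g convex_g mem that
    by (simp add: h_def model_def smooth_on_def)
  have 2: "K * (K + 1) / 2 * (F xa' + g xa') \<le> K * (K - 1) / 2 * (F xa + g xa) + K * (h xt + F xt + b * V x xt)"
  proof -
    have distr: "c * ((1 - \<gamma>) * a + \<gamma> * d + L * \<gamma>\<^sup>2 * e) = c * (1 - \<gamma>) * a + c * \<gamma> * d + c * \<gamma> * \<gamma> * (L * e)" for a c d e :: real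
      by (simp add: algebra_simps power2_eq_square)
    have dd: "xa' - und G k = \<gamma> *\<^sub>R (xt - x)"
      unfolding xa'eq und_def \<gamma>_def[symmetric] xa_def[symmetric] x_def[symmetric] by (simp add: algebra_simps)
    have hx: "h xa' = (1 - \<gamma>) * h xa + \<gamma> * h xt"
      unfolding h_def model_def xa'eq by (simp add: inner_diff_right inner_add_right algebra_simps)
    have "g xa' \<le> h xa' + L / 2 * (nrm (xa' - und G k))\<^sup>2"
      unfolding h_def model_def
      by (rule smooth_on_descent[OF smooth_g convex_X mem(6,5) holder nrm_scale nrm_nonneg])
    also have "(nrm (xa' - und G k))\<^sup>2 = \<gamma>\<^sup>2 * (nrm (xt - x))\<^sup>2"
      unfolding dd nrm_scale by (simp add: power_mult_distrib)
    also have "L / 2 * (\<gamma>\<^sup>2 * (nrm (xt - x))\<^sup>2) \<le> L / 2 * (\<gamma>\<^sup>2 * (2 * V x xt))"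
      using L_pos V_lower[OF mem(1,3)] by (intro mult_left_mono) auto
    finally have ga: "g xa' \<le> (1 - \<gamma>) * h xa + \<gamma> * h xt + L * \<gamma>\<^sup>2 * V x xt" unfolding hx by simp
    have "(1 - \<gamma>) * h xa \<le> (1 - \<gamma>) * g xa" using \<gamma> hle mem by (intro mult_left_mono) auto
    moreover have "F xa' \<le> (1 - \<gamma>) * F xa + \<gamma> * F xt"
      unfolding xa'eq using \<gamma> mem F by (intro convex_onD) auto
    ultimately have "F xa' + g xa' \<le> (1 - \<gamma>) * (F xa + g xa) + \<gamma> * (h xt + F xt) + L * \<gamma>\<^sup>2 * V x xt"
      using ga by (simp add: algebra_simps)
    hence "K * (K + 1) / 2 * (F xa' + g xa') \<le> K * (K + 1) / 2 * ((1 - \<gamma>) * (F xa + g xa) + \<gamma> * (h xt + F xt) + L * \<gamma>\<^sup>2 * V x xt)"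
      using K by (intro mult_left_mono) auto
    also have "\<dots> = K * (K + 1) / 2 * (1 - \<gamma>) * (F xa + g xa) + K * (K + 1) / 2 * \<gamma> * (h xt + F xt) + (K * (K + 1) / 2 * \<gamma> * \<gamma>) * (L * V x xt)"
      by (rule distr)
    also have g1: "K * (K + 1) / 2 * \<gamma> = K" using K by (simp add: \<gamma>_def K_def field_simps)
    also have "K * (K + 1) / 2 * (1 - \<gamma>) = K * (K - 1) / 2" proof -
      have "K * (K + 1) / 2 * (1 - \<gamma>) = K * (K + 1) / 2 - K" using g1 by (simp add: right_diff_distrib)
      thus ?thesis by (simp add: field_simps)
    qed
    \<comment> \<open>The smoothness error is paid by the term \<open>b * V x xt\<close>, which the
      inner procedure keeps in its objective. The match needs \<open>K * \<gamma> \<le> 2\<close>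
      and \<open>K * b = 2 * L\<close>.\<close>
    also have "K * \<gamma> * (L * V x xt) \<le> 2 * (L * V x xt)"
      using L_pos V_nonneg[OF mem(1,3)] K by (intro mult_right_mono) (auto simp: \<gamma>_def K_def field_simps)
    also have "2 * (L * V x xt) = K * (b * V x xt)" using b(2) by (metis mult.assoc)
    finally show ?thesis by (simp add: algebra_simps)
  qed
  \<comment> \<open>The coefficient of the divergence must not grow from one iteration to the next.
    This is where the monotonicity of \<open>T\<close> enters, by way of \<open>tri\<close>.\<close>
  have Wk: "2 * L * (1 + 1 / S) \<le> W"
  proof (cases "k = 0")
    case True
    have "1 / S \<le> 1 / 2" using S by (intro divide_left_mono) auto
    hence "2 * L * (1 + 1 / S) \<le> 2 * L * (1 + 1 / 2)" using L_pos by (intro mult_left_mono) auto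
    thus ?thesis using True by (simp add: W_def)
  next
    case False
    have "1 / S \<le> 1 / tri k" using S tri_ge_2[of k] tri_mono[of k] by (intro divide_left_mono) (auto simp: S_def)
    thus ?thesis using False L_pos by (simp add: W_def)
  qed
  have 3: "2 * L * (1 + 1 / S) * V x u \<le> W * V x u"
    using V_nonneg[OF mem(1) u] Wk by (intro mult_right_mono)
  have IH: "(K - 1) * K / 2 * (F xa + g xa - (F u + g u)) + W * V x u
    \<le> 3 * L * V x0 u + (\<Sum>j<k. (real j + 1) / tri (Suc j) * (\<Sum>t<T (Suc j). (real t + 2) * step_err F M u G j t))"
    using Suc unfolding x_def xa_def K_def W_def by simp
  have 4: "K * h u \<le> K * g u" using hle[OF u] K by (intro mult_left_mono) auto
  have "K * (K + 1) / 2 * (F xa' + g xa' - (F u + g u)) + 2 * L * (1 + 1 / S) * V x' u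
    \<le> 3 * L * V x0 u + ((\<Sum>j<k. (real j + 1) / tri (Suc j) * (\<Sum>t<T (Suc j). (real t + 2) * step_err F M u G j t)) + K / S * R)"
  proof -
    have s: "K * (K + 1) / 2 * (F xa' + g xa' - (F u + g u)) =
        K * (K + 1) / 2 * (F xa' + g xa') - (K - 1) * K / 2 * (F u + g u) - K * (F u + g u)"
      by (simp add: field_simps)
    have "K * (h xt + F xt + b * V x xt - (h u + F u)) = K * (h xt + F xt + b * V x xt) - K * h u - K * F u"
      by (simp add: algebra_simps)
    moreover have "(K - 1) * K / 2 * (F xa + g xa - (F u + g u)) = K * (K - 1) / 2 * (F xa + g xa) - (K - 1) * K / 2 * (F u + g u)"
      by (simp add: field_simps)
    moreover have "K * (F u + g u) = K * F u + K * g u" by (simp add: algebra_simps)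
    moreover have "(K * b) * ((1 + 1 / S) * V x' u) = 2 * L * (1 + 1 / S) * V x' u"
      "(K * b) * ((1 + 1 / S) * V x u) = 2 * L * (1 + 1 / S) * V x u" by (simp_all add: b(2))
    ultimately show ?thesis using s 1 2 3 4 IH by linarith
  qed
  thus ?case unfolding x'_def[symmetric] xa'_def[symmetric] K_def S_def R_def by (simp add: add.commute)
qed

end

section \<open>The random gradient estimates\<close>

lemma (in prob_space) indep_set_mono:
  "indep_set A B \<Longrightarrow> A' \<subseteq> A \<Longrightarrow> B' \<subseteq> B \<Longrightarrow> indep_set A' B'"
  unfolding indep_sets2_eq by blast

lemma (in prob_space) indep_set_commute: "indep_set A B \<Longrightarrow> indep_set B A"
  unfolding indep_sets2_eq by (metis Int_commute mult.commute)

text \<open>Composing the direction with a real function \<open>\<phi>\<close> gives it the type of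
  the noise, and the preimage families are stable under intersection, so their independence extends
  to the generated sigma-algebras.\<close>

lemma (in prob_space) indep_var_of_indep_set:
  fixes \<phi> :: "'b::topological_space \<Rightarrow> real"
  assumes [measurable]: "X \<in> borel_measurable M" "\<xi> \<in> borel_measurable M" "\<phi> \<in> borel_measurable borel"
    and ind: "indep_set {X -` A \<inter> space M | A. A \<in> sets borel} {\<xi> -` B \<inter> space M | B. B \<in> sets borel}"
  shows "indep_var borel (\<xi> :: 'a \<Rightarrow> real) borel (\<lambda>\<omega>. \<phi> (X \<omega>))"
proof -
  have st: "Int_stable {Y -` A \<inter> space M | A. A \<in> sets borel}" for Y :: "'a \<Rightarrow> 'c::topological_space"
    unfolding Int_stable_def
  proof (intro ballI)
    fix a b assume "a \<in> {Y -` A \<inter> space M | A. A \<in> sets borel}" "b \<in> {Y -` A \<inter> space M | A. A \<in> sets borel}"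
    then obtain A B where "a = Y -` A \<inter> space M" "b = Y -` B \<inter> space M" "A \<in> sets borel" "B \<in> sets borel" by blast
    hence "a \<inter> b = Y -` (A \<inter> B) \<inter> space M" "A \<inter> B \<in> sets borel" by auto
    thus "a \<inter> b \<in> {Y -` A \<inter> space M | A. A \<in> sets borel}" by blast
  qed
  have sub: "{(\<lambda>\<omega>. \<phi> (X \<omega>)) -` A \<inter> space M | A. A \<in> sets borel} \<subseteq> {X -` A \<inter> space M | A. A \<in> sets borel}"
  proof safe
    fix A :: "real set" assume A: "A \<in> sets borel"
    have "\<phi> -` A \<in> sets borel" using measurable_sets[OF assms(3) A] by simp
    thus "\<exists>B. (\<lambda>\<omega>. \<phi> (X \<omega>)) -` A \<inter> space M = X -` B \<inter> space M \<and> B \<in> sets borel"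
      by (intro exI[of _ "\<phi> -` A"]) auto
  qed
  have "indep_set {\<xi> -` B \<inter> space M | B. B \<in> sets borel} {(\<lambda>\<omega>. \<phi> (X \<omega>)) -` A \<inter> space M | A. A \<in> sets borel}"
    by (rule indep_set_mono[OF indep_set_commute[OF ind] order.refl sub])
  from indep_set_sigma_sets[OF this st st] show ?thesis
    unfolding indep_var_eq by simp
qed

lemma (in prob_space) indep_var_nn_integral_prod:
  assumes ind: "indep_var S X T Y" and [measurable]: "Q \<in> borel_measurable (S \<Otimes>\<^sub>M T)"
  shows "(\<integral>\<^sup>+\<omega>. Q (X \<omega>, Y \<omega>) \<partial>M) = (\<integral>\<^sup>+x. (\<integral>\<^sup>+\<omega>. Q (x, Y \<omega>) \<partial>M) \<partial>distr M S X)"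
proof -
  have [measurable]: "random_variable S X" "random_variable T Y"
    using ind by (auto dest: indep_var_rv1 indep_var_rv2)
  interpret Y: prob_space "distr M T Y" by (rule prob_space_distr) measurable
  have "(\<integral>\<^sup>+\<omega>. Q (X \<omega>, Y \<omega>) \<partial>M) = (\<integral>\<^sup>+p. Q p \<partial>distr M (S \<Otimes>\<^sub>M T) (\<lambda>\<omega>. (X \<omega>, Y \<omega>)))"
    by (subst nn_integral_distr) auto
  also have "distr M (S \<Otimes>\<^sub>M T) (\<lambda>\<omega>. (X \<omega>, Y \<omega>)) = distr M S X \<Otimes>\<^sub>M distr M T Y"
    using ind by (simp add: indep_var_distribution_eq)
  also have "(\<integral>\<^sup>+p. Q p \<partial>(distr M S X \<Otimes>\<^sub>M distr M T Y)) = (\<integral>\<^sup>+x. \<integral>\<^sup>+y. Q (x, y) \<partial>distr M T Y \<partial>distr M S X)"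
    by (rule Y.nn_integral_fst[symmetric]) simp
  also have "\<dots> = (\<integral>\<^sup>+x. (\<integral>\<^sup>+\<omega>. Q (x, Y \<omega>) \<partial>M) \<partial>distr M S X)"
    by (intro nn_integral_cong nn_integral_distr) auto
  finally show ?thesis .
qed

text \<open>The first variable is frozen: by Fubini for the product law, a bound valid for each
  fixed value carries over to the random one. This takes the place of conditioning on the
  past.\<close>

lemma (in prob_space) indep_var_nn_integral_le:
  assumes ind: "indep_var S X T Y" and Q: "Q \<in> borel_measurable (S \<Otimes>\<^sub>M T)"
    and A: "\<And>\<omega>. \<omega> \<in> space M \<Longrightarrow> X \<omega> \<in> A" and le: "\<And>x. x \<in> A \<Longrightarrow> x \<in> space S \<Longrightarrow> (\<integral>\<^sup>+\<omega>. Q (x, Y \<omega>) \<partial>M) \<le> C"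
  shows "(\<integral>\<^sup>+\<omega>. Q (X \<omega>, Y \<omega>) \<partial>M) \<le> C"
proof -
  note [measurable] = Q
  have [measurable]: "random_variable S X" "random_variable T Y"
    using ind by (auto dest: indep_var_rv1 indep_var_rv2)
  have "(\<integral>\<^sup>+\<omega>. Q (X \<omega>, Y \<omega>) \<partial>M) = (\<integral>\<^sup>+\<omega>'. (\<integral>\<^sup>+\<omega>. Q (X \<omega>', Y \<omega>) \<partial>M) \<partial>M)"
    unfolding indep_var_nn_integral_prod[OF ind Q] by (subst nn_integral_distr) auto
  also have "\<dots> \<le> (\<integral>\<^sup>+\<omega>'. C \<partial>M)"
    by (intro nn_integral_mono le A) (auto intro: measurable_space)
  also have "\<dots> = C" using emeasure_space_1 by simp
  finally show ?thesis .
qed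

lemma (in prob_space) indep_var_integral_le:
  fixes Q :: "'b \<times> 'b \<Rightarrow> real"
  assumes ind: "indep_var S X T Y" and Q [measurable]: "Q \<in> borel_measurable (S \<Otimes>\<^sub>M T)"
    and int: "integrable M (\<lambda>\<omega>. Q (X \<omega>, Y \<omega>))"
    and A: "\<And>\<omega>. \<omega> \<in> space M \<Longrightarrow> X \<omega> \<in> A" and le: "\<And>x. x \<in> A \<Longrightarrow> x \<in> space S \<Longrightarrow> (\<integral>\<omega>. Q (x, Y \<omega>) \<partial>M) \<le> C"
  shows "(\<integral>\<omega>. Q (X \<omega>, Y \<omega>) \<partial>M) \<le> C"
proof -
  have [measurable]: "random_variable S X" "random_variable T Y"
    using ind by (auto dest: indep_var_rv1 indep_var_rv2)
  interpret X: prob_space "distr M S X" by (rule prob_space_distr) measurable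
  interpret Y: prob_space "distr M T Y" by (rule prob_space_distr) measurable
  interpret P: pair_prob_space "distr M S X" "distr M T Y" ..
  have D: "distr M (S \<Otimes>\<^sub>M T) (\<lambda>\<omega>. (X \<omega>, Y \<omega>)) = distr M S X \<Otimes>\<^sub>M distr M T Y"
    using ind by (simp add: indep_var_distribution_eq)
  have intp: "integrable (distr M S X \<Otimes>\<^sub>M distr M T Y) Q"
    unfolding D[symmetric] using int by (subst integrable_distr_eq) auto
  have "(\<integral>\<omega>. Q (X \<omega>, Y \<omega>) \<partial>M) = (\<integral>p. Q p \<partial>(distr M S X \<Otimes>\<^sub>M distr M T Y))"
    unfolding D[symmetric] by (subst integral_distr) auto
  also have "\<dots> = (\<integral>x. (\<integral>y. Q (x, y) \<partial>distr M T Y) \<partial>distr M S X)"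
    by (rule P.integral_fst'[symmetric]) (rule intp)
  also have "\<dots> \<le> (\<integral>x. C \<partial>distr M S X)"
  proof (rule integral_mono_AE)
    show "integrable (distr M S X) (\<lambda>x. \<integral>y. Q (x, y) \<partial>distr M T Y)"
      by (rule P.integrable_fst') (rule intp)
    have [measurable]: "(\<lambda>x. \<integral>y. Q (x, y) \<partial>distr M T Y) \<in> borel_measurable S"
      by (intro Y.borel_measurable_lebesgue_integral) (simp add: case_prod_beta')
    show "AE x in distr M S X. (\<integral>y. Q (x, y) \<partial>distr M T Y) \<le> C"
    proof (subst AE_distr_iff)
      show "AE \<omega> in M. (\<integral>y. Q (X \<omega>, y) \<partial>distr M T Y) \<le> C"
      proof (rule AE_I2)
        fix \<omega> assume \<omega>: "\<omega> \<in> space M"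
        have [simp]: "X \<omega> \<in> space S" using \<omega> by (rule measurable_space[rotated]) measurable
        have "(\<integral>y. Q (X \<omega>, y) \<partial>distr M T Y) = (\<integral>\<omega>'. Q (X \<omega>, Y \<omega>') \<partial>M)"
          by (subst integral_distr) auto
        thus "(\<integral>y. Q (X \<omega>, y) \<partial>distr M T Y) \<le> C" using le[of "X \<omega>"] A[OF \<omega>] by simp
      qed
    qed measurable
  qed simp
  also have "\<dots> = C" using X.prob_space by simp
  finally show ?thesis .
qed

text \<open>The sigma-algebra generated by the samples with index in \<open>A\<close>. The pullback
  from a product space is the form in which independence of disjoint groups of variables is
  expressed.\<close>

definition past_alg :: "'w set \<Rightarrow> ('i \<Rightarrow> 'w \<Rightarrow> 'b::topological_space) \<Rightarrow> 'i set \<Rightarrow> 'w measure" where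
  "past_alg \<Omega> S A = vimage_algebra \<Omega> (\<lambda>\<omega>. restrict (\<lambda>i. S i \<omega>) A) (PiM A (\<lambda>_. borel))"

lemma space_past_alg [simp]: "space (past_alg \<Omega> S A) = \<Omega>"
  by (simp add: past_alg_def)

lemma measurable_past_alg:
  assumes "i \<in> A"
  shows "S i \<in> borel_measurable (past_alg \<Omega> S A)"
proof -
  have "(\<lambda>\<omega>. restrict (\<lambda>i. S i \<omega>) A) \<in> measurable (past_alg \<Omega> S A) (PiM A (\<lambda>_. borel))"
    unfolding past_alg_def by (rule measurable_vimage_algebra1) (auto simp: space_PiM)
  from measurable_compose[OF this measurable_component_singleton[OF assms]]
  show ?thesis using assms by simp
qed

text \<open>Disjoint groups of an independent family are independent, and a variable measurable with
  respect to one group inherits this.\<close>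

lemma (in prob_space) indep_var_past:
  fixes S :: "'i \<Rightarrow> 'a \<Rightarrow> 'b::topological_space" and Z :: "'a \<Rightarrow> 'b"
  assumes ind: "indep_vars (\<lambda>_. borel) S I" and A: "A \<subseteq> I" and j: "j \<in> I" "j \<notin> A"
    and Z: "Z \<in> borel_measurable (past_alg (space M) S A)" and ZM: "Z \<in> borel_measurable M"
  shows "indep_var borel Z borel (S j)"
proof -
  let ?RA = "\<lambda>\<omega>. restrict (\<lambda>i. S i \<omega>) A" and ?RJ = "\<lambda>\<omega>. restrict (\<lambda>i. S i \<omega>) {j}"
  have Sj: "S j \<in> borel_measurable M" using ind j by (auto simp: indep_vars_def)
  have "indep_var (PiM A (\<lambda>_. borel)) ?RA (PiM {j} (\<lambda>_. borel)) ?RJ"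
    by (rule indep_var_restrict[OF ind]) (use A j in auto)
  hence "indep_set (sigma_sets (space M) {?RA -` B \<inter> space M | B. B \<in> sets (PiM A (\<lambda>_. borel))})
      (sigma_sets (space M) {?RJ -` B \<inter> space M | B. B \<in> sets (PiM {j} (\<lambda>_. borel))})"
    unfolding indep_var_eq by blast
  hence "indep_set (sigma_sets (space M) {Z -` B \<inter> space M | B. B \<in> sets borel})
      (sigma_sets (space M) {S j -` B \<inter> space M | B. B \<in> sets borel})"
  proof (rule indep_set_mono)
    show "sigma_sets (space M) {Z -` B \<inter> space M | B. B \<in> sets borel} \<subseteq>
      sigma_sets (space M) {?RA -` B \<inter> space M | B. B \<in> sets (PiM A (\<lambda>_. borel))}"
    proof (rule sigma_sets_mono, safe)
      fix B :: "'b set" assume "B \<in> sets borel"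
      from measurable_sets[OF Z this]
      show "Z -` B \<inter> space M \<in> sigma_sets (space M) {?RA -` B \<inter> space M | B. B \<in> sets (PiM A (\<lambda>_. borel))}"
        by (simp add: past_alg_def sets_vimage_algebra)
    qed
    show "sigma_sets (space M) {S j -` B \<inter> space M | B. B \<in> sets borel} \<subseteq>
      sigma_sets (space M) {?RJ -` B \<inter> space M | B. B \<in> sets (PiM {j} (\<lambda>_. borel))}"
    proof (rule sigma_sets_mono, safe)
      fix B :: "'b set" assume "B \<in> sets borel"
      from measurable_sets[OF measurable_past_alg[of j "{j}" S "space M"] this]
      show "S j -` B \<inter> space M \<in> sigma_sets (space M) {?RJ -` B \<inter> space M | B. B \<in> sets (PiM {j} (\<lambda>_. borel))}"
        by (simp add: past_alg_def sets_vimage_algebra)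
    qed
  qed
  thus ?thesis unfolding indep_var_eq using ZM Sj by simp
qed

section \<open>Moments of a single oracle call\<close>

locale gradient_sample = prob_space M for M :: "'w measure" +
  fixes e :: "'w \<Rightarrow> real^'n" and \<xi>p \<xi>m :: "'w \<Rightarrow> real" and \<sigma> :: real
  assumes e [measurable]: "e \<in> borel_measurable M" and e_law: "distr M borel e = uniform_sphere"
    and \<xi> [measurable]: "\<xi>p \<in> borel_measurable M" "\<xi>m \<in> borel_measurable M"
    and ind: "\<xi> \<in> {\<xi>p, \<xi>m} \<Longrightarrow> indep_set {e -` A \<inter> space M | A. A \<in> sets borel} {\<xi> -` B \<inter> space M | B. B \<in> sets borel}"
    and \<xi>_int: "\<xi> \<in> {\<xi>p, \<xi>m} \<Longrightarrow> integrable M (\<lambda>\<omega>. (\<xi> \<omega>)\<^sup>2)"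
    and \<xi>_mean: "\<xi> \<in> {\<xi>p, \<xi>m} \<Longrightarrow> expectation \<xi> = 0"
    and \<xi>_var: "\<xi> \<in> {\<xi>p, \<xi>m} \<Longrightarrow> expectation (\<lambda>\<omega>. (\<xi> \<omega>)\<^sup>2) \<le> \<sigma>\<^sup>2"
begin

lemma AE_e: "AE \<omega> in M. norm (e \<omega>) = 1"
proof -
  have "AE x in distr M borel e. norm x = 1" unfolding e_law by (rule AE_uniform_sphere_norm)
  thus ?thesis by (subst (asm) AE_distr_iff) auto
qed

text \<open>Each noise is centred and independent of the direction, so the mean of the product
  factors. Each noise is treated alone, hence dependence between the two does no harm.\<close>

lemma noise_orthogonal:
  assumes x: "\<xi> \<in> {\<xi>p, \<xi>m}"
  shows "integrable M (\<lambda>\<omega>. \<xi> \<omega> * (e \<omega> \<bullet> v))" "expectation (\<lambda>\<omega>. \<xi> \<omega> * (e \<omega> \<bullet> v)) = 0"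
proof -
  have [measurable]: "\<xi> \<in> borel_measurable M" using x \<xi> by auto
  have i: "indep_var borel \<xi> borel (\<lambda>\<omega>. e \<omega> \<bullet> v)"
    by (rule indep_var_of_indep_set[OF e _ _ ind[OF x]]) measurable
  have "integrable M (\<lambda>\<omega>. (\<xi> \<omega>)\<^sup>2 + 1)" using \<xi>_int[OF x] by simp
  hence i1: "integrable M \<xi>"
  proof (rule Bochner_Integration.integrable_bound)
    have "\<bar>t\<bar> \<le> t\<^sup>2 + 1" for t :: real
    proof -
      have "0 \<le> (\<bar>t\<bar> - 1 / 2)\<^sup>2" by simp
      thus ?thesis by (simp add: power2_diff power_divide)
    qed
    thus "AE \<omega> in M. norm (\<xi> \<omega>) \<le> norm ((\<xi> \<omega>)\<^sup>2 + 1)" by simp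
  qed simp
  have i2: "integrable M (\<lambda>\<omega>. e \<omega> \<bullet> v)"
  proof (rule integrable_const_bound[where B="norm v"])
    show "AE \<omega> in M. norm (e \<omega> \<bullet> v) \<le> norm v"
      using AE_e by eventually_elim (metis Cauchy_Schwarz_ineq2 mult_1 real_norm_def)
  qed measurable
  show "integrable M (\<lambda>\<omega>. \<xi> \<omega> * (e \<omega> \<bullet> v))" by (rule indep_var_integrable[OF i i1 i2])
  show "expectation (\<lambda>\<omega>. \<xi> \<omega> * (e \<omega> \<bullet> v)) = 0"
    using indep_var_lebesgue_integral[OF i i1 i2] \<xi>_mean[OF x] by simp
qed

lemma one_point_grad_inner:
  "one_point_grad f r u a xp xm \<bullet> v = real CARD('n) / (2 * r) *
     (f (u + r *\<^sub>R a) * (a \<bullet> v) - f (u - r *\<^sub>R a) * (a \<bullet> v) + xp * (a \<bullet> v) - xm * (a \<bullet> v))"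
  for f :: "real^'n \<Rightarrow> real"
  unfolding one_point_grad_def noisy_value_def inner_scaleR_left mult.assoc
  by (intro arg_cong[where f="(*) (real CARD('n) / (2 * r))"]) (simp add: algebra_simps)

text \<open>By symmetry of the sphere the two evaluations of \<open>f\<close> contribute equally,
  which turns \<open>n / (2 * r)\<close> into the \<open>n / r\<close> of
  \<open>sphere_grad\<close>; the noise terms have mean 0.\<close>

lemma one_point_grad_mean:
  assumes f: "G-lipschitz_on UNIV f" and r: "0 < r"
  shows "integrable M (\<lambda>\<omega>. one_point_grad f r u (e \<omega>) (\<xi>p \<omega>) (\<xi>m \<omega>) \<bullet> v)"
    and "expectation (\<lambda>\<omega>. one_point_grad f r u (e \<omega>) (\<xi>p \<omega>) (\<xi>m \<omega>) \<bullet> v) = sphere_grad f r u \<bullet> v"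
proof -
  note [measurable] = lipschitz_UNIV_measurable[OF f]
  let ?\<phi> = "\<lambda>a. f (u + r *\<^sub>R a) * (a \<bullet> v)"
  let ?\<psi> = "\<lambda>a. f (u - r *\<^sub>R a) * (a \<bullet> v)"
  have ip: "integrable uniform_sphere ?\<phi>"
    using integrable_inner_left[OF integrable_sphere_grad[OF f r, of u], of v] by simp
  have neg: "?\<psi> a = - ?\<phi> (- a)" for a by simp
  have im: "integrable uniform_sphere ?\<psi>" "(\<integral>a. ?\<psi> a \<partial>uniform_sphere) = - (\<integral>a. ?\<phi> a \<partial>uniform_sphere)"
  proof -
    have "integrable (distr uniform_sphere borel uminus) ?\<phi>" unfolding uniform_sphere_uminus by (rule ip)
    hence "integrable uniform_sphere (\<lambda>a. ?\<phi> (- a))" by (subst (asm) integrable_distr_eq) auto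
    thus "integrable uniform_sphere ?\<psi>" unfolding neg by simp
    have "(\<integral>a. ?\<phi> a \<partial>uniform_sphere) = (\<integral>a. ?\<phi> (- a) \<partial>uniform_sphere)"
      by (subst uniform_sphere_uminus[symmetric], subst integral_distr) auto
    thus "(\<integral>a. ?\<psi> a \<partial>uniform_sphere) = - (\<integral>a. ?\<phi> a \<partial>uniform_sphere)" unfolding neg by simp
  qed
  have i1: "integrable M (\<lambda>\<omega>. ?\<phi> (e \<omega>))" "expectation (\<lambda>\<omega>. ?\<phi> (e \<omega>)) = (\<integral>a. ?\<phi> a \<partial>uniform_sphere)"
    using ip unfolding e_law[symmetric] by (auto simp: integrable_distr_eq integral_distr)
  have i2: "integrable M (\<lambda>\<omega>. ?\<psi> (e \<omega>))" "expectation (\<lambda>\<omega>. ?\<psi> (e \<omega>)) = - (\<integral>a. ?\<phi> a \<partial>uniform_sphere)"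
    using im unfolding e_law[symmetric] by (auto simp: integrable_distr_eq integral_distr)
  note n = noise_orthogonal[of \<xi>p v] noise_orthogonal[of \<xi>m v]
  show "integrable M (\<lambda>\<omega>. one_point_grad f r u (e \<omega>) (\<xi>p \<omega>) (\<xi>m \<omega>) \<bullet> v)"
    unfolding one_point_grad_inner using i1 i2 n by auto
  show "expectation (\<lambda>\<omega>. one_point_grad f r u (e \<omega>) (\<xi>p \<omega>) (\<xi>m \<omega>) \<bullet> v) = sphere_grad f r u \<bullet> v"
    unfolding one_point_grad_inner sphere_grad_inner[OF f r] using i1 i2 n r by simp
qed

lemma noise_second_moment:
  assumes x: "\<xi> \<in> {\<xi>p, \<xi>m}" and n2: "CARD('n) \<ge> 2" and q: "1 \<le> q"
  shows "(\<integral>\<^sup>+\<omega>. ennreal ((\<xi> \<omega>)\<^sup>2 * (lp_norm q (e \<omega>))\<^sup>2) \<partial>M) \<le> ennreal (\<sigma>\<^sup>2 * (p_const q CARD('n))\<^sup>2)"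
proof -
  have [measurable]: "\<xi> \<in> borel_measurable M" using x \<xi> by auto
  have i: "indep_var borel \<xi> borel (\<lambda>\<omega>. lp_norm q (e \<omega>))"
    by (rule indep_var_of_indep_set[OF e _ _ ind[OF x]]) measurable
  have "(\<integral>\<^sup>+\<omega>. ennreal ((\<xi> \<omega>)\<^sup>2 * (lp_norm q (e \<omega>))\<^sup>2) \<partial>M)
    = (\<integral>\<^sup>+y. (\<integral>\<^sup>+\<omega>. ennreal (y\<^sup>2 * (lp_norm q (e \<omega>))\<^sup>2) \<partial>M) \<partial>distr M borel \<xi>)"
    using indep_var_nn_integral_prod[OF i, of "\<lambda>(y, z). ennreal (y\<^sup>2 * z\<^sup>2)"] by simp
  also have "\<dots> = (\<integral>\<^sup>+\<omega>'. (\<integral>\<^sup>+\<omega>. ennreal ((\<xi> \<omega>')\<^sup>2 * (lp_norm q (e \<omega>))\<^sup>2) \<partial>M) \<partial>M)"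
    by (subst nn_integral_distr) auto
  also have "\<dots> = (\<integral>\<^sup>+\<omega>'. ennreal ((\<xi> \<omega>')\<^sup>2) * (\<integral>\<^sup>+\<omega>. ennreal ((lp_norm q (e \<omega>))\<^sup>2) \<partial>M) \<partial>M)"
    by (simp add: ennreal_mult' nn_integral_cmult)
  also have "\<dots> = (\<integral>\<^sup>+\<omega>. ennreal ((\<xi> \<omega>)\<^sup>2) \<partial>M) * (\<integral>\<^sup>+\<omega>. ennreal ((lp_norm q (e \<omega>))\<^sup>2) \<partial>M)"
    by (simp add: nn_integral_multc)
  also have "(\<integral>\<^sup>+\<omega>. ennreal ((lp_norm q (e \<omega>))\<^sup>2) \<partial>M) = (\<integral>\<^sup>+a. ennreal ((lp_norm q a)\<^sup>2) \<partial>(uniform_sphere :: (real^'n) measure))"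
    unfolding e_law[symmetric] by (subst nn_integral_distr) auto
  also have "(\<integral>\<^sup>+\<omega>. ennreal ((\<xi> \<omega>)\<^sup>2) \<partial>M) = ennreal (expectation (\<lambda>\<omega>. (\<xi> \<omega>)\<^sup>2))"
    by (rule nn_integral_eq_integral[OF \<xi>_int[OF x]]) simp
  also have "\<dots> * (\<integral>\<^sup>+a. ennreal ((lp_norm q a)\<^sup>2) \<partial>(uniform_sphere :: (real^'n) measure)) \<le> ennreal (\<sigma>\<^sup>2) * ennreal ((p_const q CARD('n))\<^sup>2)"
    by (intro mult_mono ennreal_leI \<xi>_var[OF x] sphere_lp_second_moment n2 q) auto
  finally show ?thesis by (simp add: ennreal_mult')
qed

text \<open>The noises may be correlated, so the three contributions are separated by \<open>(a + b
  - d)\<^sup>2 \<le> 2 * a\<^sup>2 + 4 * b\<^sup>2 + 4 * d\<^sup>2\<close>. With the prefactor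
  \<open>n\<^sup>2 / (4 * r\<^sup>2)\<close> this gives 59 as \<open>2 * 118 / 4\<close> and 2 as
  \<open>(4 + 4) / 4\<close>.\<close>

lemma one_point_grad_second_moment:
  assumes f: "G-lipschitz_on UNIV f" and cf: "convex_on UNIV f" and r: "0 < r" and G: "0 < G"
    and n2: "CARD('n) \<ge> 2" and q: "1 \<le> q"
  defines "n \<equiv> real CARD('n)" and "c \<equiv> p_const q CARD('n)"
  shows "(\<integral>\<^sup>+\<omega>. ennreal ((lp_norm q (one_point_grad f r u (e \<omega>) (\<xi>p \<omega>) (\<xi>m \<omega>)))\<^sup>2) \<partial>M)
    \<le> ennreal (59 * n * G\<^sup>2 * c\<^sup>2 + 2 * n\<^sup>2 * c\<^sup>2 * \<sigma>\<^sup>2 / r\<^sup>2)"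
proof -
  note [measurable] = lipschitz_UNIV_measurable[OF f]
  have n: "n > 0" by (simp add: n_def)
  let ?h = "\<lambda>a. f (u + r *\<^sub>R a) - f (u - r *\<^sub>R a)"
  define C where "C = n\<^sup>2 / (4 * r\<^sup>2)"
  have C: "0 \<le> C" by (simp add: C_def)
  have lin: "ennreal C * (2 * ennreal x + (4 * ennreal y + 4 * ennreal z)) = ennreal (C * (2 * x + (4 * y + 4 * z)))"
    if "0 \<le> x" "0 \<le> y" "0 \<le> z" for x y z
    using that C by (simp add: ennreal_mult' ennreal_plus)
  let ?l = "\<lambda>\<omega>. (lp_norm q (e \<omega>))\<^sup>2"
  have "(\<integral>\<^sup>+\<omega>. ennreal ((lp_norm q (one_point_grad f r u (e \<omega>) (\<xi>p \<omega>) (\<xi>m \<omega>)))\<^sup>2) \<partial>M)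
    \<le> (\<integral>\<^sup>+\<omega>. ennreal C * (2 * ennreal ((?h (e \<omega>))\<^sup>2 * ?l \<omega>) + (4 * ennreal ((\<xi>p \<omega>)\<^sup>2 * ?l \<omega>) + 4 * ennreal ((\<xi>m \<omega>)\<^sup>2 * ?l \<omega>))) \<partial>M)"
  proof (rule nn_integral_mono)
    fix \<omega>
    define a where "a = ?h (e \<omega>)"
    define b where "b = \<xi>p \<omega>"
    define d where "d = \<xi>m \<omega>"
    have "one_point_grad f r u (e \<omega>) (\<xi>p \<omega>) (\<xi>m \<omega>) = (n / (2 * r) * (a + b - d)) *\<^sub>R e \<omega>"
      by (simp add: one_point_grad_def noisy_value_def n_def a_def b_def d_def algebra_simps)
    hence "(lp_norm q (one_point_grad f r u (e \<omega>) (\<xi>p \<omega>) (\<xi>m \<omega>)))\<^sup>2 = C * ((a + b - d)\<^sup>2 * ?l \<omega>)"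
      using q by (simp add: lp_norm_scaleR power_mult_distrib power_divide C_def)
    also have "\<dots> \<le> C * ((2 * a\<^sup>2 + (4 * b\<^sup>2 + 4 * d\<^sup>2)) * ?l \<omega>)"
    proof (intro mult_left_mono mult_right_mono C)
      have "0 \<le> (a - (b - d))\<^sup>2 + 2 * (b + d)\<^sup>2" by simp
      thus "(a + b - d)\<^sup>2 \<le> 2 * a\<^sup>2 + (4 * b\<^sup>2 + 4 * d\<^sup>2)" by (simp add: power2_eq_square algebra_simps)
    qed simp
    also have "\<dots> = C * (2 * (a\<^sup>2 * ?l \<omega>) + (4 * (b\<^sup>2 * ?l \<omega>) + 4 * (d\<^sup>2 * ?l \<omega>)))"
      by (simp add: algebra_simps)
    finally have "ennreal ((lp_norm q (one_point_grad f r u (e \<omega>) (\<xi>p \<omega>) (\<xi>m \<omega>)))\<^sup>2) \<le> ennreal (C * (2 * (a\<^sup>2 * ?l \<omega>) + (4 * (b\<^sup>2 * ?l \<omega>) + 4 * (d\<^sup>2 * ?l \<omega>))))"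
      by (rule ennreal_leI)
    also have "\<dots> = ennreal C * (2 * ennreal (a\<^sup>2 * ?l \<omega>) + (4 * ennreal (b\<^sup>2 * ?l \<omega>) + 4 * ennreal (d\<^sup>2 * ?l \<omega>)))"
      by (rule lin[symmetric]) auto
    finally show "ennreal ((lp_norm q (one_point_grad f r u (e \<omega>) (\<xi>p \<omega>) (\<xi>m \<omega>)))\<^sup>2)
      \<le> ennreal C * (2 * ennreal ((?h (e \<omega>))\<^sup>2 * ?l \<omega>) + (4 * ennreal ((\<xi>p \<omega>)\<^sup>2 * ?l \<omega>) + 4 * ennreal ((\<xi>m \<omega>)\<^sup>2 * ?l \<omega>)))"
      by (simp only: a_def b_def d_def)
  qed
  also have "\<dots> = ennreal C * (2 * (\<integral>\<^sup>+\<omega>. ennreal ((?h (e \<omega>))\<^sup>2 * ?l \<omega>) \<partial>M) +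
      (4 * (\<integral>\<^sup>+\<omega>. ennreal ((\<xi>p \<omega>)\<^sup>2 * ?l \<omega>) \<partial>M) + 4 * (\<integral>\<^sup>+\<omega>. ennreal ((\<xi>m \<omega>)\<^sup>2 * ?l \<omega>) \<partial>M)))"
    by (simp add: nn_integral_cmult nn_integral_add)
  also have "\<dots> \<le> ennreal C * (2 * ennreal (118 * r\<^sup>2 * G\<^sup>2 / n * c\<^sup>2) + (4 * ennreal (\<sigma>\<^sup>2 * c\<^sup>2) + 4 * ennreal (\<sigma>\<^sup>2 * c\<^sup>2)))"
  proof (intro mult_left_mono add_mono)
    have "(\<integral>\<^sup>+\<omega>. ennreal ((?h (e \<omega>))\<^sup>2 * ?l \<omega>) \<partial>M) = (\<integral>\<^sup>+a. ennreal ((?h a)\<^sup>2 * (lp_norm q a)\<^sup>2) \<partial>uniform_sphere)"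
      unfolding e_law[symmetric] by (subst nn_integral_distr) auto
    also have "\<dots> \<le> ennreal (118 * r\<^sup>2 * G\<^sup>2 / n * c\<^sup>2)"
      unfolding n_def c_def by (rule sphere_weighted_second_moment[OF f cf r G n2 q])
    finally show "(\<integral>\<^sup>+\<omega>. ennreal ((?h (e \<omega>))\<^sup>2 * ?l \<omega>) \<partial>M) \<le> ennreal (118 * r\<^sup>2 * G\<^sup>2 / n * c\<^sup>2)" .
    show "(\<integral>\<^sup>+\<omega>. ennreal ((\<xi>p \<omega>)\<^sup>2 * ?l \<omega>) \<partial>M) \<le> ennreal (\<sigma>\<^sup>2 * c\<^sup>2)"
      "(\<integral>\<^sup>+\<omega>. ennreal ((\<xi>m \<omega>)\<^sup>2 * ?l \<omega>) \<partial>M) \<le> ennreal (\<sigma>\<^sup>2 * c\<^sup>2)"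
      unfolding c_def by (rule noise_second_moment[OF _ n2 q], simp)+
  qed auto
  also have "\<dots> = ennreal (C * (2 * (118 * r\<^sup>2 * G\<^sup>2 / n * c\<^sup>2) + (4 * (\<sigma>\<^sup>2 * c\<^sup>2) + 4 * (\<sigma>\<^sup>2 * c\<^sup>2))))"
    by (rule lin) (use n in auto)
  also have "C * (2 * (118 * r\<^sup>2 * G\<^sup>2 / n * c\<^sup>2) + (4 * (\<sigma>\<^sup>2 * c\<^sup>2) + 4 * (\<sigma>\<^sup>2 * c\<^sup>2))) = 59 * n * G\<^sup>2 * c\<^sup>2 + 2 * n\<^sup>2 * c\<^sup>2 * \<sigma>\<^sup>2 / r\<^sup>2"
    using n r by (simp add: C_def field_simps power2_eq_square)
  finally show ?thesis .
qed

end

section \<open>Measurability of the iterates and the expected gap\<close>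

lemma measurable_continuous_on_compose:
  fixes h :: "'a::topological_space \<Rightarrow> 'b::topological_space"
  assumes "continuous_on X h" "Y \<in> borel_measurable M" "\<And>\<omega>. \<omega> \<in> space M \<Longrightarrow> Y \<omega> \<in> X"
  shows "(\<lambda>\<omega>. h (Y \<omega>)) \<in> borel_measurable M"
proof -
  have "Y \<in> measurable M (restrict_space borel X)"
    using assms by (intro measurable_restrict_space2) auto
  thus ?thesis
    by (rule measurable_compose) (rule borel_measurable_continuous_on_restrict[OF assms(1)])
qed

context sliding_setup
begin

lemma continuous_g':
  assumes C: "\<And>b. nrm b \<le> C * norm b"
  shows "continuous_on X g'"
proof (rule lipschitz_on_continuous_on, rule lipschitz_onI)
  have CC: "0 \<le> C"
  proof -
    obtain b :: 'a where "b \<in> Basis" using nonempty_Basis by blast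
    thus ?thesis using C[of b] nrm_nonneg[of b] by simp
  qed
  thus "0 \<le> L * C * C" using L_pos by simp
  fix x y assume xy: "x \<in> X" "y \<in> X"
  let ?d = "g' x - g' y"
  have "norm ?d * norm ?d = \<bar>?d \<bullet> ?d\<bar>" by (simp add: power2_norm_eq_inner[symmetric] power2_eq_square)
  also have "\<dots> \<le> dual ?d * nrm ?d" by (rule holder)
  also have "\<dots> \<le> (L * nrm (x - y)) * (C * norm ?d)"
    using smooth_g xy C nrm_nonneg L_pos unfolding smooth_on_def by (intro mult_mono) auto
  also have "\<dots> \<le> (L * (C * norm (x - y))) * (C * norm ?d)"
    using C[of "x - y"] L_pos CC by (intro mult_right_mono mult_left_mono) auto
  finally have "norm ?d * norm ?d \<le> (L * C * C * norm (x - y)) * norm ?d" by (simp add: mult_ac)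
  hence "norm ?d \<le> L * C * C * norm (x - y)"
    using L_pos CC by (cases "norm ?d = 0") (auto simp: mult_le_cancel_right)
  thus "dist (g' x) (g' y) \<le> L * C * C * dist x y" by (simp add: dist_norm)
qed

lemma inner_state_0: "inner_state G k 0 = (fst (outer G k), fst (outer G k))"
  by (simp add: inner_state_def)

lemma inner_state_Suc:
  fixes k t
  defines "b \<equiv> step_\<beta> (Suc k)" and "s \<equiv> step_p (Suc t)"
  shows "inner_state G k (Suc t) =
    (let u = fst (inner_state G k t);
         v = prox (b * (1 + s)) (g' (und G k) + G (Suc k) t u - b *\<^sub>R \<nu>' (fst (outer G k)) - (b * s) *\<^sub>R \<nu>' u)
     in (v, (1 - step_\<theta> (Suc t)) *\<^sub>R snd (inner_state G k t) + step_\<theta> (Suc t) *\<^sub>R v))"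
  unfolding inner_state_def prox_sliding_Suc b_def s_def Let_def
  by (subst prox_step_eq[OF model_def])+ (rule refl)

text \<open>Only query points with values in \<open>X\<close> are tested, because \<open>f\<close>
  is controlled only near \<open>X\<close> and may be irregular elsewhere.\<close>

definition measurable_oracle :: "'w measure \<Rightarrow> ('w \<Rightarrow> 'a \<Rightarrow> 'a) \<Rightarrow> bool" where
  "measurable_oracle M H \<longleftrightarrow>
     (\<forall>U\<in>borel_measurable M. (\<forall>\<omega>\<in>space M. U \<omega> \<in> X) \<longrightarrow> (\<lambda>\<omega>. H \<omega> (U \<omega>)) \<in> borel_measurable M)"

text \<open>\<open>M\<close> is any sigma-algebra for which the earlier calls are measurable. Later
  it is both the full one and the one generated by the past; the latter yields independence of the
  next sample.\<close>

lemma measurable_inner_state: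
  assumes g': "continuous_on X g'"
    and fst: "(\<lambda>\<omega>. fst (outer (Gr \<omega>) k)) \<in> borel_measurable M"
    and snd: "(\<lambda>\<omega>. snd (outer (Gr \<omega>) k)) \<in> borel_measurable M"
    and H: "\<And>s. s < t \<Longrightarrow> measurable_oracle M (\<lambda>\<omega>. Gr \<omega> (Suc k) s)"
  shows "(\<lambda>\<omega>. fst (inner_state (Gr \<omega>) k t)) \<in> borel_measurable M \<and> (\<lambda>\<omega>. snd (inner_state (Gr \<omega>) k t)) \<in> borel_measurable M"
  using H
proof (induction t)
  case 0
  thus ?case using fst by (simp add: inner_state_0)
next
  case (Suc t)
  note [measurable] = fst snd
  have IH [measurable]: "(\<lambda>\<omega>. fst (inner_state (Gr \<omega>) k t)) \<in> borel_measurable M"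
    "(\<lambda>\<omega>. snd (inner_state (Gr \<omega>) k t)) \<in> borel_measurable M" using Suc by auto
  have [measurable]: "(\<lambda>\<omega>. und (Gr \<omega>) k) \<in> borel_measurable M" unfolding und_def by measurable
  have [measurable]: "(\<lambda>\<omega>. g' (und (Gr \<omega>) k)) \<in> borel_measurable M"
    by (rule measurable_continuous_on_compose[OF g']) (auto intro: und_in)
  have [measurable]: "(\<lambda>\<omega>. \<nu>' (fst (outer (Gr \<omega>) k))) \<in> borel_measurable M"
    by (rule measurable_continuous_on_compose[OF cont_\<nu>']) (auto intro: outer_in)
  have [measurable]: "(\<lambda>\<omega>. \<nu>' (fst (inner_state (Gr \<omega>) k t))) \<in> borel_measurable M"
    by (rule measurable_continuous_on_compose[OF cont_\<nu>']) (auto intro: inner_state_in)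
  have [measurable]: "(\<lambda>\<omega>. Gr \<omega> (Suc k) t (fst (inner_state (Gr \<omega>) k t))) \<in> borel_measurable M"
    using Suc.prems[of t] IH(1) inner_state_in unfolding measurable_oracle_def by auto
  have [measurable]: "prox w \<in> borel_measurable borel" if "w > 0" for w
    by (rule borel_measurable_continuous_onI[OF continuous_prox[OF that]])
  have pos: "step_\<beta> (Suc k) * (1 + step_p (Suc t)) > 0"
    using L_pos by (intro mult_pos_pos divide_pos_pos add_pos_nonneg) auto
  note [measurable] = borel_measurable_continuous_onI[OF continuous_prox[OF pos]]
  show ?case
    unfolding inner_state_Suc Let_def fst_conv snd_conv by (intro conjI) measurable
qed

lemma measurable_outer:
  assumes g': "continuous_on X g'"
    and H: "\<And>j s. j < k \<Longrightarrow> s < T (Suc j) \<Longrightarrow> measurable_oracle M (\<lambda>\<omega>. Gr \<omega> (Suc j) s)"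
  shows "(\<lambda>\<omega>. fst (outer (Gr \<omega>) k)) \<in> borel_measurable M \<and> (\<lambda>\<omega>. snd (outer (Gr \<omega>) k)) \<in> borel_measurable M"
  using H
proof (induction k)
  case (Suc k)
  hence IH [measurable]: "(\<lambda>\<omega>. fst (outer (Gr \<omega>) k)) \<in> borel_measurable M" "(\<lambda>\<omega>. snd (outer (Gr \<omega>) k)) \<in> borel_measurable M"
    by auto
  have "(\<lambda>\<omega>. fst (inner_state (Gr \<omega>) k (T (Suc k)))) \<in> borel_measurable M \<and> (\<lambda>\<omega>. snd (inner_state (Gr \<omega>) k (T (Suc k)))) \<in> borel_measurable M"
    by (rule measurable_inner_state[OF g' IH]) (use Suc.prems in auto)
  hence [measurable]: "(\<lambda>\<omega>. fst (inner_state (Gr \<omega>) k (T (Suc k)))) \<in> borel_measurable M"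
    "(\<lambda>\<omega>. snd (inner_state (Gr \<omega>) k (T (Suc k)))) \<in> borel_measurable M" by auto
  show ?case unfolding outer_Suc fst_conv snd_conv by (intro conjI) measurable
qed simp

text \<open>In iteration \<open>a = j + 1\<close> the inner sum is at most
  \<open>T * B * a / L\<close>; dividing by the total weight leaves \<open>2 * B / L\<close> times
  \<open>a\<^sup>2 / (T + 3)\<close>. The quadratic growth of \<open>T\<close> makes this bound the
  same for all outer iterations.\<close>

lemma error_sum_bound:
  assumes c: "0 < c" and T: "\<And>j. j < N \<Longrightarrow> c * (real j + 1)\<^sup>2 \<le> real (T (Suc j))" and B: "0 \<le> B"
  shows "(\<Sum>j<N. (real j + 1) / tri (Suc j) * (\<Sum>t<T (Suc j). (real t + 2) * (B / (step_\<beta> (Suc j) * (real t + 1)))))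
    \<le> real N * (2 * B / (L * c))"
proof -
  have "(real j + 1) / tri (Suc j) * (\<Sum>t<T (Suc j). (real t + 2) * (B / (step_\<beta> (Suc j) * (real t + 1)))) \<le> 2 * B / (L * c)"
    if j: "j < N" for j
  proof -
    define \<tau> where "\<tau> = real (T (Suc j))"
    have \<tau>: "1 \<le> \<tau>" using T_ge_1[of "Suc j"] by (simp add: \<tau>_def)
    define a where "a = real j + 1"
    have a: "0 < a" by (simp add: a_def)
    have b: "step_\<beta> (Suc j) = 2 * L / a" by (simp add: a_def)
    have "(\<Sum>t<T (Suc j). (real t + 2) * (B / (step_\<beta> (Suc j) * (real t + 1)))) \<le> (\<Sum>t<T (Suc j). B * a / L)"
    proof (rule sum_mono)
      fix t :: nat
      have "(real t + 2) / (real t + 1) \<le> 2" by (simp add: divide_le_eq)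
      hence "(real t + 2) / (real t + 1) * (B * a / (2 * L)) \<le> 2 * (B * a / (2 * L))"
        using B a L_pos by (intro mult_right_mono) auto
      thus "(real t + 2) * (B / (step_\<beta> (Suc j) * (real t + 1))) \<le> B * a / L"
        unfolding b using L_pos a by (simp add: mult_ac)
    qed
    also have "\<dots> = \<tau> * (B * a / L)" by (simp add: \<tau>_def)
    finally have "a / tri (Suc j) * (\<Sum>t<T (Suc j). (real t + 2) * (B / (step_\<beta> (Suc j) * (real t + 1)))) \<le> a / tri (Suc j) * (\<tau> * (B * a / L))"
      using a tri_ge_2[of "Suc j"] by (intro mult_left_mono) auto
    also have "\<dots> = 2 * B / L * (a\<^sup>2 / (\<tau> + 3))"
      using \<tau> by (simp add: tri_def \<tau>_def[symmetric] power2_eq_square mult_ac)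
    also have "a\<^sup>2 / (\<tau> + 3) \<le> 1 / c"
    proof -
      have "c * a\<^sup>2 \<le> \<tau>" using T[OF j] by (simp add: a_def \<tau>_def)
      thus ?thesis using c \<tau> by (simp add: field_simps)
    qed
    hence "2 * B / L * (a\<^sup>2 / (\<tau> + 3)) \<le> 2 * B / L * (1 / c)" using B L_pos by (intro mult_left_mono) auto
    finally show ?thesis by (simp add: a_def)
  qed
  hence "(\<Sum>j<N. (real j + 1) / tri (Suc j) * (\<Sum>t<T (Suc j). (real t + 2) * (B / (step_\<beta> (Suc j) * (real t + 1)))))
    \<le> (\<Sum>j<N. 2 * B / (L * c))" by (intro sum_mono) auto
  thus ?thesis by simp
qed

text \<open>The mean of \<open>sliding_invariant\<close>, with its last divergence dropped as
  nonnegative. \<open>\<Delta>\<close> need only lie below the gap, which leaves room for exchanging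
  the smoothed objective for the original one.\<close>

lemma expected_gap:
  fixes M :: "'w measure" and Gr :: "'w \<Rightarrow> nat \<Rightarrow> nat \<Rightarrow> 'a \<Rightarrow> 'a"
  assumes M: "prob_space M" and u: "u \<in> X" and F: "convex_on X F"
    and FM: "\<And>v w. v \<in> X \<Longrightarrow> w \<in> X \<Longrightarrow> F v - F w \<le> m * nrm (v - w)"
    and gap: "integrable M \<Delta>" "\<And>\<omega>. \<omega> \<in> space M \<Longrightarrow> \<Delta> \<omega> \<le> F (snd (outer (Gr \<omega>) N)) + g (snd (outer (Gr \<omega>) N)) - (F u + g u)"
    and int: "\<And>j t. j < N \<Longrightarrow> t < T (Suc j) \<Longrightarrow> integrable M (\<lambda>\<omega>. step_err F m u (Gr \<omega>) j t)"
    and le: "\<And>j t. j < N \<Longrightarrow> t < T (Suc j) \<Longrightarrow> (\<integral>\<omega>. step_err F m u (Gr \<omega>) j t \<partial>M) \<le> B / (step_\<beta> (Suc j) * (real t + 1))"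
  shows "real N * (real N + 1) / 2 * (\<integral>\<omega>. \<Delta> \<omega> \<partial>M) \<le>
    3 * L * V x0 u + (\<Sum>j<N. (real j + 1) / tri (Suc j) * (\<Sum>t<T (Suc j). (real t + 2) * (B / (step_\<beta> (Suc j) * (real t + 1)))))"
proof -
  interpret prob_space M by (rule M)
  let ?R = "\<lambda>\<omega>. \<Sum>j<N. (real j + 1) / tri (Suc j) * (\<Sum>t<T (Suc j). (real t + 2) * step_err F m u (Gr \<omega>) j t)"
  have iR: "integrable M ?R" using int by (intro Bochner_Integration.integrable_sum integrable_mult_right) auto
  have "real N * (real N + 1) / 2 * (\<integral>\<omega>. \<Delta> \<omega> \<partial>M) = (\<integral>\<omega>. real N * (real N + 1) / 2 * \<Delta> \<omega> \<partial>M)" by simp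
  also have "\<dots> \<le> (\<integral>\<omega>. 3 * L * V x0 u + ?R \<omega> \<partial>M)"
  proof (rule integral_mono)
    fix \<omega> assume \<omega>: "\<omega> \<in> space M"
    have "real N * (real N + 1) / 2 * \<Delta> \<omega> \<le> real N * (real N + 1) / 2 * (F (snd (outer (Gr \<omega>) N)) + g (snd (outer (Gr \<omega>) N)) - (F u + g u))"
      by (intro mult_left_mono gap(2)[OF \<omega>]) auto
    moreover have "0 \<le> (if N = 0 then 3 * L else 2 * L * (1 + 1 / tri N)) * V (fst (outer (Gr \<omega>) N)) u"
      using L_pos tri_ge_2[of N] V_nonneg[OF outer_in(1) u] by (intro mult_nonneg_nonneg) auto
    ultimately show "real N * (real N + 1) / 2 * \<Delta> \<omega> \<le> 3 * L * V x0 u + ?R \<omega>"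
      using sliding_invariant[OF u F FM, of N "Gr \<omega>"] by linarith
  qed (use gap(1) iR in auto)
  also have "\<dots> = 3 * L * V x0 u + (\<integral>\<omega>. ?R \<omega> \<partial>M)" using iR prob_space by simp
  also have "(\<integral>\<omega>. ?R \<omega> \<partial>M) = (\<Sum>j<N. (real j + 1) / tri (Suc j) * (\<Sum>t<T (Suc j). (real t + 2) * (\<integral>\<omega>. step_err F m u (Gr \<omega>) j t \<partial>M)))"
  proof -
    have "(\<integral>\<omega>. ?R \<omega> \<partial>M) = (\<Sum>j<N. \<integral>\<omega>. (real j + 1) / tri (Suc j) * (\<Sum>t<T (Suc j). (real t + 2) * step_err F m u (Gr \<omega>) j t) \<partial>M)"
      using int by (intro Bochner_Integration.integral_sum integrable_mult_right Bochner_Integration.integrable_sum) auto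
    also have "\<dots> = (\<Sum>j<N. (real j + 1) / tri (Suc j) * (\<integral>\<omega>. (\<Sum>t<T (Suc j). (real t + 2) * step_err F m u (Gr \<omega>) j t) \<partial>M))"
      by simp
    also have "\<dots> = (\<Sum>j<N. (real j + 1) / tri (Suc j) * (\<Sum>t<T (Suc j). \<integral>\<omega>. (real t + 2) * step_err F m u (Gr \<omega>) j t \<partial>M))"
      using int by (intro sum.cong arg_cong[where f="(*) _"] Bochner_Integration.integral_sum integrable_mult_right refl) auto
    finally show ?thesis by simp
  qed
  also have "\<dots> \<le> (\<Sum>j<N. (real j + 1) / tri (Suc j) * (\<Sum>t<T (Suc j). (real t + 2) * (B / (step_\<beta> (Suc j) * (real t + 1)))))"
  proof (intro sum_mono mult_left_mono)
    fix j assume "j \<in> {..<N}"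
    show "0 \<le> (real j + 1) / tri (Suc j)" using tri_ge_2[of "Suc j"] by simp
  qed (use le in auto)
  finally show ?thesis by simp
qed

end

context gradient_sample
begin

lemma one_point_grad_measurable_pair:
  fixes f :: "real^'n \<Rightarrow> real"
  assumes [measurable]: "f \<in> borel_measurable borel"
  shows "(\<lambda>p :: ((real^'n) \<times> real \<times> real) \<times> ((real^'n) \<times> real \<times> real).
     one_point_grad f r (fst (fst p)) (fst (snd p)) (fst (snd (snd p))) (snd (snd (snd p)))) \<in> borel_measurable (borel \<Otimes>\<^sub>M borel)"
proof -
  have [measurable]: "fst \<in> borel_measurable (borel :: ((real^'n) \<times> real \<times> real) measure)"
    "snd \<in> borel_measurable (borel :: ((real^'n) \<times> real \<times> real) measure)"
    "fst \<in> borel_measurable (borel :: (real \<times> real) measure)" "snd \<in> borel_measurable (borel :: (real \<times> real) measure)"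
    by (intro borel_measurable_continuous_onI continuous_on_fst continuous_on_snd continuous_on_id)+
  show ?thesis unfolding one_point_grad_def noisy_value_def by measurable
qed

lemma random_step_moments:
  assumes f: "G-lipschitz_on UNIV f" and cf: "convex_on UNIV f" and r: "0 < r" and G: "0 < G"
    and n2: "CARD('n) \<ge> 2" and q: "1 \<le> q"
    and X: "bounded X" and x: "x \<in> X" and Y: "\<And>\<omega>. \<omega> \<in> space M \<Longrightarrow> Y \<omega> \<in> X"
    \<comment> \<open>\<open>indep_var\<close> wants both variables of one type, hence the padding.\<close>
    and ind: "indep_var borel (\<lambda>\<omega>. (Y \<omega>, 0, 0)) borel (\<lambda>\<omega>. (e \<omega>, \<xi>p \<omega>, \<xi>m \<omega>))"
    and Ym [measurable]: "Y \<in> borel_measurable M" and m: "0 \<le> m"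
  defines "n \<equiv> real CARD('n)" and "c \<equiv> p_const q CARD('n)"
  defines "g \<equiv> \<lambda>\<omega>. one_point_grad f r (Y \<omega>) (e \<omega>) (\<xi>p \<omega>) (\<xi>m \<omega>)"
  defines "err \<equiv> \<lambda>b \<omega>. g \<omega> \<bullet> (x - Y \<omega>) + smoothed f r (Y \<omega>) - smoothed f r x + (m + lp_norm q (g \<omega>))\<^sup>2 / b"
  assumes b: "0 < b"
  shows "integrable M (err b)"
    and "expectation (err b) \<le> (2 * m\<^sup>2 + 2 * (59 * n * G\<^sup>2 * c\<^sup>2 + 2 * n\<^sup>2 * c\<^sup>2 * \<sigma>\<^sup>2 / r\<^sup>2)) / b"
proof -
  note [measurable] = lipschitz_UNIV_measurable[OF f]
  define B where "B = 59 * n * G\<^sup>2 * c\<^sup>2 + 2 * n\<^sup>2 * c\<^sup>2 * \<sigma>\<^sup>2 / r\<^sup>2"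
  have B: "0 \<le> B" by (simp add: B_def n_def)
  let ?S = "\<lambda>\<omega>. (e \<omega>, \<xi>p \<omega>, \<xi>m \<omega>)" and ?Z = "\<lambda>\<omega>. (Y \<omega>, 0::real, 0::real)"
  define h where "h = (\<lambda>p :: ((real^'n) \<times> real \<times> real) \<times> ((real^'n) \<times> real \<times> real).
     one_point_grad f r (fst (fst p)) (fst (snd p)) (fst (snd (snd p))) (snd (snd (snd p))))"
  have hm [measurable]: "h \<in> borel_measurable (borel \<Otimes>\<^sub>M borel)"
    unfolding h_def by (rule one_point_grad_measurable_pair) measurable
  have gh: "g \<omega> = h (?Z \<omega>, ?S \<omega>)" for \<omega> by (simp add: g_def h_def)
  have Zm [measurable]: "?Z \<in> borel_measurable M" and Sm [measurable]: "?S \<in> borel_measurable M"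
    using ind by (auto dest: indep_var_rv1 indep_var_rv2)
  have gm [measurable]: "g \<in> borel_measurable M" unfolding gh[abs_def] by measurable
  have "(\<integral>\<^sup>+\<omega>. (\<lambda>p. ennreal ((lp_norm q (h p))\<^sup>2)) (?Z \<omega>, ?S \<omega>) \<partial>M) \<le> ennreal B"
  proof (rule indep_var_nn_integral_le[OF ind, where A=UNIV])
    fix z :: "(real^'n) \<times> real \<times> real"
    show "(\<integral>\<^sup>+\<omega>. ennreal ((lp_norm q (h (z, ?S \<omega>)))\<^sup>2) \<partial>M) \<le> ennreal B"
      unfolding h_def B_def n_def c_def using one_point_grad_second_moment[OF f cf r G n2 q, of "fst z"] by simp
  qed auto
  hence sq: "(\<integral>\<^sup>+\<omega>. ennreal ((lp_norm q (g \<omega>))\<^sup>2) \<partial>M) \<le> ennreal B" by (simp add: gh)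
  have isq: "integrable M (\<lambda>\<omega>. (lp_norm q (g \<omega>))\<^sup>2)"
    by (rule integrableI_nonneg) (use sq in \<open>auto simp: order_le_less_trans\<close>)
  have Esq: "expectation (\<lambda>\<omega>. (lp_norm q (g \<omega>))\<^sup>2) \<le> B"
  proof -
    have "ennreal (expectation (\<lambda>\<omega>. (lp_norm q (g \<omega>))\<^sup>2)) \<le> ennreal B"
      using sq nn_integral_eq_integral[OF isq] by simp
    thus ?thesis using B by (simp add: ennreal_le_iff)
  qed
  have i2: "integrable M (\<lambda>\<omega>. (m + lp_norm q (g \<omega>))\<^sup>2)"
    and E2: "expectation (\<lambda>\<omega>. (m + lp_norm q (g \<omega>))\<^sup>2) \<le> 2 * m\<^sup>2 + 2 * B"
  proof -
    have pt: "(m + lp_norm q (g \<omega>))\<^sup>2 \<le> 2 * m\<^sup>2 + 2 * (lp_norm q (g \<omega>))\<^sup>2" for \<omega>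
    proof -
      have "0 \<le> (m - lp_norm q (g \<omega>))\<^sup>2" by simp
      thus ?thesis by (simp add: power2_eq_square algebra_simps)
    qed
    have i: "integrable M (\<lambda>\<omega>. 2 * m\<^sup>2 + 2 * (lp_norm q (g \<omega>))\<^sup>2)" using isq by simp
    show i2: "integrable M (\<lambda>\<omega>. (m + lp_norm q (g \<omega>))\<^sup>2)"
      by (rule Bochner_Integration.integrable_bound[OF i]) (use pt in auto)
    have "expectation (\<lambda>\<omega>. (m + lp_norm q (g \<omega>))\<^sup>2) \<le> expectation (\<lambda>\<omega>. 2 * m\<^sup>2 + 2 * (lp_norm q (g \<omega>))\<^sup>2)"
      by (intro integral_mono i2 i pt)
    also have "\<dots> = 2 * m\<^sup>2 + 2 * expectation (\<lambda>\<omega>. (lp_norm q (g \<omega>))\<^sup>2)" using isq prob_space by simp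
    finally show "expectation (\<lambda>\<omega>. (m + lp_norm q (g \<omega>))\<^sup>2) \<le> 2 * m\<^sup>2 + 2 * B" using Esq by simp
  qed
  define K where "K = diameter X"
  have K: "norm (x - y) \<le> K" if "y \<in> X" for y
    using diameter_bounded_bound[OF X x that] by (simp add: K_def dist_norm)
  have K0: "0 \<le> K" using K[OF x] by simp
  note lipF = lipschitz_UNIV_D[OF smoothed_lipschitz[OF f r]]
  note Fm [measurable] = lipschitz_UNIV_measurable[OF smoothed_lipschitz[OF f r]]
  \<comment> \<open>\<open>X\<close> is bounded, so the inner product is at most a multiple of the
    norm of the estimate, and \<open>t \<le> 1 + t\<^sup>2\<close> reduces integrability to the
    second moment.\<close>
  have i1: "integrable M (\<lambda>\<omega>. g \<omega> \<bullet> (x - Y \<omega>) + smoothed f r (Y \<omega>) - smoothed f r x)"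
  proof (rule Bochner_Integration.integrable_bound)
    show "integrable M (\<lambda>\<omega>. sqrt n * K * (1 + (lp_norm q (g \<omega>))\<^sup>2) + G * K)" using isq by simp
    show "AE \<omega> in M. norm (g \<omega> \<bullet> (x - Y \<omega>) + smoothed f r (Y \<omega>) - smoothed f r x) \<le> norm (sqrt n * K * (1 + (lp_norm q (g \<omega>))\<^sup>2) + G * K)"
    proof (rule AE_I2)
      fix \<omega> assume \<omega>: "\<omega> \<in> space M"
      have t: "t \<le> 1 + t\<^sup>2" for t :: real
      proof -
        have "0 \<le> (t - 1 / 2)\<^sup>2" by simp
        thus ?thesis by (simp add: power2_diff power_divide)
      qed
      have "norm (g \<omega>) \<le> sqrt n * lp_norm q (g \<omega>)" unfolding n_def by (rule norm_le_lp_norm[OF q])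
      also have "\<dots> \<le> sqrt n * (1 + (lp_norm q (g \<omega>))\<^sup>2)" by (intro mult_left_mono t) (simp add: n_def)
      finally have "norm (g \<omega>) * norm (x - Y \<omega>) \<le> (sqrt n * (1 + (lp_norm q (g \<omega>))\<^sup>2)) * K"
        using K[OF Y[OF \<omega>]] by (intro mult_mono) (auto simp: n_def)
      moreover have "\<bar>g \<omega> \<bullet> (x - Y \<omega>)\<bar> \<le> norm (g \<omega>) * norm (x - Y \<omega>)" by (rule Cauchy_Schwarz_ineq2)
      moreover have "\<bar>smoothed f r (Y \<omega>) - smoothed f r x\<bar> \<le> G * K"
      proof -
        have "\<bar>smoothed f r x - smoothed f r (Y \<omega>)\<bar> \<le> G * norm (x - Y \<omega>)" by (rule lipF)
        also have "\<dots> \<le> G * K" using K[OF Y[OF \<omega>]] G by (intro mult_left_mono) auto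
        finally show ?thesis by (simp add: abs_minus_commute)
      qed
      ultimately show "norm (g \<omega> \<bullet> (x - Y \<omega>) + smoothed f r (Y \<omega>) - smoothed f r x) \<le> norm (sqrt n * K * (1 + (lp_norm q (g \<omega>))\<^sup>2) + G * K)"
        by (simp add: mult_ac)
    qed
  qed measurable
  \<comment> \<open>At each frozen point the mean of the estimate is a subgradient of the smoothed
    function there, so this part of the error has nonpositive mean; independence carries this over
    to the random point \<open>Y\<close>.\<close>
  have E1: "expectation (\<lambda>\<omega>. g \<omega> \<bullet> (x - Y \<omega>) + smoothed f r (Y \<omega>) - smoothed f r x) \<le> 0"
  proof -
    let ?Q = "\<lambda>p. h p \<bullet> (x - fst (fst p)) + smoothed f r (fst (fst p)) - smoothed f r x"
    have [measurable]: "fst \<in> borel \<rightarrow>\<^sub>M (borel :: (real^'n) measure)"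
      by (intro borel_measurable_continuous_onI continuous_on_fst continuous_on_id)
    have "expectation (\<lambda>\<omega>. ?Q (?Z \<omega>, ?S \<omega>)) \<le> 0"
    proof (rule indep_var_integral_le[OF ind, where A=UNIV])
      show "?Q \<in> borel_measurable (borel \<Otimes>\<^sub>M borel)" by measurable
      show "integrable M (\<lambda>\<omega>. ?Q (?Z \<omega>, ?S \<omega>))" using i1 by (simp add: gh)
      fix z :: "(real^'n) \<times> real \<times> real"
      let ?y = "fst z"
      note mean = one_point_grad_mean[OF f r, of ?y "x - ?y"]
      have "expectation (\<lambda>\<omega>. ?Q (z, ?S \<omega>)) = sphere_grad f r ?y \<bullet> (x - ?y) + smoothed f r ?y - smoothed f r x"
        unfolding h_def using mean prob_space by simp
      also have "\<dots> \<le> 0" using sphere_grad_subgradient[OF f cf r, of ?y "x - ?y"] by simp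
      finally show "expectation (\<lambda>\<omega>. ?Q (z, ?S \<omega>)) \<le> 0" .
    qed auto
    thus ?thesis by (simp add: gh)
  qed
  show "integrable M (err b)"
    unfolding err_def using i1 i2 by (intro Bochner_Integration.integrable_add integrable_divide_zero) auto
  have "expectation (err b) = expectation (\<lambda>\<omega>. g \<omega> \<bullet> (x - Y \<omega>) + smoothed f r (Y \<omega>) - smoothed f r x) + expectation (\<lambda>\<omega>. (m + lp_norm q (g \<omega>))\<^sup>2) / b"
    unfolding err_def using i1 i2 by (subst Bochner_Integration.integral_add) auto
  also have "\<dots> \<le> 0 + (2 * m\<^sup>2 + 2 * B) / b"
    using b by (intro add_mono E1 divide_right_mono E2) auto
  finally show "expectation (err b) \<le> (2 * m\<^sup>2 + 2 * (59 * n * G\<^sup>2 * c\<^sup>2 + 2 * n\<^sup>2 * c\<^sup>2 * \<sigma>\<^sup>2 / r\<^sup>2)) / b"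
    by (simp add: B_def)
qed

end

context mirror_setup
begin

text \<open>\<open>bregman_diam\<close> is a supremum of reals and bounds its members only if the
  set is bounded above; compactness of \<open>X\<close> and continuity of \<open>\<nu>\<close> and
  \<open>\<nu>'\<close> ensure this.\<close>

lemma V_le_diam:
  assumes xy: "x \<in> X" "y \<in> X"
  shows "2 * V x y \<le> (bregman_diam X \<nu> \<nu>')\<^sup>2" and "0 \<le> bregman_diam X \<nu> \<nu>'"
proof -
  have "continuous_on (X \<times> X) (\<lambda>p. sqrt (2 * V (fst p) (snd p)))"
    unfolding bregman_def
    by (intro continuous_intros continuous_on_compose2[OF cont_\<nu>] continuous_on_compose2[OF cont_\<nu>']) auto
  hence "compact ((\<lambda>p. sqrt (2 * V (fst p) (snd p))) ` (X \<times> X))"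
    by (rule compact_continuous_image) (intro compact_Times compact_X)
  hence bdd: "bdd_above ((\<lambda>(x, y). sqrt (2 * V x y)) ` (X \<times> X))"
    by (simp add: case_prod_beta' compact_imp_bounded bounded_imp_bdd_above)
  have "(\<lambda>(x, y). sqrt (2 * V x y)) (x, y) \<le> bregman_diam X \<nu> \<nu>'"
    unfolding bregman_diam_def by (rule cSUP_upper[OF _ bdd]) (use xy in auto)
  hence le: "sqrt (2 * V x y) \<le> bregman_diam X \<nu> \<nu>'" by simp
  have V: "0 \<le> 2 * V x y" using V_nonneg[OF xy] by simp
  thus "0 \<le> bregman_diam X \<nu> \<nu>'" using le by (meson order.trans real_sqrt_ge_zero)
  show "2 * V x y \<le> (bregman_diam X \<nu> \<nu>')\<^sup>2"
    using power_mono[OF le real_sqrt_ge_zero[OF V], of 2] V by simp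
qed

end

section \<open>Iteration counts and the final estimate\<close>

lemma lp_norm_le_norm:
  fixes b :: "real^'n"
  assumes "1 \<le> p"
  shows "lp_norm p b \<le> real CARD('n) * norm b"
proof -
  have "lp_norm p b \<le> lp_norm 1 b" by (rule lp_norm_antimono[OF order.refl assms])
  also have "\<dots> = lp_norm (ereal 1) b" by (simp add: one_ereal_def)
  also have "\<dots> = (\<Sum>i\<in>UNIV. \<bar>b $ i\<bar>)" by (simp add: lp_norm_ereal sum_nonneg)
  also have "\<dots> \<le> (\<Sum>i\<in>(UNIV::'n set). norm b)" by (intro sum_mono component_le_norm_cart)
  finally show ?thesis by simp
qed

lemma sum_squares_le: "(\<Sum>k=1..N. (real k)\<^sup>2) \<le> (real N + 1) ^ 3 / 3"
proof (induction N)
  case (Suc N)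
  have "(\<Sum>k=1..Suc N. (real k)\<^sup>2) \<le> (real N + 1) ^ 3 / 3 + (real N + 1)\<^sup>2"
    using Suc by (simp add: add.commute)
  also have "\<dots> \<le> (real (Suc N) + 1) ^ 3 / 3"
    by (simp add: power2_eq_square power3_eq_cube field_simps)
  finally show ?case .
qed simp

text \<open>Rounding up and the maximum with 1 together cost at most 1 per term. The squares sum to
  at most \<open>(N + 1) ^ 3 / 3\<close>, and the remaining factor \<open>N\<close> is enlarged to
  \<open>N + 1\<close>.\<close>

lemma total_iterations_le:
  fixes A :: real
  assumes A: "0 \<le> A"
  shows "real (\<Sum>k=1..N. max 1 (nat \<lceil>real N * A * (real k)\<^sup>2\<rceil>)) \<le> (real N + 1) ^ 4 * (A / 3) + real N"
proof -
  have "real (\<Sum>k=1..N. max 1 (nat \<lceil>real N * A * (real k)\<^sup>2\<rceil>)) \<le> (\<Sum>k=1..N. real N * A * (real k)\<^sup>2 + 1)"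
  proof (subst of_nat_sum, rule sum_mono)
    fix k
    have "0 \<le> real N * A * (real k)\<^sup>2" using A by simp
    thus "real (max 1 (nat \<lceil>real N * A * (real k)\<^sup>2\<rceil>)) \<le> real N * A * (real k)\<^sup>2 + 1" by linarith
  qed
  also have "\<dots> = real N * A * (\<Sum>k=1..N. (real k)\<^sup>2) + real N"
    by (simp add: sum.distrib sum_distrib_left)
  also have "real N * A * (\<Sum>k=1..N. (real k)\<^sup>2) \<le> (real N + 1) * A * ((real N + 1) ^ 3 / 3)"
    using A by (intro mult_mono sum_squares_le) (auto intro: sum_nonneg)
  also have "\<dots> = (real N + 1) ^ 4 * (A / 3)" by (simp add: eval_nat_numeral)
  finally show ?thesis by simp
qed

theorem theoremE3:
  fixes M :: "'w measure"
    and X :: "(real^'n) set"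
    and f g \<nu> :: "real^'n \<Rightarrow> real"
    and g' \<nu>' :: "real^'n \<Rightarrow> real^'n"
    and p q :: ereal
    and L G r \<sigma> :: real
    and x0 x_opt :: "real^'n"
    and N :: nat
    and e :: "nat \<Rightarrow> nat \<Rightarrow> 'w \<Rightarrow> real^'n"
    and \<xi>p \<xi>m :: "nat \<Rightarrow> nat \<Rightarrow> 'w \<Rightarrow> real"
    and n :: nat and \<Psi> :: "real^'n \<Rightarrow> real" and D pn Gt rho2 :: real and T :: "nat \<Rightarrow> nat"
    and x_out :: "'w \<Rightarrow> real^'n"
  defines "n \<equiv> CARD('n)"
    and "\<Psi> \<equiv> \<lambda>x. f x + g x"
    and "D \<equiv> bregman_diam X \<nu> \<nu>'"
    and "pn \<equiv> p_const q n"
    and "Gt \<equiv> 2 * pn * sqrt (real n) * G"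
    and "rho2 \<equiv> 24 * real n * pn\<^sup>2 * G\<^sup>2 + 4 * (real n)\<^sup>2 * pn\<^sup>2 * \<sigma>\<^sup>2 / r\<^sup>2"
    and "T \<equiv> \<lambda>k. max 1 (nat \<lceil>real N * (2 * Gt\<^sup>2 + rho2) * (real k)\<^sup>2 / (D\<^sup>2 * L\<^sup>2)\<rceil>)"
    and "x_out \<equiv> \<lambda>\<omega>. sliding_output X (bregman \<nu> \<nu>') g g'
           (\<lambda>t. real t / 2)
           (\<lambda>t. 2 * (real t + 1) / (real t * (real t + 3)))
           (\<lambda>k. 2 * L / real k)
           (\<lambda>k. 2 / (real k + 1))
           T
           (\<lambda>k t u. one_point_grad f r u (e k t \<omega>) (\<xi>p k t \<omega>) (\<xi>m k t \<omega>))
           x0 N"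
  assumes "n \<ge> 2"
    and "1 \<le> p" and "1 \<le> q" and "1 / p + 1 / q = 1"
    and "compact X" and "convex X" and "X \<noteq> {}"
    and "has_gradient_on \<nu> \<nu>' X" and "continuous_on X \<nu>'"
    and "strongly_convex_on (lp_norm p) 1 X \<nu>"
    and "convex_on X g" and "smooth_on (lp_norm p) (lp_norm q) L X g g'" and "L > 0"
    and "r > 0" and "G > 0"
    and "convex_on {x + z | x z. x \<in> X \<and> norm z \<le> r} f"
    and "G-lipschitz_on {x + z | x z. x \<in> X \<and> norm z \<le> r} f"
    and "x_opt \<in> X" and "\<forall>x\<in>X. \<Psi> x_opt \<le> \<Psi> x"
    and "x0 \<in> X" and "N \<ge> 1"
    and "oracle_samples M \<sigma> N T e \<xi>p \<xi>m"
  shows "(integrable M (\<lambda>\<omega>. \<Psi> (x_out \<omega>) - \<Psi> x_opt) \<and>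
          prob_space.expectation M (\<lambda>\<omega>. \<Psi> (x_out \<omega>) - \<Psi> x_opt)
            \<le> 20 * L * D\<^sup>2 / (real N * (real N + 1)) + 2 * r * G) \<and>
         real (\<Sum>k=1..N. T k)
            \<le> (real N + 1) ^ 4 / (D\<^sup>2 * L\<^sup>2) *
                (20 * pn\<^sup>2 * real n * G\<^sup>2 + 2 * pn\<^sup>2 * (real n)\<^sup>2 * \<sigma>\<^sup>2 / r\<^sup>2) + real N"
proof -
  note defs = n_def \<Psi>_def D_def pn_def Gt_def rho2_def T_def x_out_def
  note n2 = \<open>n \<ge> 2\<close>[unfolded n_def] and q = \<open>1 \<le> q\<close> and p = \<open>1 \<le> p\<close>
  note r = \<open>r > 0\<close> and G = \<open>G > 0\<close>
  have npos: "0 < real n" using \<open>n \<ge> 2\<close> by simp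
  have pn: "0 < pn" unfolding pn_def n_def by (rule p_const_pos[OF n2 q])
  define Q where "Q = 2 * Gt\<^sup>2 + rho2"
  define v1 where "v1 = real n * pn\<^sup>2 * G\<^sup>2"
  define v2 where "v2 = (real n)\<^sup>2 * pn\<^sup>2 * \<sigma>\<^sup>2 / r\<^sup>2"
  \<comment> \<open>\<open>2 * Gt\<^sup>2\<close> contributes 8 to the coefficient of
    \<open>v1\<close>, and \<open>rho2\<close> the other 24.\<close>
  have Q: "Q = 32 * v1 + 4 * v2"
    by (simp add: Q_def Gt_def rho2_def v1_def v2_def power_mult_distrib)
  have np: "0 < v1" unfolding v1_def using npos pn G by simp
  have ns: "0 \<le> v2" by (simp add: v2_def)
  have Qpos: "0 < Q" unfolding Q using np ns by linarith
  have T_alt: "T k = max 1 (nat \<lceil>real N * (Q / (D\<^sup>2 * L\<^sup>2)) * (real k)\<^sup>2\<rceil>)" for k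
    by (simp add: T_def Q_def)
  \<comment> \<open>Also true for \<open>D = 0\<close>: division by zero gives 0, every
    \<open>T k\<close> is 1, and the bound on the total number reads
    \<open>N \<le> N\<close>.\<close>
  have A0: "0 \<le> Q / (D\<^sup>2 * L\<^sup>2)" using Qpos by simp
  have total: "real (\<Sum>k=1..N. T k) \<le> (real N + 1) ^ 4 / (D\<^sup>2 * L\<^sup>2) *
                (20 * pn\<^sup>2 * real n * G\<^sup>2 + 2 * pn\<^sup>2 * (real n)\<^sup>2 * \<sigma>\<^sup>2 / r\<^sup>2) + real N"
  proof -
    have "real (\<Sum>k=1..N. T k) \<le> (real N + 1) ^ 4 * (Q / (D\<^sup>2 * L\<^sup>2) / 3) + real N"
      unfolding T_alt by (rule total_iterations_le[OF A0])
    also have "(real N + 1) ^ 4 * (Q / (D\<^sup>2 * L\<^sup>2) / 3) = (real N + 1) ^ 4 / (D\<^sup>2 * L\<^sup>2) * (Q / 3)" by simp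
    also have "\<dots> \<le> (real N + 1) ^ 4 / (D\<^sup>2 * L\<^sup>2) * (20 * pn\<^sup>2 * real n * G\<^sup>2 + 2 * pn\<^sup>2 * (real n)\<^sup>2 * \<sigma>\<^sup>2 / r\<^sup>2)"
    proof (rule mult_left_mono)
      \<comment> \<open>One third of \<open>Q\<close> is \<open>32 / 3 * v1 + 4 / 3 * v2\<close>,
        below the coefficients 20 and 2 of the claim.\<close>
      have "Q \<le> 60 * v1 + 6 * v2" unfolding Q using np ns by linarith
      hence "Q / 3 \<le> 20 * v1 + 2 * v2" by simp
      thus "Q / 3 \<le> 20 * pn\<^sup>2 * real n * G\<^sup>2 + 2 * pn\<^sup>2 * (real n)\<^sup>2 * \<sigma>\<^sup>2 / r\<^sup>2"
        by (simp add: v1_def v2_def mult_ac)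
    qed simp
    finally show ?thesis by simp
  qed
  define K where "K = {x + z | x z. x \<in> X \<and> norm z \<le> r}"
  have KI: "x + z \<in> K" if "x \<in> X" "norm z \<le> r" for x z using that by (auto simp: K_def)
  have XK: "x \<in> K" if "x \<in> X" for x using KI[OF that, of 0] r by simp
  have "K \<noteq> {}" using XK \<open>x_opt \<in> X\<close> by blast
  then obtain F where F: "convex_on UNIV F" "G-lipschitz_on UNIV F" "\<And>x. x \<in> K \<Longrightarrow> F x = f x"
    using convex_lipschitz_extension[of K f G] \<open>convex_on {x + z | x z. x \<in> X \<and> norm z \<le> r} f\<close>
      \<open>G-lipschitz_on {x + z | x z. x \<in> X \<and> norm z \<le> r} f\<close> unfolding K_def by blast
  interpret mirror_setup X \<nu> \<nu>' "lp_norm p" "lp_norm q" "sqrt (real CARD('n))"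
  proof
    show "\<bar>a \<bullet> b\<bar> \<le> lp_norm q a * lp_norm p b" for a b :: "real^'n"
      by (rule lp_norm_holder[OF p q \<open>1 / p + 1 / q = 1\<close>])
    show "lp_norm p (c *\<^sub>R b) = \<bar>c\<bar> * lp_norm p b" for c and b :: "real^'n" by (rule lp_norm_scaleR[OF p])
    show "norm b \<le> sqrt (real CARD('n)) * lp_norm p b" for b :: "real^'n" by (rule norm_le_lp_norm[OF p])
    show "0 < sqrt (real CARD('n))" by simp
  qed (fact | simp)+
  interpret sliding_setup X \<nu> \<nu>' "lp_norm p" "lp_norm q" "sqrt (real CARD('n))" g g' L T x0
  proof
    show "1 \<le> T k" for k by (simp add: T_def)
    show "T k \<le> T (Suc k)" for k
    proof -
      have "real N * (Q / (D\<^sup>2 * L\<^sup>2)) * (real k)\<^sup>2 \<le> real N * (Q / (D\<^sup>2 * L\<^sup>2)) * (real (Suc k))\<^sup>2"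
        by (intro mult_left_mono power_mono mult_nonneg_nonneg A0) auto
      thus ?thesis unfolding T_alt by (intro max.mono nat_mono ceiling_mono) auto
    qed
  qed fact+
  have cg': "continuous_on X g'"
    by (rule continuous_g'[of "real CARD('n)"]) (rule lp_norm_le_norm[OF p])
  define Gr where "Gr = (\<lambda>\<omega> k t u. one_point_grad f r u (e k t \<omega>) (\<xi>p k t \<omega>) (\<xi>m k t \<omega>))"
  have out: "x_out \<omega> = snd (outer (Gr \<omega>) N)" for \<omega>
    by (simp add: x_out_def sliding_output_def outer_def Gr_def)
  have outX: "x_out \<omega> \<in> X" for \<omega> unfolding out by (rule outer_in)
  note samples = \<open>oracle_samples M \<sigma> N T e \<xi>p \<xi>m\<close>[unfolded oracle_samples_def]
  interpret prob_space M using samples by blast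
  define I where "I = (SIGMA k:{1..N}. {..<T k})"
  define S where "S = (\<lambda>(k, t) \<omega>. (e k t \<omega>, \<xi>p k t \<omega>, \<xi>m k t \<omega>))"
  have indS: "indep_vars (\<lambda>_. borel) S I" using samples unfolding S_def I_def by blast
  have projections [measurable]: "fst \<in> borel \<rightarrow>\<^sub>M (borel :: (real^'n) measure)" "snd \<in> borel_measurable (borel :: ((real^'n) \<times> real \<times> real) measure)"
    "fst \<in> borel_measurable (borel :: (real \<times> real) measure)" "snd \<in> borel_measurable (borel :: (real \<times> real) measure)"
    by (intro borel_measurable_continuous_onI continuous_on_fst continuous_on_snd continuous_on_id)+
  have components: "e k t \<in> borel_measurable M'" "\<xi>p k t \<in> borel_measurable M'" "\<xi>m k t \<in> borel_measurable M'"
    if [measurable]: "S (k, t) \<in> borel_measurable M'" for M' k t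
  proof -
    have "(\<lambda>\<omega>. fst (S (k, t) \<omega>)) \<in> borel_measurable M'" "(\<lambda>\<omega>. fst (snd (S (k, t) \<omega>))) \<in> borel_measurable M'"
      "(\<lambda>\<omega>. snd (snd (S (k, t) \<omega>))) \<in> borel_measurable M'" by measurable
    thus "e k t \<in> borel_measurable M'" "\<xi>p k t \<in> borel_measurable M'" "\<xi>m k t \<in> borel_measurable M'"
      by (simp_all add: S_def)
  qed
  have unit: "norm (e k t \<omega>) = 1" if "(k, t) \<in> I" "\<omega> \<in> space M" for k t \<omega>
  proof -
    have "e k t \<in> space M \<rightarrow> sphere 0 1" using samples that(1) by (auto simp: I_def)
    thus ?thesis using that(2) by auto
  qed
  \<comment> \<open>Directions of unit length keep both query points within distance
    \<open>r\<close> of \<open>X\<close>, where \<open>f\<close> and its extension \<open>F\<close>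
    agree. So the run of the algorithm with \<open>f\<close> is one with \<open>F\<close>.\<close>
  have GrF: "Gr \<omega> k t u = one_point_grad F r u (e k t \<omega>) (\<xi>p k t \<omega>) (\<xi>m k t \<omega>)"
    if "(k, t) \<in> I" "\<omega> \<in> space M" "u \<in> X" for \<omega> k t u
  proof -
    have "u + r *\<^sub>R e k t \<omega> \<in> K" "u - r *\<^sub>R e k t \<omega> \<in> K"
      using KI[OF that(3), of "r *\<^sub>R e k t \<omega>"] KI[OF that(3), of "- (r *\<^sub>R e k t \<omega>)"] unit[OF that(1,2)] r
      by simp_all
    thus ?thesis using F(3) by (simp add: Gr_def one_point_grad_def noisy_value_def)
  qed
  note [measurable] = lipschitz_UNIV_measurable[OF F(2)]
  have query: "measurable_oracle M' (\<lambda>\<omega>. Gr \<omega> k t)"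
    if kt: "(k, t) \<in> I" and S: "S (k, t) \<in> borel_measurable M'" and sp: "space M' = space M" for M' k t
    unfolding measurable_oracle_def
  proof (intro ballI impI)
    fix U assume [measurable]: "U \<in> borel_measurable M'" and U: "\<forall>\<omega>\<in>space M'. U \<omega> \<in> X"
    note [measurable] = components[OF S]
    have "(\<lambda>\<omega>. one_point_grad F r (U \<omega>) (e k t \<omega>) (\<xi>p k t \<omega>) (\<xi>m k t \<omega>)) \<in> borel_measurable M'"
      unfolding one_point_grad_def noisy_value_def by measurable
    thus "(\<lambda>\<omega>. Gr \<omega> k t (U \<omega>)) \<in> borel_measurable M'"
      using GrF[OF kt] U sp by (subst measurable_cong) auto
  qed
  have SM: "S i \<in> borel_measurable M" if "i \<in> I" for i using indS that by (auto simp: indep_vars_def)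
  have idx: "(Suc j, t) \<in> I" if "j < N" "t < T (Suc j)" for j t using that by (auto simp: I_def)
  have out_meas: "x_out \<in> borel_measurable M"
  proof -
    have "(\<lambda>\<omega>. fst (outer (Gr \<omega>) N)) \<in> borel_measurable M \<and> (\<lambda>\<omega>. snd (outer (Gr \<omega>) N)) \<in> borel_measurable M"
      by (rule measurable_outer[OF cg']) (auto intro!: query SM idx)
    thus ?thesis by (simp add: out[abs_def])
  qed
  have cont_f: "continuous_on X f"
    using lipschitz_on_continuous_on[OF F(2)] F(3) XK
    by (metis (no_types, lifting) continuous_on_cong continuous_on_subset subset_UNIV)
  have cont_g: "continuous_on X g"
    using smooth_g unfolding smooth_on_def has_gradient_on_def continuous_on_eq_continuous_within
    by (blast intro: has_derivative_continuous)
  have cont_\<Psi>: "continuous_on X \<Psi>" unfolding \<Psi>_def by (intro continuous_intros cont_f cont_g)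
  have \<Psi>_meas [measurable]: "(\<lambda>\<omega>. \<Psi> (x_out \<omega>)) \<in> borel_measurable M"
    by (rule measurable_continuous_on_compose[OF cont_\<Psi> out_meas]) (rule outX)
  have \<Psi>_int: "integrable M (\<lambda>\<omega>. \<Psi> (x_out \<omega>))"
  proof -
    have "bounded (\<Psi> ` X)" using compact_continuous_image[OF cont_\<Psi> compact_X] by (rule compact_imp_bounded)
    then obtain C where "\<forall>y\<in>\<Psi> ` X. norm y \<le> C" unfolding bounded_iff by blast
    thus ?thesis using outX by (intro integrable_const_bound[where B=C]) auto
  qed
  have gap_int: "integrable M (\<lambda>\<omega>. \<Psi> (x_out \<omega>) - \<Psi> x_opt)" using \<Psi>_int by simp
  have gap: "expectation (\<lambda>\<omega>. \<Psi> (x_out \<omega>) - \<Psi> x_opt) \<le> 20 * L * D\<^sup>2 / (real N * (real N + 1)) + 2 * r * G"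
  \<comment> \<open>If \<open>D = 0\<close>, strong convexity shrinks \<open>X\<close> to one point.
    The general argument divides by \<open>c\<close>, which would be 0 here.\<close>
  proof (cases "D = 0")
    case True
    have "x = x_opt" if "x \<in> X" for x
    proof -
      have "2 * V x_opt x \<le> D\<^sup>2" unfolding D_def by (rule V_le_diam[OF \<open>x_opt \<in> X\<close> that])
      hence "(lp_norm p (x - x_opt))\<^sup>2 \<le> D\<^sup>2" using V_lower[OF \<open>x_opt \<in> X\<close> that] by linarith
      hence "lp_norm p (x - x_opt) = 0" using True by simp
      hence "x - x_opt = 0" by (rule lp_norm_eq_0_imp[OF p])
      thus ?thesis by simp
    qed
    hence "x_out \<omega> = x_opt" for \<omega> using outX by blast
    thus ?thesis using True r G by simp
  next
    case False
    have D2: "0 < D\<^sup>2" using False by simp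
    define Fs where "Fs = smoothed F r"
    define m where "m = sqrt (real n) * pn * G"
    have m: "0 \<le> m" using pn G by (simp add: m_def)
    have m2: "m\<^sup>2 = v1" by (simp add: m_def v1_def power_mult_distrib)
    \<comment> \<open>Bounds the mean of \<open>(m + lp_norm q g)\<^sup>2\<close> for an estimate
      \<open>g\<close>: twice the squared Lipschitz constant plus twice the second moment.\<close>
    define B where "B = 2 * m\<^sup>2 + 2 * (59 * real n * G\<^sup>2 * pn\<^sup>2 + 2 * (real n)\<^sup>2 * pn\<^sup>2 * \<sigma>\<^sup>2 / r\<^sup>2)"
    have Beq: "B = 120 * v1 + 4 * v2"
      by (simp add: B_def m2 v1_def v2_def)
    have B0: "0 \<le> B" unfolding Beq using np ns by linarith
    \<comment> \<open>The slack in the constant \<open>20 = 2 (3/2 + 17/2)\<close>: the initial distance costs \<open>3/2\<close>.\<close>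
    have BQ: "4 * B \<le> 17 * Q" unfolding Beq Q distrib_left using np ns by linarith
    have FsX: "convex_on X Fs"
      unfolding Fs_def by (rule convex_on_subset[OF smoothed_convex[OF F(2) r F(1)] subset_UNIV convex_X])
    have Fs_lip: "Fs v - Fs w \<le> m * lp_norm p (v - w)" for v w
    proof -
      have "Fs v - Fs w \<le> G * norm (v - w)"
        using lipschitz_UNIV_D[OF smoothed_lipschitz[OF F(2) r], of v w] by (simp add: Fs_def)
      also have "\<dots> \<le> G * (sqrt (real n) * pn * lp_norm p (v - w))"
        unfolding n_def pn_def
        using G by (intro mult_left_mono norm_le_p_const_lp_norm[OF n2 p q \<open>1 / p + 1 / q = 1\<close>]) auto
      finally show ?thesis by (simp add: m_def mult_ac)
    qed
    have Fs_close: "\<bar>Fs x - f x\<bar> \<le> r * G" if "x \<in> X" for x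
      using smoothed_close[OF F(2) r, of x] F(3)[OF XK[OF that]] by (simp add: Fs_def)
    have step: "integrable M (\<lambda>\<omega>. step_err Fs m x_opt (Gr \<omega>) j t) \<and>
        expectation (\<lambda>\<omega>. step_err Fs m x_opt (Gr \<omega>) j t) \<le> B / (step_\<beta> (Suc j) * (real t + 1))"
      if j: "j < N" and t: "t < T (Suc j)" for j t
    proof -
      have kt: "(Suc j, t) \<in> I" by (rule idx[OF j t])
      define Y where "Y = (\<lambda>\<omega>. fst (inner_state (Gr \<omega>) j t))"
      have YX: "Y \<omega> \<in> X" for \<omega> unfolding Y_def by (rule inner_state_in)
      \<comment> \<open>The calls made before call \<open>(Suc j, t)\<close>, in the lexicographic
        order of outer and inner index.\<close>
      define A where "A = {(k', t'). (k', t') \<in> I \<and> (k' < Suc j \<or> k' = Suc j \<and> t' < t)}"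
      have A: "A \<subseteq> I" "(Suc j, t) \<notin> A" by (auto simp: A_def)
      \<comment> \<open>Stated for every \<open>M'\<close> because it is used twice: for the whole
        space, and for the algebra of the past, where it gives independence of the current
        sample.\<close>
      have Ymeas: "Y \<in> borel_measurable M'"
        if sp: "space M' = space M" and SA: "\<And>i. i \<in> A \<Longrightarrow> S i \<in> borel_measurable M'" for M'
      proof -
        have H: "measurable_oracle M' (\<lambda>\<omega>. Gr \<omega> k' t')" if "(k', t') \<in> A" for k' t'
          using that A(1) by (intro query SA sp) auto
        have "(\<lambda>\<omega>. fst (outer (Gr \<omega>) j)) \<in> borel_measurable M' \<and> (\<lambda>\<omega>. snd (outer (Gr \<omega>) j)) \<in> borel_measurable M'"
          by (rule measurable_outer[OF cg']) (use j in \<open>auto intro!: H simp: A_def I_def\<close>)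
        hence "(\<lambda>\<omega>. fst (inner_state (Gr \<omega>) j t)) \<in> borel_measurable M' \<and> (\<lambda>\<omega>. snd (inner_state (Gr \<omega>) j t)) \<in> borel_measurable M'"
          by (intro measurable_inner_state[OF cg']) (use j t in \<open>auto intro!: H simp: A_def I_def\<close>)
        thus ?thesis by (simp add: Y_def)
      qed
      have YM: "Y \<in> borel_measurable M" by (rule Ymeas) (use A SM in auto)
      have YP: "Y \<in> borel_measurable (past_alg (space M) S A)"
        by (rule Ymeas) (auto intro: measurable_past_alg)
      have triple: "(\<lambda>\<omega>. (Y \<omega>, 0::real, 0::real)) \<in> borel_measurable M'" if "Y \<in> borel_measurable M'" for M'
        using that by (intro borel_measurable_Pair) auto
      have "indep_var borel (\<lambda>\<omega>. (Y \<omega>, 0, 0)) borel (S (Suc j, t))"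
        by (rule indep_var_past[OF indS A(1) kt A(2) triple[OF YP] triple[OF YM]])
      hence ind: "indep_var borel (\<lambda>\<omega>. (Y \<omega>, 0, 0)) borel (\<lambda>\<omega>. (e (Suc j) t \<omega>, \<xi>p (Suc j) t \<omega>, \<xi>m (Suc j) t \<omega>))"
        by (simp add: S_def)
      interpret gs: gradient_sample M "e (Suc j) t" "\<xi>p (Suc j) t" "\<xi>m (Suc j) t" \<sigma>
      proof
        show "e (Suc j) t \<in> borel_measurable M" "\<xi>p (Suc j) t \<in> borel_measurable M" "\<xi>m (Suc j) t \<in> borel_measurable M"
          by (rule components[OF SM[OF kt]])+
      qed (use samples kt in \<open>auto simp: I_def\<close>)
      have b: "0 < step_\<beta> (Suc j) * (real t + 1)" using L_pos by (intro mult_pos_pos) auto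
      note mom = gs.random_step_moments[OF F(2,1) r G n2 q compact_imp_bounded[OF compact_X] \<open>x_opt \<in> X\<close> YX ind YM m b,
          folded n_def, folded pn_def, folded Fs_def B_def]
      have eq: "step_err Fs m x_opt (Gr \<omega>) j t =
          one_point_grad F r (Y \<omega>) (e (Suc j) t \<omega>) (\<xi>p (Suc j) t \<omega>) (\<xi>m (Suc j) t \<omega>) \<bullet> (x_opt - Y \<omega>) + Fs (Y \<omega>) - Fs x_opt +
          (m + lp_norm q (one_point_grad F r (Y \<omega>) (e (Suc j) t \<omega>) (\<xi>p (Suc j) t \<omega>) (\<xi>m (Suc j) t \<omega>)))\<^sup>2 / (step_\<beta> (Suc j) * (real t + 1))"
        if "\<omega> \<in> space M" for \<omega>
      proof -
        have "fst (inner_state (Gr \<omega>) j t) = Y \<omega>" by (simp add: Y_def)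
        thus ?thesis unfolding step_err_def using GrF[OF kt that YX] by simp
      qed
      show ?thesis
        using mom by (simp only: eq cong: Bochner_Integration.integrable_cong Bochner_Integration.integral_cong)
    qed
    \<comment> \<open>Replacing \<open>f\<close> by its smoothing costs \<open>r * G\<close> at the
      output and another \<open>r * G\<close> at the optimum.\<close>
    define \<Delta> where "\<Delta> = (\<lambda>\<omega>. \<Psi> (x_out \<omega>) - \<Psi> x_opt - 2 * r * G)"
    have \<Delta>int: "integrable M \<Delta>" unfolding \<Delta>_def using gap_int by simp
    have \<Delta>le: "\<Delta> \<omega> \<le> Fs (snd (outer (Gr \<omega>) N)) + g (snd (outer (Gr \<omega>) N)) - (Fs x_opt + g x_opt)" for \<omega>
      using Fs_close[OF outX[of \<omega>]] Fs_close[OF \<open>x_opt \<in> X\<close>]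
      unfolding \<Delta>_def \<Psi>_def out[symmetric] by linarith
    define c where "c = real N * (Q / (D\<^sup>2 * L\<^sup>2))"
    have c: "0 < c" unfolding c_def using \<open>N \<ge> 1\<close> Qpos D2 L_pos by simp
    have cT: "c * (real j + 1)\<^sup>2 \<le> real (T (Suc j))" for j
      unfolding T_alt c_def using real_nat_ceiling_ge[of "real N * (Q / (D\<^sup>2 * L\<^sup>2)) * (real (Suc j))\<^sup>2"]
      by (simp add: add.commute le_max_iff_disj)
    have "real N * (real N + 1) / 2 * expectation \<Delta> \<le> 3 * L * V x0 x_opt +
        (\<Sum>j<N. (real j + 1) / tri (Suc j) * (\<Sum>t<T (Suc j). (real t + 2) * (B / (step_\<beta> (Suc j) * (real t + 1)))))"
      by (rule expected_gap[OF prob_space_axioms \<open>x_opt \<in> X\<close> FsX Fs_lip \<Delta>int \<Delta>le]) (use step in auto)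
    also have "\<dots> \<le> 3 * L * V x0 x_opt + real N * (2 * B / (L * c))"
      by (intro add_left_mono error_sum_bound[OF c cT B0])
    \<comment> \<open>By the choice of \<open>T\<close>, \<open>N\<close> cancels in the error term
      and \<open>2 * L * D\<^sup>2 * B / Q\<close> remains. Dividing by the weight
      \<open>N * (N + 1) / 2\<close> then doubles the 10.\<close>
    also have "\<dots> \<le> 10 * L * D\<^sup>2"
    proof -
      have "2 * V x0 x_opt \<le> D\<^sup>2" unfolding D_def by (rule V_le_diam[OF x0 \<open>x_opt \<in> X\<close>])
      hence "3 / 2 * L * (2 * V x0 x_opt) \<le> 3 / 2 * L * D\<^sup>2" using L_pos by (intro mult_left_mono) auto
      moreover have "real N * (2 * B / (L * c)) = (2 * L * D\<^sup>2 / Q) * B"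
        unfolding c_def using \<open>N \<ge> 1\<close> Qpos D2 L_pos by (simp add: power2_eq_square)
      moreover have "(2 * L * D\<^sup>2 / Q) * B \<le> (2 * L * D\<^sup>2 / Q) * (17 / 4 * Q)"
        using BQ Qpos L_pos by (intro mult_left_mono) auto
      moreover have "(2 * L * D\<^sup>2 / Q) * (17 / 4 * Q) = 17 / 2 * L * D\<^sup>2" using Qpos by simp
      ultimately show ?thesis by simp
    qed
    finally have "real N * (real N + 1) / 2 * expectation \<Delta> \<le> 10 * L * D\<^sup>2" .
    moreover have "0 < real N * (real N + 1)" using \<open>N \<ge> 1\<close> by simp
    ultimately have "expectation \<Delta> \<le> 20 * L * D\<^sup>2 / (real N * (real N + 1))"
      by (simp add: pos_le_divide_eq mult_ac)
    moreover have "expectation \<Delta> = expectation (\<lambda>\<omega>. \<Psi> (x_out \<omega>) - \<Psi> x_opt) - 2 * r * G"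
      unfolding \<Delta>_def using gap_int prob_space by simp
    ultimately show ?thesis by simp
  qed
  show ?thesis using gap_int gap total by blast
qed

end
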